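(* Let $n\ge1$, $x=(x_1,\dots,x_n)$ and $\beta\in\mathbb{C}$ with $|\beta|<1$. For any $n$-partition $\lambda$, $$\mathrm{s}^{\mathrm{CB}}_{\lambda}(x;\beta) = K_{\lambda}(x;0,0;-\beta,0,0,0),$$ i.e. the CB-interpolating Schur polynomial indexed by $\lambda$ with parameter $\beta$ is the Koornwinder polynomial $K_\lambda(x;q,t;t_0,t_1,t_2,t_3)$ specialized at $q=t=0$, $t_0=-\beta$, $t_1=t_2=t_3=0$.
   Context: An $n$-partition is an $n$-tuple of integers $\lambda_1\ge\dots\ge\lambda_n\ge0$. CB-interpolating Schur polynomials. A half-triangular array of height $2n$ is $z=(z_{i,j})_{1\le i\le 2n,\,1\le j\le\lceil i/2\rceil}$. The interlacing conditions are $z_{i+1,j+1}\le z_{i,j}\le z_{i+1,j}$, each inequality being required whenever both entries exist. The shape of $z$ is its last row, and $\mathrm{type}(z)_i=\sum_{j=1}^{\lceil i/2\rceil}z_{i,j}-\sum_{j=1}^{\lceil (i-1)/2\rceil}z_{i-1,j}$. For an $n$-partition $\lambda$, $\mathrm{soP}^{(2n)}_\lambda$ is the set of such arrays of shape $\lambda$ satisfying the interlacing conditions, whose odd ends $z_{2i-1,i}$ ($1\le i\le n$) lie in $\frac12\mathbb{Z}_{\ge0}$ and whose other entries all lie in $\mathbb{Z}_{\ge0}$ (split orthogonal patterns); $|\mathfrak a(z)|$ is the number of entries of $z$ in $\frac12+\mathbb{Z}$. Then $$\mathrm{s}^{\mathrm{CB}}_\lambda(x;\beta)=\sum_{z\in\mathrm{soP}^{(2n)}_\lambda}\beta^{|\mathfrak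 a(z)|}\prod_{i=1}^n x_i^{\mathrm{type}(z)_{2i}-\mathrm{type}(z)_{2i-1}}\qquad(0^0=1).$$ Koornwinder polynomials. Let $(z;q)_\infty=\prod_{k\ge0}(1-q^kz)$ (so $(z;0)_\infty=1-z$) and $$\Delta(x;q,t;t_0,t_1,t_2,t_3)=\prod_{i=1}^n\prod_{\epsilon=\pm1}\frac{(x_i^{2\epsilon};q)_\infty}{\prod_{k=0}^3(t_kx_i^\epsilon;q)_\infty}\prod_{1\le i<j\le n}\prod_{\epsilon,\delta=\pm1}\frac{(x_i^\epsilon x_j^\delta;q)_\infty}{(t x_i^\epsilon x_j^\delta;q)_\infty}.$$ For $|q|,|t|,|t_0|,\dots,|t_3|<1$ and Laurent polynomials $f,g$ over $\mathbb{C}$ let $$\langle f,g\rangle=\frac{1}{2^n n!(2\pi \mathrm{i})^n}\int_{\mathbb{T}^n}f(x)g(x^{-1})\Delta(x;q,t;t_0,t_1,t_2,t_3)\prod_{i=1}^n\frac{dx_i}{x_i},\qquad \mathbb{T}^n=\{|x_1|=\dots=|x_n|=1\}.$$ The Koornwinder polynomials $K_\lambda=K_\lambda(x;q,t;t_0,t_1,t_2,t_3)$, indexed by $n$-partitions $\lambda$, are the unique family of Laurent polynomials in $x$ over $\mathbb{C}$ such that: each $K_\lambda$ is invariant under permutations of the $x_i$'s and under inversion $x_i\mapsto x_i^{-1}$ of any of them; $\langle K_\lambda,K_\mu\rangle=0$ for $\lambda\ne\mu$; for any $n$-partition $\mu$, the coefficient of $x_1^{\mu_1}\cdots x_n^{\mu_n}$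 in $K_\lambda$ is zero unless $\mu_1+\dots+\mu_k\le\lambda_1+\dots+\lambda_k$ for all $1\le k\le n$, and the coefficient of $x_1^{\lambda_1}\cdots x_n^{\lambda_n}$ is $1$. *)

theory Defs
  imports
    "HOL-Analysis.Analysis"
    "HOL-Combinatorics.Permutations"
    "HOL-Library.Poly_Mapping"
begin

section \<open>Laurent polynomials in \<open>x\<^sub>1, \<dots>, x\<^sub>n\<close> over the complex numbers\<close>

text \<open>
  An integer vector \<open>m = (m\<^sub>1, \<dots>, m\<^sub>n)\<close> is a finitely supported function \<open>nat \<Rightarrow>\<^sub>0 int\<close>
  that vanishes outside \<open>{1..n}\<close>. Laurent polynomials form the group algebra over these vectors:
  \<open>lookup f m\<close> is the coefficient of \<open>x\<^sub>1\<^bsup>m\<^sub>1\<^esup> \<cdots> x\<^sub>n\<^bsup>m\<^sub>n\<^esup>\<close> in \<open>f\<close>.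
\<close>

type_synonym exponent = "nat \<Rightarrow>\<^sub>0 int"
type_synonym laurent = "exponent \<Rightarrow>\<^sub>0 complex"

definition int_vectors :: "nat \<Rightarrow> exponent set" where
  "int_vectors n = {m. Poly_Mapping.keys m \<subseteq> {1..n}}"

definition laurent_polys :: "nat \<Rightarrow> laurent set" where
  "laurent_polys n = {f. Poly_Mapping.keys f \<subseteq> int_vectors n}"

definition laurent_eval :: "nat \<Rightarrow> laurent \<Rightarrow> (nat \<Rightarrow> complex) \<Rightarrow> complex" where
  "laurent_eval n f x =
     (\<Sum>m\<in>Poly_Mapping.keys f. Poly_Mapping.lookup f m * (\<Prod>i\<in>{1..n}. x i powi Poly_Mapping.lookup m i))"

text \<open>The image of \<open>f\<close> under the linear map that sends the monomial \<open>x\<^sup>m\<close> to \<open>x\<^bsup>\<phi> m\<^esup>\<close>.\<close>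

definition monomial_subst :: "(exponent \<Rightarrow> exponent) \<Rightarrow> laurent \<Rightarrow> laurent" where
  "monomial_subst \<phi> f =
     (\<Sum>m\<in>Poly_Mapping.keys f. Poly_Mapping.single (\<phi> m) (Poly_Mapping.lookup f m))"

text \<open>
  \<open>map_key \<sigma> m\<close> is the vector with entries \<open>m\<^bsub>\<sigma> i\<^esub>\<close>, so the first condition is invariance under the
  substitutions \<open>x\<^bsub>\<sigma> i\<^esub> \<mapsto> x\<^sub>i\<close>; the second one is invariance under \<open>x\<^sub>i \<mapsto> x\<^sub>i\<^sup>-\<^sup>1\<close>.
\<close>

definition bc_invariant :: "nat \<Rightarrow> laurent \<Rightarrow> bool" where
  "bc_invariant n f \<longleftrightarrow>
     (\<forall>\<sigma>. \<sigma> permutes {1..n} \<longrightarrow> monomial_subst (Poly_Mapping.map_key \<sigma>) f = f) \<and>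
     (\<forall>i\<in>{1..n}. monomial_subst (\<lambda>m. Poly_Mapping.update i (- Poly_Mapping.lookup m i) m) f = f)"

definition partitions :: "nat \<Rightarrow> exponent set" where
  "partitions n = {\<kappa>\<in>int_vectors n.
     (\<forall>i\<in>{1..n}. 0 \<le> Poly_Mapping.lookup \<kappa> i) \<and>
     (\<forall>i\<in>{1..<n}. Poly_Mapping.lookup \<kappa> (i + 1) \<le> Poly_Mapping.lookup \<kappa> i)}"


section \<open>CB-interpolating Schur polynomials\<close>

text \<open>
  Row \<open>i\<close> of a half-triangular array has \<open>\<lceil>i/2\<rceil> = (i + 1) div 2\<close> entries. Arrays are functions
  that vanish outside the index set.
\<close>

definition array_index :: "nat \<Rightarrow> (nat \<times> nat) set" where
  "array_index n = {(i, j). i \<in> {1..2 * n} \<and> j \<in> {1..(i + 1) div 2}}"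

definition odd_ends :: "nat \<Rightarrow> (nat \<times> nat) set" where
  "odd_ends n = {(2 * i - 1, i) | i. i \<in> {1..n}}"

definition array_type :: "(nat \<Rightarrow> nat \<Rightarrow> rat) \<Rightarrow> nat \<Rightarrow> rat" where
  "array_type z i = (\<Sum>j\<in>{1..(i + 1) div 2}. z i j) - (\<Sum>j\<in>{1..i div 2}. z (i - 1) j)"

definition interlacing :: "nat \<Rightarrow> (nat \<Rightarrow> nat \<Rightarrow> rat) \<Rightarrow> bool" where
  "interlacing n z \<longleftrightarrow>
     (\<forall>i j. (i, j) \<in> array_index n \<and> (i + 1, j + 1) \<in> array_index n \<longrightarrow> z (i + 1) (j + 1) \<le> z i j) \<and>
     (\<forall>i j. (i, j) \<in> array_index n \<and> (i + 1, j) \<in> array_index n \<longrightarrow> z i j \<le> z (i + 1) j)"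

definition split_orthogonal_patterns :: "nat \<Rightarrow> exponent \<Rightarrow> (nat \<Rightarrow> nat \<Rightarrow> rat) set" where
  "split_orthogonal_patterns n \<kappa> = {z.
     (\<forall>i j. (i, j) \<notin> array_index n \<longrightarrow> z i j = 0) \<and>
     (\<forall>j\<in>{1..n}. z (2 * n) j = of_int (Poly_Mapping.lookup \<kappa> j)) \<and>
     interlacing n z \<and>
     (\<forall>(i, j)\<in>odd_ends n. 2 * z i j \<in> \<nat>) \<and>
     (\<forall>(i, j)\<in>array_index n - odd_ends n. z i j \<in> \<nat>)}"

definition half_entries :: "nat \<Rightarrow> (nat \<Rightarrow> nat \<Rightarrow> rat) \<Rightarrow> (nat \<times> nat) set" where
  "half_entries n z = {(i, j)\<in>array_index n. z i j - 1 / 2 \<in> \<int>}"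

text \<open>
  The differences of types are integers for split orthogonal patterns (lemma
  \<open>array_type_diff_Ints\<close> below), so the floor only converts from \<open>rat\<close> to \<open>int\<close>.
\<close>

definition pattern_exponent :: "nat \<Rightarrow> (nat \<Rightarrow> nat \<Rightarrow> rat) \<Rightarrow> exponent" where
  "pattern_exponent n z =
     (\<Sum>i\<in>{1..n}. Poly_Mapping.single i \<lfloor>array_type z (2 * i) - array_type z (2 * i - 1)\<rfloor>)"

definition schur_CB :: "nat \<Rightarrow> exponent \<Rightarrow> complex \<Rightarrow> laurent" where
  "schur_CB n \<kappa> \<beta> =
     (\<Sum>z\<in>split_orthogonal_patterns n \<kappa>.
        Poly_Mapping.single (pattern_exponent n z) (\<beta> ^ card (half_entries n z)))"

lemma array_type_diff_Ints:
  assumes z: "z \<in> split_orthogonal_patterns n \<kappa>" and i: "i \<in> {1..n}"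
  shows "array_type z (2 * i) - array_type z (2 * i - 1) \<in> \<int>"
proof -
  obtain k where k: "i = Suc k"
    using i by (cases i) auto
  have odd_end: "2 * z (2 * i - 1) i \<in> \<int>"
    using z i Nats_subset_Ints by (fastforce simp: split_orthogonal_patterns_def odd_ends_def)
  have other: "z a b \<in> \<int>" if "(a, b) \<notin> odd_ends n" for a b
    using z that Nats_subset_Ints
    by (cases "(a, b) \<in> array_index n") (fastforce simp: split_orthogonal_patterns_def)+
  have even_row: "z (2 * a) b \<in> \<int>" for a b
    by (rule other) (auto simp: odd_ends_def; presburger)
  have odd_row: "z (2 * i - 1) b \<in> \<int>" if "b \<noteq> i" for b
    by (rule other) (use that i in \<open>auto simp: odd_ends_def\<close>)
  have split: "(\<Sum>j\<in>{1..i}. z (2 * i - 1) j) = (\<Sum>j\<in>{1..k}. z (2 * i - 1) j) + z (2 * i - 1) i"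
    by (simp add: k)
  have "array_type z (2 * i) - array_type z (2 * i - 1)
      = (\<Sum>j\<in>{1..i}. z (2 * i) j) - 2 * (\<Sum>j\<in>{1..i}. z (2 * i - 1) j) + (\<Sum>j\<in>{1..k}. z (2 * k) j)"
    by (simp add: array_type_def k)
  also have "\<dots> = (\<Sum>j\<in>{1..i}. z (2 * i) j) - 2 * (\<Sum>j\<in>{1..k}. z (2 * i - 1) j)
                   - 2 * z (2 * i - 1) i + (\<Sum>j\<in>{1..k}. z (2 * k) j)"
    unfolding split by (simp add: algebra_simps)
  also have "\<dots> \<in> \<int>"
    by (intro Ints_add Ints_diff Ints_mult Ints_sum even_row odd_row odd_end) (auto simp: k)
  finally show ?thesis .
qed

lemma finite_array_index: "finite (array_index n)"
  by (rule finite_subset[of _ "{1..2 * n} \<times> {1..2 * n}"]) (auto simp: array_index_def)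

lemma finite_split_orthogonal_patterns: "finite (split_orthogonal_patterns n \<kappa>)"
proof -
  define M where "M = (\<Sum>j\<in>{1..n}. \<bar>of_int (Poly_Mapping.lookup \<kappa> j) :: rat\<bar>)"
  define V where "V = (\<lambda>k. of_nat k / 2 :: rat) ` {..nat \<lfloor>2 * M\<rfloor>}"
  have bound: "z i j \<in> V"
    if z: "z \<in> split_orthogonal_patterns n \<kappa>" and ij: "(i, j) \<in> array_index n" for z i j
  proof -
    have "z i j \<le> z (i + d) j" if "i + d \<le> 2 * n" for d
      using that
    proof (induction d)
      case (Suc d)
      have "(i + d, j) \<in> array_index n" "(i + d + 1, j) \<in> array_index n"
        using ij Suc.prems by (auto simp: array_index_def)
      then have "z (i + d) j \<le> z (i + d + 1) j"
        using z by (simp add: split_orthogonal_patterns_def interlacing_def)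
      then show ?case
        using Suc by simp
    qed simp
    from this[of "2 * n - i"] have "z i j \<le> z (2 * n) j"
      using ij by (simp add: array_index_def)
    also have j: "j \<in> {1..n}"
      using ij by (auto simp: array_index_def)
    then have "z (2 * n) j \<le> \<bar>of_int (Poly_Mapping.lookup \<kappa> j)\<bar>"
      using z by (simp add: split_orthogonal_patterns_def)
    also have "\<dots> \<le> M"
      unfolding M_def by (rule member_le_sum) (use j in auto)
    finally have le: "z i j \<le> M" .
    have "2 * z i j \<in> \<nat>"
    proof (cases "(i, j) \<in> odd_ends n")
      case True
      then show ?thesis
        using z by (auto simp: split_orthogonal_patterns_def)
    next
      case False
      then have "z i j \<in> \<nat>"
        using z ij by (auto simp: split_orthogonal_patterns_def)
      then show ?thesis
        by (intro Nats_mult) auto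
    qed
    then obtain k where k: "2 * z i j = of_nat k"
      by (auto elim: Nats_cases)
    then have "of_nat k \<le> 2 * M"
      using le by linarith
    then have "int k \<le> \<lfloor>2 * M\<rfloor>"
      by (simp add: le_floor_iff)
    then have "k \<le> nat \<lfloor>2 * M\<rfloor>"
      by linarith
    moreover have "z i j = of_nat k / 2"
      using k by simp
    ultimately show ?thesis
      unfolding V_def by blast
  qed
  have "finite {f. (\<forall>p. (p \<in> array_index n \<longrightarrow> f p \<in> V) \<and> (p \<notin> array_index n \<longrightarrow> f p = 0))}"
    by (rule finite_set_of_finite_funs) (auto simp: finite_array_index V_def)
  moreover have "case_prod ` split_orthogonal_patterns n \<kappa> \<subseteq>
      {f. (\<forall>p. (p \<in> array_index n \<longrightarrow> f p \<in> V) \<and> (p \<notin> array_index n \<longrightarrow> f p = 0))}"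
    using bound by (auto simp: split_orthogonal_patterns_def)
  ultimately have "finite (case_prod ` split_orthogonal_patterns n \<kappa>)"
    by (rule rev_finite_subset)
  then show ?thesis
    by (rule finite_imageD) (auto simp: inj_on_def fun_eq_iff)
qed


section \<open>Koornwinder polynomials\<close>

definition qpoch_inf :: "complex \<Rightarrow> complex \<Rightarrow> complex" where
  "qpoch_inf z q = prodinf (\<lambda>k. 1 - q ^ k * z)"

definition koornwinder_density ::
  "nat \<Rightarrow> complex \<Rightarrow> complex \<Rightarrow> complex \<Rightarrow> complex \<Rightarrow> complex \<Rightarrow> complex \<Rightarrow> (nat \<Rightarrow> complex) \<Rightarrow> complex"
where
  "koornwinder_density n q t t0 t1 t2 t3 x =
     (\<Prod>i\<in>{1..n}. \<Prod>\<epsilon>\<in>{1, -1::int}.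
        qpoch_inf (x i powi (2 * \<epsilon>)) q /
        (qpoch_inf (t0 * x i powi \<epsilon>) q * qpoch_inf (t1 * x i powi \<epsilon>) q *
         qpoch_inf (t2 * x i powi \<epsilon>) q * qpoch_inf (t3 * x i powi \<epsilon>) q)) *
     (\<Prod>(i, j)\<in>{(i, j). 1 \<le> i \<and> i < j \<and> j \<le> n}. \<Prod>\<epsilon>\<in>{1, -1::int}. \<Prod>\<delta>\<in>{1, -1::int}.
        qpoch_inf (x i powi \<epsilon> * x j powi \<delta>) q / qpoch_inf (t * x i powi \<epsilon> * x j powi \<delta>) q)"

text \<open>
  The integral of \<open>F(x) dx\<^sub>1 \<cdots> dx\<^sub>n\<close> over the torus \<open>|x\<^sub>1| = \<dots> = |x\<^sub>n| = 1\<close>, parametrized by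
  \<open>x\<^sub>k = exp(\<i> \<theta>\<^sub>k)\<close> with \<open>0 \<le> \<theta>\<^sub>k \<le> 2\<pi>\<close>, so that \<open>dx\<^sub>k = \<i> x\<^sub>k d\<theta>\<^sub>k\<close>.
\<close>

definition torus_integral :: "nat \<Rightarrow> ((nat \<Rightarrow> complex) \<Rightarrow> complex) \<Rightarrow> complex" where
  "torus_integral n F =
     (LINT \<theta>|Pi\<^sub>M {1..n} (\<lambda>_. restrict_space lborel {0..2 * pi}).
        F (\<lambda>k. cis (\<theta> k)) * (\<Prod>k\<in>{1..n}. \<i> * cis (\<theta> k)))"

definition koornwinder_inner ::
  "nat \<Rightarrow> complex \<Rightarrow> complex \<Rightarrow> complex \<Rightarrow> complex \<Rightarrow> complex \<Rightarrow> complex \<Rightarrow> laurent \<Rightarrow> laurent \<Rightarrow> complex"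
where
  "koornwinder_inner n q t t0 t1 t2 t3 f g =
     1 / (2 ^ n * fact n * (2 * of_real pi * \<i>) ^ n) *
     torus_integral n (\<lambda>x. laurent_eval n f x * laurent_eval n g (\<lambda>i. inverse (x i)) *
       koornwinder_density n q t t0 t1 t2 t3 x * (\<Prod>i\<in>{1..n}. 1 / x i))"

definition is_koornwinder_family ::
  "nat \<Rightarrow> complex \<Rightarrow> complex \<Rightarrow> complex \<Rightarrow> complex \<Rightarrow> complex \<Rightarrow> complex \<Rightarrow> (exponent \<Rightarrow> laurent) \<Rightarrow> bool"
where
  "is_koornwinder_family n q t t0 t1 t2 t3 K \<longleftrightarrow>
     (\<forall>\<kappa>\<in>partitions n. K \<kappa> \<in> laurent_polys n \<and> bc_invariant n (K \<kappa>)) \<and>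
     (\<forall>\<kappa>\<in>partitions n. \<forall>\<mu>\<in>partitions n. \<kappa> \<noteq> \<mu> \<longrightarrow>
        koornwinder_inner n q t t0 t1 t2 t3 (K \<kappa>) (K \<mu>) = 0) \<and>
     (\<forall>\<kappa>\<in>partitions n. \<forall>\<mu>\<in>partitions n.
        \<not> (\<forall>k\<in>{1..n}. (\<Sum>i\<in>{1..k}. Poly_Mapping.lookup \<mu> i) \<le> (\<Sum>i\<in>{1..k}. Poly_Mapping.lookup \<kappa> i)) \<longrightarrow>
        Poly_Mapping.lookup (K \<kappa>) \<mu> = 0) \<and>
     (\<forall>\<kappa>\<in>partitions n. Poly_Mapping.lookup (K \<kappa>) \<kappa> = 1)"

text \<open>
  The family is indexed by the \<open>n\<close>-partitions only; \<open>extensional\<close> fixes its values elsewhere, which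
  is needed for uniqueness as a HOL function. The parameters are meant to lie in the open unit disc.
\<close>

definition koornwinder ::
  "nat \<Rightarrow> complex \<Rightarrow> complex \<Rightarrow> complex \<Rightarrow> complex \<Rightarrow> complex \<Rightarrow> complex \<Rightarrow> exponent \<Rightarrow> laurent"
where
  "koornwinder n q t t0 t1 t2 t3 =
     (THE K. K \<in> extensional (partitions n) \<and> is_koornwinder_family n q t t0 t1 t2 t3 K)"

end

theory Submission
  imports Defs "Jordan_Normal_Form.Determinant"
begin

text \<open>
  Write \<open>[k] = x\<^sup>k - x\<^sup>-\<^sup>k\<close> and \<open>a\<^sub>k(x) = [k] + \<beta> [k - 1]\<close>. At \<open>q = t = 0\<close> the density is
  \<open>\<delta>(x) \<delta>(x\<^sup>-\<^sup>1) / \<Prod>\<^sub>i (1 + \<beta> x\<^sub>i) (1 + \<beta> x\<^sub>i\<^sup>-\<^sup>1)\<close> with \<open>\<delta>\<close> the Weyl denominator of type C, and the functions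
  \<open>a\<^sub>k\<close>, \<open>k \<ge> 1\<close>, are orthogonal for the one-variable weight. Hence polynomials \<open>P\<^sub>\<kappa>\<close> with
  \<open>P\<^sub>\<kappa> \<delta> = det (a\<^bsub>l\<^sub>j\<^esub>(x\<^sub>i))\<close>, where \<open>l\<^sub>j = \<kappa>\<^sub>j + n - j + 1\<close>, are orthogonal. That the CB-interpolating Schur
  polynomials have this determinantal form is shown by induction on the number of variables: after removal
  of the last two rows of a pattern the remaining sums run over independent intervals, so they can be
  carried out inside the columns of the determinant, where they telescope because of
  \<open>a\<^bsub>k+1\<^esub> + a\<^bsub>k-1\<^esub> = (x + x\<^sup>-\<^sup>1) a\<^sub>k\<close>. Triangularity is read off from the patterns, and uniqueness of the
  Koornwinder family holds because all the norms are nonzero.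
\<close>

section \<open>Alternants\<close>

text \<open>The half-integral odd ends act at the lower boundary of the last column. There the two
  kinds of odd end (integer, proper half-integer) contribute boundary terms a_0 and \<beta> a_1,
  which cancel in the rows of the old variables because a_0 = - \<beta> a_1. The determinant must
  also grow from size n to n + 1: a bordering row of ones is added for the new variable, the second
  summation turns its entries into powers of x_{n+1}, and the boundary terms, which do not cancel in
  this row, supply the part x^k + \<beta> x^{k-1} of a_k(x_{n+1}). Identities are kept free of
  division; factors such as 1 + \<beta> x_{n+1} and powers of x_{n+1} are cancelled in the integral
  domain of Laurent polynomials. At the zero partition the determinantal formula identifies the Weyl
  denominator itself with a determinant, so the symmetry of the quotient follows from that of
  determinants. The pairing is bilinear, and for complex \<beta> its density need not be positive,
  so nonvanishing of the norms has to come from explicit integration.\<close>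

definition alternant :: "nat \<Rightarrow> (nat \<Rightarrow> nat \<Rightarrow> 'a) \<Rightarrow> 'a::comm_ring_1" where
  "alternant n f = Determinant.det (Matrix.mat n n (\<lambda>(i, j). f (Suc i) (Suc j)))"

lemma prod_Suc_shift: "(\<Prod>i\<in>{0..<n}. f (Suc i)) = (\<Prod>i\<in>{1..n}. f i)"
  by (simp add: prod.shift_bounds_Suc_ivl[symmetric] atLeastLessThanSuc_atLeastAtMost
      del: prod.shift_bounds_Suc_ivl)

lemma alternant_by_rows:
  "alternant n f = (\<Sum>p\<in>{p. p permutes {0..<n}}. signof p * (\<Prod>i\<in>{0..<n}. f (Suc i) (Suc (p i))))"
  unfolding alternant_def
  by (subst det_def'[where n = n]) (auto intro!: sum.cong prod.cong simp: permutes_in_image)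

lemma alternant_by_columns:
  "alternant n f = (\<Sum>p\<in>{p. p permutes {0..<n}}. signof p * (\<Prod>j\<in>{0..<n}. f (Suc (p j)) (Suc j)))"
  unfolding alternant_def
  by (subst det_col[where n = n])
    (auto intro!: sum.cong prod.cong simp: permutes_in_image lessThan_atLeast0)

lemma alternant_cong:
  assumes "\<And>i j. i \<in> {1..n} \<Longrightarrow> j \<in> {1..n} \<Longrightarrow> f i j = g i j"
  shows "alternant n f = alternant n g"
  unfolding alternant_def by (rule arg_cong[of _ _ Determinant.det]) (auto intro!: eq_matI assms)

lemma alternant_scale_rows:
  "alternant n (\<lambda>i j. r i * f i j) = (\<Prod>i\<in>{1..n}. r i) * alternant n f"
  by (simp add: alternant_by_rows prod.distrib sum_distrib_left prod_Suc_shift algebra_simps)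

lemma alternant_scale_columns:
  "alternant n (\<lambda>i j. r j * f i j) = (\<Prod>j\<in>{1..n}. r j) * alternant n f"
  by (simp add: alternant_by_columns prod.distrib sum_distrib_left prod_Suc_shift algebra_simps)

text \<open>Multilinearity: expanding a sum in every column produces one determinant for each family
  \<open>c\<close> of independent choices. It applies to rows of patterns once each entry ranges
  over its own interval.\<close>

lemma alternant_sum_columns:
  assumes "\<And>j. j \<in> {1..n} \<Longrightarrow> finite (K j)"
  shows "(\<Sum>c\<in>PiE {1..n} K. alternant n (\<lambda>i j. g i j (c j))) = alternant n (\<lambda>i j. \<Sum>k\<in>K j. g i j k)"
proof -
  have *: "(\<Prod>j\<in>{0..<n}. \<Sum>k\<in>K (Suc j). g (Suc (p j)) (Suc j) k)
      = (\<Sum>c\<in>PiE {1..n} K. \<Prod>j\<in>{0..<n}. g (Suc (p j)) (Suc j) (c (Suc j)))" for p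
    using prod_sum_PiE[of "{1..n}" K "\<lambda>j. g (Suc (p (j - 1))) j"] assms
    by (simp only: prod_Suc_shift[symmetric] finite_atLeastAtMost diff_Suc_1)
  show ?thesis
    unfolding alternant_by_columns * sum_distrib_left by (rule sum.swap)
qed

lemma alternant_last_column:
  assumes "\<And>i j. i \<in> {1..Suc n} \<Longrightarrow> j \<in> {1..n} \<Longrightarrow> f i j = g i j"
  shows "x * alternant (Suc n) f + z * alternant (Suc n) g
    = alternant (Suc n) (\<lambda>i j. if j = Suc n then x * f i j + z * g i j else f i j)"
proof -
  have "(\<Prod>j\<in>{0..<n}. g (Suc (p j)) (Suc j)) = (\<Prod>j\<in>{0..<n}. f (Suc (p j)) (Suc j))"
    if "p permutes {0..<Suc n}" for p
  proof (rule prod.cong)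
    fix j assume "j \<in> {0..<n}"
    moreover from this have "p j \<in> {0..<Suc n}"
      using permutes_in_image[OF that, of j] by auto
    ultimately show "g (Suc (p j)) (Suc j) = f (Suc (p j)) (Suc j)"
      by (intro assms[symmetric]) auto
  qed simp
  then show ?thesis
    unfolding alternant_by_columns sum_distrib_left sum.distrib[symmetric]
    by (intro sum.cong) (auto simp: algebra_simps)
qed

text \<open>Subtracting from each column its right neighbour is right multiplication by the
  unitriangular matrix \<open>T\<close>.\<close>

lemma alternant_telescope:
  fixes g :: "nat \<Rightarrow> nat \<Rightarrow> 'a::comm_ring_1"
  shows "alternant n (\<lambda>i j. if j < n then g i j - g i (Suc j) else g i j) = alternant n g"
proof -
  define G where "G = Matrix.mat n n (\<lambda>(i, j). g (Suc i) (Suc j))"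
  define T :: "'a Matrix.mat" where "T = Matrix.mat n n (\<lambda>(i, j). if i = j then 1 else if i = Suc j then - 1 else 0)"
  have dT: "Determinant.det T = 1"
  proof -
    have "Determinant.det T = prod_list (diag_mat T)"
      by (rule det_lower_triangular[where n = n]) (auto simp: T_def)
    also have "diag_mat T = map (\<lambda>_. 1) [0..<n]"
      by (auto simp: diag_mat_def T_def)
    finally show ?thesis by (simp add: map_replicate_const)
  qed
  have "Matrix.mat n n (\<lambda>(i, j). if Suc j < n then g (Suc i) (Suc j) - g (Suc i) (Suc (Suc j)) else g (Suc i) (Suc j)) = G * T"
  proof (rule eq_matI)
    fix i j assume ij: "i < dim_row (G * T)" "j < dim_col (G * T)"
    then have [simp]: "i < n" "j < n" by (auto simp: G_def T_def)
    have "(G * T) $$ (i, j) = (\<Sum>k\<in>{0..<n}. g (Suc i) (Suc k) * (if k = j then 1 else if k = Suc j then - 1 else 0))"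
      by (simp add: G_def T_def scalar_prod_def)
    also have "\<dots> = (\<Sum>k\<in>{0..<n}. (if k = j then g (Suc i) (Suc k) else 0) + (if k = Suc j then - g (Suc i) (Suc k) else 0))"
      by (intro sum.cong) auto
    also have "\<dots> = g (Suc i) (Suc j) + (if Suc j < n then - g (Suc i) (Suc (Suc j)) else 0)"
      by (simp add: sum.distrib)
    finally show "Matrix.mat n n (\<lambda>(i, j). if Suc j < n then g (Suc i) (Suc j) - g (Suc i) (Suc (Suc j)) else g (Suc i) (Suc j)) $$ (i, j) = (G * T) $$ (i, j)"
      by simp
  qed (auto simp: G_def T_def)
  moreover have "Determinant.det (G * T) = Determinant.det G * Determinant.det T"
    by (rule det_mult[where n = n]) (auto simp: G_def T_def)
  ultimately show ?thesis
    by (simp add: alternant_def dT G_def cong: if_cong)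
qed

text \<open>Laplace expansion along the last row (0, ..., 0, 1). It is applied from right to left,
  to enlarge a determinant by one row and column.\<close>

lemma alternant_border:
  assumes "\<And>j. j \<in> {1..n} \<Longrightarrow> f (Suc n) j = 0" "f (Suc n) (Suc n) = 1"
  shows "alternant (Suc n) f = alternant n f"
proof -
  let ?A = "Matrix.mat (Suc n) (Suc n) (\<lambda>(i, j). f (Suc i) (Suc j))"
  have "Determinant.det ?A = (\<Sum>j<Suc n. ?A $$ (n, j) * cofactor ?A n j)"
    by (rule laplace_expansion_row[where n = "Suc n"]) auto
  also have "\<dots> = cofactor ?A n n"
    using assms by simp
  also have "\<dots> = Determinant.det (mat_delete ?A n n)"
    by (simp add: cofactor_def power_add[symmetric] mult_2[symmetric])
  also have "mat_delete ?A n n = Matrix.mat n n (\<lambda>(i, j). f (Suc i) (Suc j))"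
    by (rule eq_matI) (auto simp: mat_delete_def)
  finally show ?thesis by (simp add: alternant_def)
qed

text \<open>The bound \<open>p \<le> q + 1\<close> admits the empty range. That case occurs for a
  half-integral odd end below a zero last part.\<close>

lemma sum_telescope_int:
  fixes g :: "int \<Rightarrow> 'a::ab_group_add"
  assumes "p \<le> q + 1"
  shows "(\<Sum>k\<in>{p..q}. g (k + 1) - g k) = g (q + 1) - g p"
proof -
  have "(\<Sum>k\<in>{p..p + int d - 1}. g (k + 1) - g k) = g (p + int d) - g p" for d
  proof (induction d)
    case (Suc d)
    have "{p..p + int (Suc d) - 1} = insert (p + int d) {p..p + int d - 1}" by auto
    then show ?case using Suc by (simp add: algebra_simps)
  qed simp
  from this[of "nat (q + 1 - p)"] show ?thesis using assms by simp
qed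

section \<open>Summation over two rows inside an alternant\<close>

text \<open>The intended model is \<open>y k\<close> = x^k for the variable x = x_{n+1} that is
  added in the induction.\<close>

locale exponential =
  fixes y :: "int \<Rightarrow> 'a::idom"
  assumes add: "y (k + l) = y k * y l" and zero: "y 0 = 1"
begin

lemma minus: "y (- k) * y k = 1"
  using add[of "- k" k] by (simp add: zero)

lemma sum: "finite A \<Longrightarrow> y (\<Sum>i\<in>A. f i) = (\<Prod>i\<in>A. y (f i))"
  by (induction A rule: finite_induct) (auto simp: add zero)

end

text \<open>The intended model is \<open>a i k\<close> = a_k(x_i), \<open>u i\<close> = x_i + 1/x_i,
  \<open>b\<close> = \<beta>. The assumption \<open>start\<close> is the only property of
  \<open>a\<close> that involves \<open>b\<close>.\<close>

locale three_term = exponential y for y :: "int \<Rightarrow> 'a::idom" +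
  fixes a :: "nat \<Rightarrow> int \<Rightarrow> 'a" and u :: "nat \<Rightarrow> 'a" and b :: 'a
  assumes rec: "a i (k + 1) + a i (k - 1) = u i * a i k"
    and start: "a i 0 = - b * a i 1"
begin

text \<open>
  Summation by parts: \<open>f i\<close> is an antidifference of \<open>r i * (y k * a i k)\<close> and \<open>g i\<close> one of \<open>y (- 2 * k) * f i k\<close>.
  \<open>F\<close> and \<open>G\<close> append the bordering row; its entries become telescoping only after scaling by \<open>1 - y 2\<close>,
  which is what \<open>R\<close> does.
\<close>

definition r where "r i = 1 + y 2 - y 1 * u i"
definition f where "f i k = y (k + 1) * a i (k - 1) - y k * a i k"
definition g where "g i k = - y (- k) * a i k"

lemma f_step: "f i (k + 1) - f i k = r i * (y k * a i k)"
proof -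
  have e: "y (k + 1 + 1) = y k * y 2" "y (k + 1) = y k * y 1"
    by (simp_all add: add[symmetric] add.commute)
  have "y 2 = y 1 * y 1" by (simp add: add[symmetric])
  have "f i (k + 1) - f i k = y k * y 2 * a i k + y k * a i k - y k * y 1 * (a i (k + 1) + a i (k - 1))"
    using e by (simp add: f_def) (simp add: algebra_simps)
  also have "\<dots> = r i * (y k * a i k)"
    unfolding rec by (simp add: r_def algebra_simps)
  finally show ?thesis .
qed

lemma g_step: "y (- 2 * k) * f i k = g i k - g i (k - 1)"
proof -
  have "y (- 2 * k) * y (k + 1) = y (- (k - 1))" "y (- 2 * k) * y k = y (- k)"
    by (simp_all add: add[symmetric])
  then show ?thesis
    by (simp add: f_def g_def right_diff_distrib mult.assoc[symmetric] del: minus_diff_eq)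
qed

definition F where "F n i k = (if i \<le> n then f i k else 1)"
definition R where "R n i = (if i \<le> n then 1 else 1 - y 2)"
definition G where "G n i k = (if i \<le> n then g i k else y (- 2 * k))"

lemma G_step: "R n i * (y (- 2 * k) * F n i k) = G n i k - G n i (k - 1)"
proof -
  have "y 2 * y (- (2 * k)) = y (- (2 * (k - 1)))" by (simp add: add[symmetric])
  then show ?thesis
    using g_step[of k i] by (simp add: R_def F_def G_def algebra_simps)
qed

text \<open>In the shifted index \<mu>_j + n + 1 - j the antidifference of column j is evaluated at
  s_j and s_{j+1}: the staircase shift makes the lower limit of a column the upper limit of the
  next. The sums therefore leave differences of adjacent columns.\<close>

lemma inner_sum:
  assumes "\<And>j. j \<in> {1..n} \<Longrightarrow> c (Suc j) \<le> (c j :: int)"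
  shows "(\<Prod>i\<in>{1..n}. r i) * (\<Sum>\<mu>\<in>PiE {1..n} (\<lambda>j. {c (Suc j)..c j}).
            y (\<Sum>j\<in>{1..n}. \<mu> j) * alternant n (\<lambda>i j. a i (\<mu> j + int n + 1 - int j)))
    = y (\<Sum>j\<in>{1..n}. int j - int n - 1) * alternant (Suc n) (\<lambda>i j. F n i (c j + int n + 2 - int j))"
    (is "?l = _ * ?r")
proof -
  define s where "s j = c j + int n + 2 - int j" for j
  have "?l = (\<Sum>\<mu>\<in>PiE {1..n} (\<lambda>j. {c (Suc j)..c j}).
      alternant n (\<lambda>i j. r i * (y (\<mu> j) * a i (\<mu> j + int n + 1 - int j))))"
    by (simp add: sum_distrib_left sum alternant_scale_rows alternant_scale_columns)
  also have "\<dots> = alternant n (\<lambda>i j. \<Sum>m\<in>{c (Suc j)..c j}. r i * (y m * a i (m + int n + 1 - int j)))"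
    by (rule alternant_sum_columns) auto
  also have "\<dots> = alternant n (\<lambda>i j. y (int j - int n - 1) * (f i (s j) - f i (s (Suc j))))"
  proof (rule alternant_cong)
    fix i j assume ij: "i \<in> {1..n}" "j \<in> {1..n}"
    have "r i * (y m * a i (m + int n + 1 - int j))
       = y (int j - int n - 1) * (f i (m + 1 + int n + 1 - int j) - f i (m + int n + 1 - int j))" for m
    proof -
      have "y m = y (int j - int n - 1) * y (m + int n + 1 - int j)" by (simp add: add[symmetric])
      then show ?thesis using f_step[of i "m + int n + 1 - int j"] by (simp add: algebra_simps)
    qed
    then have "(\<Sum>m\<in>{c (Suc j)..c j}. r i * (y m * a i (m + int n + 1 - int j)))
      = y (int j - int n - 1) * (\<Sum>m\<in>{c (Suc j)..c j}. f i (m + 1 + int n + 1 - int j) - f i (m + int n + 1 - int j))"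
      by (simp add: sum_distrib_left)
    also have "\<dots> = y (int j - int n - 1) * (f i (c j + 1 + int n + 1 - int j) - f i (c (Suc j) + int n + 1 - int j))"
      using assms[OF ij(2)] by (subst sum_telescope_int) auto
    finally show "(\<Sum>m\<in>{c (Suc j)..c j}. r i * (y m * a i (m + int n + 1 - int j)))
      = y (int j - int n - 1) * (f i (s j) - f i (s (Suc j)))"
      by (simp add: s_def algebra_simps)
  qed
  also have "\<dots> = y (\<Sum>j\<in>{1..n}. int j - int n - 1) * alternant n (\<lambda>i j. f i (s j) - f i (s (Suc j)))"
    by (simp add: alternant_scale_columns sum)
  \<comment> \<open>In the bordering row of ones all adjacent differences vanish and the last column
    keeps its 1, so this row is (0, ..., 0, 1).\<close>
  also have "alternant n (\<lambda>i j. f i (s j) - f i (s (Suc j)))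
      = alternant (Suc n) (\<lambda>i j. if j < Suc n then F n i (s j) - F n i (s (Suc j)) else F n i (s j))"
    by (subst alternant_border) (auto simp: F_def intro!: alternant_cong)
  also have "\<dots> = alternant (Suc n) (\<lambda>i j. F n i (s j))"
    by (rule alternant_telescope)
  finally show ?thesis by (simp add: s_def)
qed

text \<open>The mechanism of \<open>inner_sum\<close> once more, now for row 2n + 1. The last column
  starts at \<open>h\<close> instead of a part of \<kappa>, which accounts for the extra value
  \<open>l (n + 2) = h\<close>.\<close>

lemma middle_sum:
  fixes n :: nat and \<kappa> :: "nat \<Rightarrow> int"
  assumes "\<And>j. j \<in> {1..n} \<Longrightarrow> \<kappa> (Suc j) \<le> \<kappa> j" "h \<le> \<kappa> (Suc n) + 1"
  defines "l \<equiv> \<lambda>j. if j = Suc (Suc n) then h else \<kappa> j + int n + 2 - int j"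
  shows "(1 - y 2) * (\<Sum>c\<in>PiE {1..Suc n} (\<lambda>j. {if j = Suc n then h else \<kappa> (Suc j)..\<kappa> j}).
            y (- 2 * (\<Sum>j\<in>{1..Suc n}. c j)) * alternant (Suc n) (\<lambda>i j. F n i (c j + int n + 2 - int j)))
    = y (\<Sum>j\<in>{1..Suc n}. 2 * (int n + 2 - int j)) * alternant (Suc n) (\<lambda>i j. G n i (l j) - G n i (l (Suc j)))"
    (is "?l = _")
proof -
  let ?K = "\<lambda>j. {if j = Suc n then h else \<kappa> (Suc j)..\<kappa> j}"
  have R: "(\<Prod>i\<in>{1..Suc n}. R n i) = 1 - y 2"
    by (simp add: R_def)
  have "?l = (\<Sum>c\<in>PiE {1..Suc n} ?K.
      alternant (Suc n) (\<lambda>i j. R n i * (y (- 2 * c j) * F n i (c j + int n + 2 - int j))))"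
    unfolding alternant_scale_rows alternant_scale_columns R
    by (simp add: sum_distrib_left sum[symmetric] del: prod.cl_ivl_Suc sum.cl_ivl_Suc)
  also have "\<dots> = alternant (Suc n) (\<lambda>i j. \<Sum>c\<in>?K j. R n i * (y (- 2 * c) * F n i (c + int n + 2 - int j)))"
    by (rule alternant_sum_columns) auto
  also have "\<dots> = alternant (Suc n) (\<lambda>i j. y (2 * (int n + 2 - int j)) * (G n i (l j) - G n i (l (Suc j))))"
  proof (rule alternant_cong)
    fix i j assume ij: "i \<in> {1..Suc n}" "j \<in> {1..Suc n}"
    have "R n i * (y (- 2 * c) * F n i (c + int n + 2 - int j))
       = y (2 * (int n + 2 - int j)) * (G n i (c + 1 + int n + 1 - int j) - G n i (c + int n + 1 - int j))" for c
    proof -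
      have "y (- 2 * c) = y (2 * (int n + 2 - int j)) * y (- 2 * (c + int n + 2 - int j))"
        by (simp add: add[symmetric])
      then have "R n i * (y (- 2 * c) * F n i (c + int n + 2 - int j))
          = y (2 * (int n + 2 - int j)) * (R n i * (y (- 2 * (c + int n + 2 - int j)) * F n i (c + int n + 2 - int j)))"
        by (simp only: mult_ac)
      moreover have "c + int n + 2 - int j - 1 = c + int n + 1 - int j" "c + int n + 2 - int j = c + 1 + int n + 1 - int j"
        by simp_all
      ultimately show ?thesis by (simp only: G_step)
    qed
    then have "(\<Sum>c\<in>?K j. R n i * (y (- 2 * c) * F n i (c + int n + 2 - int j)))
      = y (2 * (int n + 2 - int j)) * (\<Sum>c\<in>?K j. G n i (c + 1 + int n + 1 - int j) - G n i (c + int n + 1 - int j))"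
      by (simp add: sum_distrib_left)
    also have "\<dots> = y (2 * (int n + 2 - int j)) * (G n i (\<kappa> j + 1 + int n + 1 - int j) - G n i ((if j = Suc n then h else \<kappa> (Suc j)) + int n + 1 - int j))"
    proof (subst sum_telescope_int)
      show "(if j = Suc n then h else \<kappa> (Suc j)) \<le> \<kappa> j + 1"
        using assms(1)[of j] assms(2) ij by auto
    qed simp
    finally show "(\<Sum>c\<in>?K j. R n i * (y (- 2 * c) * F n i (c + int n + 2 - int j)))
      = y (2 * (int n + 2 - int j)) * (G n i (l j) - G n i (l (Suc j)))"
      using ij by (auto simp: l_def algebra_simps)
  qed
  also have "\<dots> = y (\<Sum>j\<in>{1..Suc n}. 2 * (int n + 2 - int j)) * alternant (Suc n) (\<lambda>i j. G n i (l j) - G n i (l (Suc j)))"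
    by (simp add: alternant_scale_columns sum del: prod.cl_ivl_Suc sum.cl_ivl_Suc)
  finally show ?thesis .
qed

text \<open>This is the function a_k with \<open>y\<close> in place of the powers of x_i, hence the
  row that belongs to the new variable.\<close>

definition B where "B k = y k + b * y (k - 1) - (y (- k) + b * y (1 - k))"

text \<open>The two determinants differ only in the last column, where the lower boundary terms
  combine to G(0) + b y G(1). This is - (a_0 + b a_1) = 0 in the rows i \<le> n by
  \<open>start\<close>, and 1 + b/y in the bordering row.\<close>

lemma outer_sum:
  fixes n :: nat and \<kappa> :: "nat \<Rightarrow> int"
  assumes nz: "1 + b * y 1 \<noteq> 0"
  defines "l \<equiv> \<lambda>j. \<kappa> j + int n + 2 - int j"
  defines "L \<equiv> \<lambda>h j. if j = Suc (Suc n) then h else l j"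
  shows "alternant (Suc n) (\<lambda>i j. G n i (L 0 j) - G n i (L 0 (Suc j)))
      + b * y 1 * alternant (Suc n) (\<lambda>i j. G n i (L 1 j) - G n i (L 1 (Suc j)))
    = (-1) ^ Suc n * y (- (\<Sum>j\<in>{1..Suc n}. l j)) * alternant (Suc n) (\<lambda>i j. if i \<le> n then a i (l j) else B (l j))"
    (is "?l = ?c * ?r")
proof -
  define w where "w = 1 + b * y 1"
  define E where "E i j = (if i \<le> n then w * g i (l j) else w * y (- 2 * l j) - (1 + b * y (-1)))" for i j
  let ?f = "\<lambda>h i j. G n i (L h j) - G n i (L h (Suc j))"
  let ?h = "\<lambda>i j. if j = Suc n then ?f 0 i j + b * y 1 * ?f 1 i j else ?f 0 i j"
  have l: "?l = alternant (Suc n) ?h"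
    using alternant_last_column[of n "?f 0" "?f 1" 1 "b * y 1"] by (auto simp: L_def cong: if_cong)
  \<comment> \<open>The last column already carries the factor \<open>w\<close>. Giving it to the
    other n columns makes all columns adjacent differences of the single array \<open>E\<close>; the
    constant 1 + b/y in the last row of \<open>E\<close> drops out of the differences.\<close>
  let ?v = "\<lambda>j. if j \<le> n then w else 1"
  have v: "(\<Prod>j\<in>{1..Suc n}. ?v j) = w ^ n" by simp
  have "w ^ n * ?l = alternant (Suc n) (\<lambda>i j. ?v j * ?h i j)"
    by (simp only: l v[symmetric] alternant_scale_columns)
  also have "\<dots> = alternant (Suc n) (\<lambda>i j. if j < Suc n then E i j - E i (Suc j) else E i j)"
  proof (rule alternant_cong)
    fix i j assume ij: "i \<in> {1..Suc n}" "j \<in> {1..Suc n}"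
    have "y 1 * y (-2) = y (-1)" by (simp add: add[symmetric])
    moreover have "y 1 * (y (-1) * x) = x" for x
      using add[of 1 "-1"] by (simp add: zero mult.assoc[symmetric])
    ultimately show "?v j * ?h i j = (if j < Suc n then E i j - E i (Suc j) else E i j)"
      using ij start[of i]
      by (auto simp: G_def E_def g_def w_def L_def zero algebra_simps)
  qed
  also have "\<dots> = alternant (Suc n) E" by (rule alternant_telescope)
  also have "\<dots> = alternant (Suc n) (\<lambda>i j. - y (- l j) * (if i \<le> n then w * a i (l j) else B (l j)))"
  proof (rule alternant_cong)
    fix i j
    have "y (- 2 * l j) = y (- l j) * y (- l j)" "y (-1) = y (- l j) * y (l j - 1)"
      "y 1 * y (- (2 * l j)) = y (- l j) * y (1 - l j)" "y (- l j) * y (l j) = 1"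
      by (simp_all add: add[symmetric] zero)
    then show "E i j = - y (- l j) * (if i \<le> n then w * a i (l j) else B (l j))"
      by (auto simp: E_def g_def B_def w_def algebra_simps)
  qed
  \<comment> \<open>The factor \<open>w\<close> now sits in the first n rows instead of the first n
    columns, so the same power of \<open>w\<close> occurs on both sides and cancels.\<close>
  also have "\<dots> = (\<Prod>j\<in>{1..Suc n}. - y (- l j)) * alternant (Suc n) (\<lambda>i j. ?v i * (if i \<le> n then a i (l j) else B (l j)))"
    by (subst alternant_scale_columns) (auto intro!: arg_cong2[of _ _ _ _ "(*)"] alternant_cong)
  also have "\<dots> = (\<Prod>j\<in>{1..Suc n}. - y (- l j)) * (w ^ n * ?r)"
    by (simp only: alternant_scale_rows v)
  also have "(\<Prod>j\<in>{1..Suc n}. - y (- l j)) = (\<Prod>j\<in>{1..Suc n}. - 1) * (\<Prod>j\<in>{1..Suc n}. y (- l j))"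
    by (subst prod.distrib[symmetric]) simp
  also have "\<dots> = ?c"
    by (simp only: sum[symmetric] finite_atLeastAtMost sum_negf prod_constant) simp
  finally have "w ^ n * ?l = w ^ n * (?c * ?r)"
    by (simp only: mult.left_commute)
  moreover have "w ^ n \<noteq> 0" using nz by (simp add: w_def)
  ultimately show ?thesis by (simp only: mult_cancel_left simp_thms)
qed

text \<open>The three sums are the exponents of \<open>y\<close> taken out of the columns in
  \<open>inner_sum\<close>, \<open>middle_sum\<close> and \<open>outer_sum\<close>. Adding the size
  of \<kappa> from the summand leaves n + 1.\<close>

lemma total_exponent:
  "(\<Sum>j\<in>{1..n}. int j - int n - 1) + (\<Sum>j\<in>{1..Suc n}. 2 * (int n + 2 - int j))
     - (\<Sum>j\<in>{1..Suc n}. \<kappa> j + int n + 2 - int j) = int n + 1 - (\<Sum>j\<in>{1..Suc n}. \<kappa> j)"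
proof -
  have 1: "2 * (\<Sum>j\<in>{1..m}. int j) = int m * (int m + 1)" for m
    by (induction m) (auto simp: algebra_simps)
  have 2: "(\<Sum>j\<in>{1..Suc n}. \<kappa> j + int n + 2 - int j)
      = (\<Sum>j\<in>{1..Suc n}. \<kappa> j) + (int n + 1) * (int n + 2) - (\<Sum>j\<in>{1..Suc n}. int j)"
    by (simp only: sum.distrib sum_subtractf) (simp add: algebra_simps)
  have 3: "(\<Sum>j\<in>{1..Suc n}. 2 * (int n + 2 - int j)) = 2 * (int n + 1) * (int n + 2) - 2 * (\<Sum>j\<in>{1..Suc n}. int j)"
    by (simp only: sum_distrib_left[symmetric] sum_subtractf) (simp add: algebra_simps)
  have 4: "(\<Sum>j\<in>{1..n}. int j - int n - 1) = (\<Sum>j\<in>{1..n}. int j) - int n * (int n + 1)"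
    by (simp only: sum_subtractf) (simp add: algebra_simps)
  have 5: "(\<Sum>j\<in>{1..Suc n}. int j) = (\<Sum>j\<in>{1..n}. int j) + int n + 1" by simp
  show ?thesis unfolding 2 3 4 5 using 1[of n] by (simp add: algebra_simps)
qed

text \<open>For u_i = x_i + 1/x_i the factor \<open>r i\<close> is (1 - y x_i)(1 - y/x_i). With u =
  y + 1/y, the prefactor equals (-y)^{n+1} (y - 1/y) times the product of the u_i - u, that is, up
  to a unit, the quotient of two consecutive Weyl denominators.\<close>

theorem branching_determinant:
  fixes \<kappa> :: "nat \<Rightarrow> int"
  assumes nz: "1 + b * y 1 \<noteq> 0"
    and mono: "\<And>j. j \<in> {1..n} \<Longrightarrow> \<kappa> (Suc j) \<le> \<kappa> j" "0 \<le> \<kappa> (Suc n)"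
  shows "(1 - y 2) * (\<Prod>i\<in>{1..n}. r i) *
      (\<Sum>h\<in>{0, 1 :: nat}. \<Sum>c\<in>PiE {1..Suc n} (\<lambda>j. {if j = Suc n then int h else \<kappa> (Suc j)..\<kappa> j}).
        \<Sum>\<mu>\<in>PiE {1..n} (\<lambda>j. {c (Suc j)..c j}).
          b ^ h * y ((\<Sum>j\<in>{1..Suc n}. \<kappa> j) - 2 * (\<Sum>j\<in>{1..Suc n}. c j) + int h + (\<Sum>j\<in>{1..n}. \<mu> j)) *
            alternant n (\<lambda>i j. a i (\<mu> j + int n + 1 - int j)))
    = (-1) ^ Suc n * y (int n + 1) *
        alternant (Suc n) (\<lambda>i j. if i \<le> n then a i (\<kappa> j + int n + 2 - int j) else B (\<kappa> j + int n + 2 - int j))"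
    (is "_ * _ * (\<Sum>h\<in>_. \<Sum>c\<in>?K h. \<Sum>\<mu>\<in>?M c. _ * y (?k - _ + _ + _) * _) = _")
proof -
  define e1 where "e1 = (\<Sum>j\<in>{1..n}. int j - int n - 1)"
  define e2 where "e2 = (\<Sum>j\<in>{1..Suc n}. 2 * (int n + 2 - int j))"
  define e3 where "e3 = (\<Sum>j\<in>{1..Suc n}. \<kappa> j + int n + 2 - int j)"
  define l where "l h j = (if j = Suc (Suc n) then h else \<kappa> j + int n + 2 - int j)" for h j
  have c_mono: "c (Suc j) \<le> c j" if c: "c \<in> ?K h" and j: "j \<in> {1..n}" for c h j
  proof -
    have "c (Suc j) \<le> \<kappa> (Suc j)"
      using PiE_mem[OF c, of "Suc j"] j by auto
    also have "\<dots> \<le> c j"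
      using PiE_mem[OF c, of j] j by auto
    finally show ?thesis .
  qed
  have h: "(1 - y 2) * (\<Prod>i\<in>{1..n}. r i) * (\<Sum>c\<in>?K h. \<Sum>\<mu>\<in>?M c.
          b ^ h * y (?k - 2 * (\<Sum>j\<in>{1..Suc n}. c j) + int h + (\<Sum>j\<in>{1..n}. \<mu> j)) *
            alternant n (\<lambda>i j. a i (\<mu> j + int n + 1 - int j)))
     = b ^ h * y (?k + int h + e1 + e2) * alternant (Suc n) (\<lambda>i j. G n i (l (int h) j) - G n i (l (int h) (Suc j)))"
    (is "?l = ?r") if "h \<le> 1" for h
  proof -
    have "?l = (1 - y 2) * (\<Sum>c\<in>?K h. b ^ h * y (?k + int h) * (y (- 2 * (\<Sum>j\<in>{1..Suc n}. c j)) *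
       ((\<Prod>i\<in>{1..n}. r i) * (\<Sum>\<mu>\<in>?M c. y (\<Sum>j\<in>{1..n}. \<mu> j) * alternant n (\<lambda>i j. a i (\<mu> j + int n + 1 - int j))))))"
    proof -
      have T: "b ^ h * y (?k - 2 * (\<Sum>j\<in>{1..Suc n}. c j) + int h + (\<Sum>j\<in>{1..n}. \<mu> j)) * x
        = b ^ h * y (?k + int h) * y (- 2 * (\<Sum>j\<in>{1..Suc n}. c j)) * (y (\<Sum>j\<in>{1..n}. \<mu> j) * x)" for c \<mu> :: "nat \<Rightarrow> int" and x
      proof -
        have "y (?k - 2 * (\<Sum>j\<in>{1..Suc n}. c j) + int h + (\<Sum>j\<in>{1..n}. \<mu> j))
          = y (?k + int h) * y (- 2 * (\<Sum>j\<in>{1..Suc n}. c j)) * y (\<Sum>j\<in>{1..n}. \<mu> j)"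
          by (simp only: add[symmetric]) (simp add: algebra_simps)
        then show ?thesis by (simp only: mult.assoc)
      qed
      have "(\<Sum>\<mu>\<in>?M c. b ^ h * y (?k - 2 * (\<Sum>j\<in>{1..Suc n}. c j) + int h + (\<Sum>j\<in>{1..n}. \<mu> j)) *
            alternant n (\<lambda>i j. a i (\<mu> j + int n + 1 - int j)))
          = b ^ h * y (?k + int h) * y (- 2 * (\<Sum>j\<in>{1..Suc n}. c j)) *
            (\<Sum>\<mu>\<in>?M c. y (\<Sum>j\<in>{1..n}. \<mu> j) * alternant n (\<lambda>i j. a i (\<mu> j + int n + 1 - int j)))" for c
        unfolding sum_distrib_left[where A = "?M c"] by (rule sum.cong[OF refl], rule T)
      then show ?thesis
        unfolding mult.assoc[of "1 - y 2"] sum_distrib_left[where A = "?K h"]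
        by (intro arg_cong[where f = "\<lambda>x. (1 - y 2) * x"] sum.cong refl) (simp only: mult_ac)
    qed
    also have "\<dots> = (1 - y 2) * (\<Sum>c\<in>?K h. b ^ h * y (?k + int h) * (y (- 2 * (\<Sum>j\<in>{1..Suc n}. c j)) *
       (y e1 * alternant (Suc n) (\<lambda>i j. F n i (c j + int n + 2 - int j)))))"
    proof (rule arg_cong[where f = "\<lambda>x. (1 - y 2) * x"], rule sum.cong[OF refl])
      fix c assume c: "c \<in> ?K h"
      show "b ^ h * y (?k + int h) * (y (- 2 * (\<Sum>j\<in>{1..Suc n}. c j)) *
         ((\<Prod>i\<in>{1..n}. r i) * (\<Sum>\<mu>\<in>?M c. y (\<Sum>j\<in>{1..n}. \<mu> j) * alternant n (\<lambda>i j. a i (\<mu> j + int n + 1 - int j)))))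
        = b ^ h * y (?k + int h) * (y (- 2 * (\<Sum>j\<in>{1..Suc n}. c j)) *
          (y e1 * alternant (Suc n) (\<lambda>i j. F n i (c j + int n + 2 - int j))))"
        by (simp only: inner_sum[where n = n and c = c, OF c_mono[OF c]] e1_def)
    qed
    also have "\<dots> = b ^ h * y (?k + int h) * y e1 * ((1 - y 2) * (\<Sum>c\<in>?K h. y (- 2 * (\<Sum>j\<in>{1..Suc n}. c j)) *
        alternant (Suc n) (\<lambda>i j. F n i (c j + int n + 2 - int j))))"
      by (simp only: sum_distrib_left mult_ac)
    also have "\<dots> = b ^ h * y (?k + int h) * y e1 * (y e2 * alternant (Suc n) (\<lambda>i j. G n i (l (int h) j) - G n i (l (int h) (Suc j))))"
      using middle_sum[of n \<kappa> "int h"] mono that unfolding e2_def l_def by simp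
    also have "\<dots> = ?r"
      by (simp add: add mult_ac)
    finally show ?thesis .
  qed
  define S where "S h = (\<Sum>c\<in>?K h. \<Sum>\<mu>\<in>?M c.
          b ^ h * y (?k - 2 * (\<Sum>j\<in>{1..Suc n}. c j) + int h + (\<Sum>j\<in>{1..n}. \<mu> j)) *
            alternant n (\<lambda>i j. a i (\<mu> j + int n + 1 - int j)))" for h
  have "y (?k + int 1 + e1 + e2) = y 1 * y (?k + e1 + e2)"
    by (simp add: add[symmetric] algebra_simps)
  then have "(1 - y 2) * (\<Prod>i\<in>{1..n}. r i) * (\<Sum>h\<in>{0, 1}. S h)
     = y (?k + e1 + e2) * (alternant (Suc n) (\<lambda>i j. G n i (l 0 j) - G n i (l 0 (Suc j)))
      + b * y 1 * alternant (Suc n) (\<lambda>i j. G n i (l 1 j) - G n i (l 1 (Suc j))))"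
    using h[of 0, folded S_def] h[of 1, folded S_def]
    by (simp add: distrib_left distrib_right mult_ac del: sum.cl_ivl_Suc One_nat_def)
  also have "\<dots> = y (?k + e1 + e2) * ((-1) ^ Suc n * y (- e3) *
        alternant (Suc n) (\<lambda>i j. if i \<le> n then a i (\<kappa> j + int n + 2 - int j) else B (\<kappa> j + int n + 2 - int j)))"
    using outer_sum[OF nz, of n \<kappa>] unfolding e3_def l_def by simp
  also have "\<dots> = (-1) ^ Suc n * (y (?k + e1 + e2) * y (- e3)) * alternant (Suc n) (\<lambda>i j. if i \<le> n then a i (\<kappa> j + int n + 2 - int j) else B (\<kappa> j + int n + 2 - int j))"
    by (simp only: mult_ac)
  also have "y (?k + e1 + e2) * y (- e3) = y (int n + 1)"
    using total_exponent[of n \<kappa>] unfolding add[symmetric] e1_def e2_def e3_def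
    by (intro arg_cong[of _ _ y]) (simp only: algebra_simps)
  finally show ?thesis unfolding S_def .
qed

end

section \<open>The last two rows of a split orthogonal pattern\<close>

abbreviation "lookup \<equiv> Poly_Mapping.lookup"
abbreviation "single \<equiv> Poly_Mapping.single"
abbreviation "keys \<equiv> Poly_Mapping.keys"

definition exponent_of :: "nat \<Rightarrow> (nat \<Rightarrow> int) \<Rightarrow> exponent" where
  "exponent_of n f = (\<Sum>i\<in>{1..n}. single i (f i))"

lemma lookup_exponent_of: "lookup (exponent_of n f) i = (if i \<in> {1..n} then f i else 0)"
proof -
  have "lookup (exponent_of n f) i = (\<Sum>j\<in>{1..n}. if j = i then f j else 0)"
    unfolding exponent_of_def lookup_sum by (intro sum.cong) (auto simp: lookup_single when_def)
  then show ?thesis by simp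
qed

lemma exponent_of_cong:
  "(\<And>i. i \<in> {1..n} \<Longrightarrow> f i = g i) \<Longrightarrow> exponent_of n f = exponent_of n g"
  unfolding exponent_of_def by (intro sum.cong) auto

lemma exponent_of_lookup:
  assumes "m \<in> int_vectors n"
  shows "exponent_of n (lookup m) = m"
proof (rule poly_mapping_eqI)
  show "lookup (exponent_of n (lookup m)) i = lookup m i" for i
    using assms by (auto simp: int_vectors_def lookup_exponent_of in_keys_iff subset_iff)
qed

lemma exponent_of_in_int_vectors: "exponent_of n f \<in> int_vectors n"
  by (auto simp: int_vectors_def lookup_exponent_of in_keys_iff split: if_splits)

lemma exponent_of_in_partitions:
  assumes "\<And>i. i \<in> {1..n} \<Longrightarrow> 0 \<le> f i" "\<And>i. i \<in> {1..<n} \<Longrightarrow> f (Suc i) \<le> f i"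
  shows "exponent_of n f \<in> partitions n"
  using assms by (auto simp: partitions_def exponent_of_in_int_vectors lookup_exponent_of)

text \<open>The rows above 2n are set to 0, not just ignored, because patterns are required to
  vanish outside their index set.\<close>

definition lower_rows :: "nat \<Rightarrow> (nat \<Rightarrow> nat \<Rightarrow> rat) \<Rightarrow> nat \<Rightarrow> nat \<Rightarrow> rat" where
  "lower_rows n z = (\<lambda>i j. if i \<le> 2 * n then z i j else 0)"

lemma array_index_iff: "(i, j) \<in> array_index n \<longleftrightarrow> 1 \<le> i \<and> i \<le> 2 * n \<and> 1 \<le> j \<and> j \<le> (i + 1) div 2"
  by (auto simp: array_index_def)

lemma odd_ends_iff: "(i, j) \<in> odd_ends n \<longleftrightarrow> 1 \<le> j \<and> j \<le> n \<and> i = 2 * j - 1"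
  by (auto simp: odd_ends_def)

lemma interlacing_lower_rows: "interlacing n (lower_rows n z) \<longleftrightarrow> interlacing n z"
  by (simp add: interlacing_def lower_rows_def array_index_iff cong: conj_cong)

lemma interlacing_Suc:
  "interlacing (Suc n) z \<longleftrightarrow> interlacing n z \<and>
    (\<forall>j\<in>{1..n}. z (2 * n + 1) (Suc j) \<le> z (2 * n) j \<and> z (2 * n) j \<le> z (2 * n + 1) j \<and>
        z (2 * n + 2) (Suc j) \<le> z (2 * n + 1) j) \<and>
    (\<forall>j\<in>{1..Suc n}. z (2 * n + 1) j \<le> z (2 * n + 2) j)" (is "?l \<longleftrightarrow> ?r")
proof
  assume l: ?l
  have 1: "z (i + 1) (j + 1) \<le> z i j" if "(i, j) \<in> array_index (Suc n)" "(i + 1, j + 1) \<in> array_index (Suc n)" for i j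
    using l that by (auto simp: interlacing_def)
  have 2: "z i j \<le> z (i + 1) j" if "(i, j) \<in> array_index (Suc n)" "(i + 1, j) \<in> array_index (Suc n)" for i j
    using l that by (auto simp: interlacing_def)
  have "interlacing n z"
    using 1 2 by (auto simp: interlacing_def array_index_iff)
  moreover have "z (2 * n + 1) (Suc j) \<le> z (2 * n) j \<and> z (2 * n) j \<le> z (2 * n + 1) j \<and>
        z (2 * n + 2) (Suc j) \<le> z (2 * n + 1) j" if "j \<in> {1..n}" for j
    using that 1[of "2 * n" j] 2[of "2 * n" j] 1[of "2 * n + 1" j] by (auto simp: array_index_iff)
  moreover have "z (2 * n + 1) j \<le> z (2 * n + 2) j" if "j \<in> {1..Suc n}" for j
    using that 2[of "2 * n + 1" j] by (auto simp: array_index_iff)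
  ultimately show ?r by blast
next
  assume r: ?r
  have 1: "z (i + 1) (j + 1) \<le> z i j" if "(i, j) \<in> array_index n" "(i + 1, j + 1) \<in> array_index n" for i j
    using r that by (auto simp: interlacing_def)
  have 2: "z i j \<le> z (i + 1) j" if "(i, j) \<in> array_index n" "(i + 1, j) \<in> array_index n" for i j
    using r that by (auto simp: interlacing_def)
  have "z (i + 1) (j + 1) \<le> z i j" if "(i, j) \<in> array_index (Suc n)" "(i + 1, j + 1) \<in> array_index (Suc n)" for i j
  proof -
    have "i \<le> 2 * n + 1" using that by (auto simp: array_index_iff)
    then consider "i + 1 \<le> 2 * n" | "i = 2 * n" | "i = 2 * n + 1" by linarith
    then show ?thesis
      using r that 1[of i j] by cases (auto simp: array_index_iff)
  qed
  moreover have "z i j \<le> z (i + 1) j" if "(i, j) \<in> array_index (Suc n)" "(i + 1, j) \<in> array_index (Suc n)" for i j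
  proof -
    have "i \<le> 2 * n + 1" using that by (auto simp: array_index_iff)
    then consider "i + 1 \<le> 2 * n" | "i = 2 * n" | "i = 2 * n + 1" by linarith
    then show ?thesis
      using r that 2[of i j] by cases (auto simp: array_index_iff)
  qed
  ultimately show ?l by (auto simp: interlacing_def)
qed

lemma pattern_row_even_Nats:
  assumes "z \<in> split_orthogonal_patterns n \<kappa>"
  shows "z (2 * i) j \<in> \<nat>"
proof (cases "(2 * i, j) \<in> array_index n")
  case True
  moreover have "(2 * i, j) \<notin> odd_ends n" by (auto simp: odd_ends_iff) presburger
  ultimately show ?thesis using assms by (auto simp: split_orthogonal_patterns_def)
next
  case False
  then show ?thesis using assms by (auto simp: split_orthogonal_patterns_def)
qed

text \<open>Row 2n has integer entries, so the floor only changes their type, and the truncated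
  array is a pattern whose shape is that row.\<close>

lemma split_orthogonal_patterns_Suc:
  "z \<in> split_orthogonal_patterns (Suc n) \<kappa> \<longleftrightarrow>
     lower_rows n z \<in> split_orthogonal_patterns n (exponent_of n (\<lambda>j. \<lfloor>z (2 * n) j\<rfloor>)) \<and>
     (\<forall>i j. 2 * n < i \<and> (i, j) \<notin> array_index (Suc n) \<longrightarrow> z i j = 0) \<and>
     (\<forall>j\<in>{1..n}. z (2 * n + 1) j \<in> \<nat>) \<and> 2 * z (2 * n + 1) (Suc n) \<in> \<nat> \<and>
     (\<forall>j\<in>{1..Suc n}. z (2 * n + 2) j \<in> \<nat>) \<and>
     (\<forall>j\<in>{1..Suc n}. z (2 * n + 2) j = of_int (lookup \<kappa> j)) \<and>
     (\<forall>j\<in>{1..n}. z (2 * n + 1) (Suc j) \<le> z (2 * n) j \<and> z (2 * n) j \<le> z (2 * n + 1) j \<and>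
        z (2 * n + 2) (Suc j) \<le> z (2 * n + 1) j) \<and>
     (\<forall>j\<in>{1..Suc n}. z (2 * n + 1) j \<le> z (2 * n + 2) j)" (is "?l \<longleftrightarrow> ?r")
proof
  assume l: ?l
  have zero: "z i j = 0" if "(i, j) \<notin> array_index (Suc n)" for i j
    using l that by (auto simp: split_orthogonal_patterns_def)
  have nat: "z i j \<in> \<nat>" if "(i, j) \<in> array_index (Suc n)" "(i, j) \<notin> odd_ends (Suc n)" for i j
    using l that by (auto simp: split_orthogonal_patterns_def)
  have half: "2 * z i j \<in> \<nat>" if "(i, j) \<in> odd_ends (Suc n)" for i j
    using l that by (auto simp: split_orthogonal_patterns_def)
  have "interlacing (Suc n) z" and top: "\<forall>j\<in>{1..Suc n}. z (2 * n + 2) j = of_int (lookup \<kappa> j)"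
    using l by (auto simp: split_orthogonal_patterns_def)
  note inter = this(1)[unfolded interlacing_Suc]
  have "lower_rows n z i j = 0" if "(i, j) \<notin> array_index n" for i j
    using that zero[of i j] by (auto simp: lower_rows_def array_index_iff)
  moreover have "lower_rows n z (2 * n) j = of_int (lookup (exponent_of n (\<lambda>j. \<lfloor>z (2 * n) j\<rfloor>)) j)"
    if "j \<in> {1..n}" for j
  proof -
    have "z (2 * n) j \<in> \<nat>" by (rule pattern_row_even_Nats[OF l])
    then show ?thesis using that by (auto simp: lower_rows_def lookup_exponent_of elim!: Nats_cases)
  qed
  moreover have "2 * lower_rows n z i j \<in> \<nat>" if "(i, j) \<in> odd_ends n" for i j
    using that half[of i j] by (auto simp: lower_rows_def odd_ends_iff)
  moreover have "lower_rows n z i j \<in> \<nat>" if "(i, j) \<in> array_index n" "(i, j) \<notin> odd_ends n" for i j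
    using that nat[of i j] by (auto simp: lower_rows_def odd_ends_iff array_index_iff)
  ultimately have "lower_rows n z \<in> split_orthogonal_patterns n (exponent_of n (\<lambda>j. \<lfloor>z (2 * n) j\<rfloor>))"
    using inter by (auto simp: split_orthogonal_patterns_def interlacing_lower_rows)
  moreover have "\<forall>j\<in>{1..n}. z (2 * n + 1) j \<in> \<nat>"
    using nat[of "2 * n + 1"] by (auto simp: odd_ends_iff array_index_iff)
  moreover have "2 * z (2 * n + 1) (Suc n) \<in> \<nat>"
    using half[of "2 * n + 1" "Suc n"] by (auto simp: odd_ends_iff)
  moreover have "\<forall>j\<in>{1..Suc n}. z (2 * n + 2) j \<in> \<nat>"
    using pattern_row_even_Nats[OF l, of "Suc n"] by simp
  ultimately show ?r
    using inter zero top by blast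
next
  assume r: ?r
  then have low: "lower_rows n z \<in> split_orthogonal_patterns n (exponent_of n (\<lambda>j. \<lfloor>z (2 * n) j\<rfloor>))" by blast
  have "z i j = 0" if "(i, j) \<notin> array_index (Suc n)" for i j
  proof (cases "i \<le> 2 * n")
    case True
    then have "(i, j) \<notin> array_index n" using that by (auto simp: array_index_iff)
    then have "lower_rows n z i j = 0" using low by (auto simp: split_orthogonal_patterns_def)
    then show ?thesis using True by (simp add: lower_rows_def)
  qed (use r that in auto)
  moreover have "2 * z i j \<in> \<nat>" if "(i, j) \<in> odd_ends (Suc n)" for i j
  proof (cases "i \<le> 2 * n")
    case True
    then have "(i, j) \<in> odd_ends n" using that by (auto simp: odd_ends_iff)
    then have "2 * lower_rows n z i j \<in> \<nat>" using low by (auto simp: split_orthogonal_patterns_def)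
    then show ?thesis using True by (simp add: lower_rows_def)
  next
    case False
    then have "j = Suc n" "i = 2 * n + 1" using that by (auto simp: odd_ends_iff)
    then show ?thesis using r by simp
  qed
  moreover have "z i j \<in> \<nat>" if "(i, j) \<in> array_index (Suc n)" "(i, j) \<notin> odd_ends (Suc n)" for i j
  proof (cases "i \<le> 2 * n")
    case True
    then have "(i, j) \<in> array_index n - odd_ends n" using that by (auto simp: odd_ends_iff array_index_iff)
    then have "lower_rows n z i j \<in> \<nat>" using low by (auto simp: split_orthogonal_patterns_def)
    then show ?thesis using True by (simp add: lower_rows_def)
  next
    case False
    moreover have "i = 2 * n + 1 \<or> i = 2 * n + 2" "1 \<le> j" "j \<le> Suc n"
      using that False by (auto simp: array_index_iff)
    moreover have "j \<noteq> Suc n" if "i = 2 * n + 1"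
      using \<open>(i, j) \<notin> odd_ends (Suc n)\<close> that by (auto simp: odd_ends_iff)
    ultimately consider "i = 2 * n + 1" "j \<in> {1..n}" | "i = 2 * n + 2" "j \<in> {1..Suc n}"
      by force
    then show ?thesis using r by cases auto
  qed
  moreover have "interlacing (Suc n) z"
    unfolding interlacing_Suc using r low
    by (auto simp: split_orthogonal_patterns_def interlacing_lower_rows)
  ultimately show ?l using r by (auto simp: split_orthogonal_patterns_def)
qed

lemma array_type_lower_rows: "i \<le> 2 * n \<Longrightarrow> array_type (lower_rows n z) i = array_type z i"
  by (auto simp: array_type_def lower_rows_def intro!: sum.cong)

lemma pattern_exponent_Suc:
  "pattern_exponent (Suc n) z = single (Suc n)
     \<lfloor>(\<Sum>j\<in>{1..Suc n}. z (2 * n + 2) j) - 2 * (\<Sum>j\<in>{1..Suc n}. z (2 * n + 1) j) + (\<Sum>j\<in>{1..n}. z (2 * n) j)\<rfloor>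
     + pattern_exponent n (lower_rows n z)"
proof -
  have "array_type z (2 * Suc n) - array_type z (2 * Suc n - 1)
    = (\<Sum>j\<in>{1..Suc n}. z (2 * n + 2) j) - 2 * (\<Sum>j\<in>{1..Suc n}. z (2 * n + 1) j) + (\<Sum>j\<in>{1..n}. z (2 * n) j)"
    by (simp add: array_type_def)
  moreover have "pattern_exponent (Suc n) z = pattern_exponent n (lower_rows n z) +
      single (Suc n) \<lfloor>array_type z (2 * Suc n) - array_type z (2 * Suc n - 1)\<rfloor>"
    by (auto simp: pattern_exponent_def array_type_lower_rows intro!: sum.cong)
  ultimately show ?thesis by (simp add: add.commute)
qed

lemma not_half_integer: "x \<in> \<int> \<Longrightarrow> (x :: rat) - 1 / 2 \<notin> \<int>"
proof
  assume "x \<in> \<int>" "x - 1 / 2 \<in> \<int>"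
  then have "(1 / 2 :: rat) \<in> \<int>" using Ints_diff[of x "x - 1 / 2"] by simp
  then obtain k where "(1 / 2 :: rat) = of_int k" by (auto elim: Ints_cases)
  then have "(of_int 1 :: rat) = of_int (2 * k)" by simp
  then have "1 = 2 * k" by (simp only: of_int_eq_iff)
  then show False by presburger
qed

text \<open>Only odd ends can be proper half-integers, so the two new rows contribute at most the
  entry (2n + 1, n + 1).\<close>

lemma card_half_entries_Suc:
  assumes z: "z \<in> split_orthogonal_patterns (Suc n) \<kappa>"
  shows "card (half_entries (Suc n) z) = (if z (2 * n + 1) (Suc n) \<in> \<int> then 0 else 1) + card (half_entries n (lower_rows n z))"
proof -
  have *: "z i j - 1 / 2 \<notin> \<int>" if "(i, j) \<in> array_index (Suc n)" "(i, j) \<notin> odd_ends (Suc n)" for i j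
    using z that by (intro not_half_integer set_mp[OF Nats_subset_Ints]) (auto simp: split_orthogonal_patterns_def)
  have "2 * z (2 * n + 1) (Suc n) \<in> \<nat>"
    using z[unfolded split_orthogonal_patterns_Suc] by blast
  then obtain k where k: "2 * z (2 * n + 1) (Suc n) = of_nat k" by (auto elim: Nats_cases)
  have top: "z (2 * n + 1) (Suc n) - 1 / 2 \<in> \<int> \<longleftrightarrow> z (2 * n + 1) (Suc n) \<notin> \<int>"
  proof (cases "even k")
    case True
    then obtain m where "k = 2 * m" by blast
    then have "z (2 * n + 1) (Suc n) = of_nat m" using k by simp
    then show ?thesis using not_half_integer[of "of_nat m"] by simp
  next
    case False
    then obtain m where "k = 2 * m + 1" by (elim oddE)
    then have "z (2 * n + 1) (Suc n) - 1 / 2 = of_nat m" using k by simp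
    then show ?thesis using not_half_integer[of "z (2 * n + 1) (Suc n)"] by auto
  qed
  have lower: "half_entries n (lower_rows n z) \<subseteq> {1..2 * n} \<times> UNIV" "finite (half_entries n (lower_rows n z))"
    by (auto simp: half_entries_def array_index_iff intro: finite_subset[OF _ finite_array_index[of n]])
  have "half_entries (Suc n) z = (if z (2 * n + 1) (Suc n) \<in> \<int> then {} else {(2 * n + 1, Suc n)}) \<union> half_entries n (lower_rows n z)"
    (is "_ = ?r")
  proof (rule Set.set_eqI)
    fix p :: "nat \<times> nat"
    obtain i j where p: "p = (i, j)" by (cases p)
    consider "i \<le> 2 * n" | "i = 2 * n + 1" "j = Suc n" | "i > 2 * n" "(i, j) \<notin> odd_ends (Suc n)"
      by (fastforce simp: odd_ends_iff)
    then show "p \<in> half_entries (Suc n) z \<longleftrightarrow> p \<in> ?r"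
    proof cases
      case 1
      then show ?thesis by (auto simp: p half_entries_def lower_rows_def array_index_iff)
    next
      case 2
      then show ?thesis using top by (auto simp: p half_entries_def lower_rows_def array_index_iff)
    next
      case 3
      then show ?thesis using *[of i j] by (auto simp: p half_entries_def lower_rows_def array_index_iff odd_ends_iff)
    qed
  qed
  moreover have "(2 * n + 1, Suc n) \<notin> half_entries n (lower_rows n z)"
    using lower(1) by auto
  ultimately show ?thesis using lower(2) by simp
qed

text \<open>
  \<open>c\<close> lists the entries of row \<open>2n + 1\<close> rounded up, and \<open>h\<close> tells whether its odd end is a proper
  half-integer; \<open>\<mu>\<close> is row \<open>2n\<close>. With this encoding the interlacing conditions bound each entry
  independently of the others.
\<close>

definition odd_rows :: "nat \<Rightarrow> exponent \<Rightarrow> nat \<Rightarrow> (nat \<Rightarrow> int) set" where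
  "odd_rows n \<kappa> h = PiE {1..Suc n} (\<lambda>j. {if j = Suc n then int h else lookup \<kappa> (Suc j)..lookup \<kappa> j})"

definition even_rows :: "nat \<Rightarrow> (nat \<Rightarrow> int) \<Rightarrow> (nat \<Rightarrow> int) set" where
  "even_rows n c = PiE {1..n} (\<lambda>j. {c (Suc j)..c j})"

definition glue_rows where
  "glue_rows n \<kappa> = (\<lambda>(h :: nat, c, \<mu> :: nat \<Rightarrow> int, z) i j. if i \<le> 2 * n then z i j
     else if (i, j) \<notin> array_index (Suc n) then 0
     else if i = 2 * n + 1 then of_int (c j) - (if j = Suc n then of_nat h / 2 else 0)
     else of_int (lookup \<kappa> j) :: rat)"

definition split_rows where
  "split_rows n z = ((if z (2 * n + 1) (Suc n) \<in> \<int> then 0 else 1 :: nat),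
     (\<lambda>j\<in>{1..Suc n}. \<lceil>z (2 * n + 1) j :: rat\<rceil>), (\<lambda>j\<in>{1..n}. \<lfloor>z (2 * n) j\<rfloor>), lower_rows n z)"

definition row_data where
  "row_data n \<kappa> = (SIGMA h:{0, 1}. SIGMA c:odd_rows n \<kappa> h. SIGMA \<mu>:even_rows n c.
     split_orthogonal_patterns n (exponent_of n \<mu>))"

lemma Nats_eq_ceiling: "x \<in> \<nat> \<Longrightarrow> x = (of_int \<lceil>x\<rceil> :: rat)"
  by (auto elim!: Nats_cases)

lemma Nats_eq_floor: "x \<in> \<nat> \<Longrightarrow> x = (of_int \<lfloor>x\<rfloor> :: rat)"
  by (auto elim!: Nats_cases)

text \<open>The odd end is recovered from its ceiling and the flag for half-integrality. A proper
  half-integer that is nonnegative is at least 1/2, which yields the lower bound \<open>h\<close>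
  for the rounded entry.\<close>

lemma half_integer_ceiling:
  assumes "2 * (x :: rat) \<in> \<nat>"
  shows "x = of_int \<lceil>x\<rceil> - of_nat (if x \<in> \<int> then 0 else 1) / 2" "x \<notin> \<int> \<Longrightarrow> 1 \<le> \<lceil>x\<rceil>"
proof -
  obtain k where k: "2 * x = of_nat k" using assms by (auto elim: Nats_cases)
  have "x = of_int \<lceil>x\<rceil> - of_nat (if x \<in> \<int> then 0 else 1) / 2 \<and> (x \<notin> \<int> \<longrightarrow> 1 \<le> \<lceil>x\<rceil>)"
  proof (cases "even k")
    case True
    then obtain m where "k = 2 * m" by blast
    then have "x = of_nat m" using k by simp
    then show ?thesis by simp
  next
    case False
    then obtain m where "k = 2 * m + 1" by (elim oddE)
    then have x: "x = of_nat m + 1 / 2" using k by simp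
    moreover have "\<lceil>x\<rceil> = int m + 1" unfolding x by (rule ceiling_unique) auto
    ultimately show ?thesis using not_half_integer[of x] by auto
  qed
  then show "x = of_int \<lceil>x\<rceil> - of_nat (if x \<in> \<int> then 0 else 1) / 2" "x \<notin> \<int> \<Longrightarrow> 1 \<le> \<lceil>x\<rceil>" by auto
qed

text \<open>An integer bounds x from above exactly when it bounds the ceiling of x, so all upper
  bounds on the odd end survive rounding. From below the odd end is bounded by 0 only.\<close>

lemma split_rows_in_row_data:
  assumes "z \<in> split_orthogonal_patterns (Suc n) \<kappa>"
  shows "split_rows n z \<in> row_data n \<kappa>"
proof -
  note z = assms[unfolded split_orthogonal_patterns_Suc]
  have row: "z (2 * n + 2) j = of_int (lookup \<kappa> j)" if "j \<in> {1..Suc n}" for j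
    using z that by blast
  have mid: "z (2 * n + 1) j = of_int \<lceil>z (2 * n + 1) j\<rceil>" if "j \<in> {1..n}" for j
    using z that by (intro Nats_eq_ceiling) blast
  have even: "z (2 * n) j = of_int \<lfloor>z (2 * n) j\<rfloor>" for j
    by (rule Nats_eq_floor[OF pattern_row_even_Nats[OF assms]])
  note last = half_integer_ceiling[of "z (2 * n + 1) (Suc n)"]
  have "2 * z (2 * n + 1) (Suc n) \<in> \<nat>" using z by blast
  then have "0 \<le> 2 * z (2 * n + 1) (Suc n)" by (auto elim!: Nats_cases)
  then have last0: "0 \<le> \<lceil>z (2 * n + 1) (Suc n)\<rceil>" by (simp add: zero_le_ceiling)
  define h where "h = (if z (2 * n + 1) (Suc n) \<in> \<int> then 0 else 1 :: nat)"
  have "(\<lambda>j\<in>{1..Suc n}. \<lceil>z (2 * n + 1) j :: rat\<rceil>) \<in> odd_rows n \<kappa> h"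
    unfolding odd_rows_def
  proof (rule PiE_I)
    fix j assume j: "j \<in> {1..Suc n}"
    then have "z (2 * n + 1) j \<le> of_int (lookup \<kappa> j)"
      using z row[OF j] by auto
    then have "\<lceil>z (2 * n + 1) j\<rceil> \<le> lookup \<kappa> j" by (simp add: ceiling_le_iff)
    moreover have "lookup \<kappa> (Suc j) \<le> \<lceil>z (2 * n + 1) j\<rceil>" if "j \<noteq> Suc n"
    proof -
      have "of_int (lookup \<kappa> (Suc j)) \<le> z (2 * n + 1) j"
        using z row[of "Suc j"] j that by auto
      then show ?thesis using mid[of j] j that by auto
    qed
    moreover have "int h \<le> \<lceil>z (2 * n + 1) (Suc n)\<rceil>"
      using last(2) last0 z by (auto simp: h_def)
    ultimately show "(\<lambda>j\<in>{1..Suc n}. \<lceil>z (2 * n + 1) j :: rat\<rceil>) j \<in> {if j = Suc n then int h else lookup \<kappa> (Suc j)..lookup \<kappa> j}"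
      using j by auto
  qed auto
  moreover have "(\<lambda>j\<in>{1..n}. \<lfloor>z (2 * n) j\<rfloor>) \<in> even_rows n (\<lambda>j\<in>{1..Suc n}. \<lceil>z (2 * n + 1) j :: rat\<rceil>)"
    unfolding even_rows_def
  proof (rule PiE_I)
    fix j assume j: "j \<in> {1..n}"
    then have "z (2 * n + 1) (Suc j) \<le> of_int \<lfloor>z (2 * n) j\<rfloor>" "of_int \<lfloor>z (2 * n) j\<rfloor> \<le> z (2 * n + 1) j"
      using z even by auto
    then have "\<lceil>z (2 * n + 1) (Suc j)\<rceil> \<le> \<lfloor>z (2 * n) j\<rfloor>" "\<lfloor>z (2 * n) j\<rfloor> \<le> \<lceil>z (2 * n + 1) j\<rceil>"
      using mid[OF j] by (auto simp: ceiling_le_iff) 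
    then show "(\<lambda>j\<in>{1..n}. \<lfloor>z (2 * n) j\<rfloor>) j \<in>
        {(\<lambda>j\<in>{1..Suc n}. \<lceil>z (2 * n + 1) j :: rat\<rceil>) (Suc j)..(\<lambda>j\<in>{1..Suc n}. \<lceil>z (2 * n + 1) j :: rat\<rceil>) j}"
      using j by auto
  qed auto
  moreover have "exponent_of n (\<lambda>j\<in>{1..n}. \<lfloor>z (2 * n) j\<rfloor>) = exponent_of n (\<lambda>j. \<lfloor>z (2 * n) j\<rfloor>)"
    by (rule exponent_of_cong) simp
  ultimately show ?thesis
    using z by (auto simp: split_rows_def row_data_def h_def)
qed

lemma glue_split_rows:
  assumes "z \<in> split_orthogonal_patterns (Suc n) \<kappa>"
  shows "glue_rows n \<kappa> (split_rows n z) = z"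
proof (intro ext)
  fix i j
  note z = assms[unfolded split_orthogonal_patterns_Suc]
  have mid: "z (2 * n + 1) j = of_int \<lceil>z (2 * n + 1) j\<rceil>" if "j \<in> {1..n}"
    using z that by (intro Nats_eq_ceiling) blast
  have last: "z (2 * n + 1) (Suc n) = of_int \<lceil>z (2 * n + 1) (Suc n)\<rceil> - of_nat (if z (2 * n + 1) (Suc n) \<in> \<int> then 0 else 1) / 2"
    using z by (intro half_integer_ceiling) blast
  consider "i \<le> 2 * n" | "i > 2 * n" "(i, j) \<notin> array_index (Suc n)" | "i = 2 * n + 1" "j \<in> {1..n}"
    | "i = 2 * n + 1" "j = Suc n" | "i = 2 * n + 2" "j \<in> {1..Suc n}"
    by (simp add: array_index_iff) linarith
  then show "glue_rows n \<kappa> (split_rows n z) i j = z i j"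
  proof cases
    case 3
    then show ?thesis using mid by (simp add: glue_rows_def split_rows_def array_index_iff)
  next
    case 4
    then show ?thesis using last by (simp add: glue_rows_def split_rows_def array_index_iff)
  qed (use z in \<open>auto simp: glue_rows_def split_rows_def lower_rows_def array_index_iff\<close>)
qed

lemma
  assumes \<kappa>: "\<kappa> \<in> partitions (Suc n)" and d: "d \<in> row_data n \<kappa>"
  shows glue_rows_in_patterns: "glue_rows n \<kappa> d \<in> split_orthogonal_patterns (Suc n) \<kappa>"
    and split_glue_rows: "split_rows n (glue_rows n \<kappa> d) = d"
proof -
  obtain h c \<mu> z' where d': "d = (h, c, \<mu>, z')" by (cases d) auto
  define z where "z = glue_rows n \<kappa> d"
  have h: "h \<in> {0, 1}" and c: "c \<in> odd_rows n \<kappa> h" and \<mu>: "\<mu> \<in> even_rows n c"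
    and z': "z' \<in> split_orthogonal_patterns n (exponent_of n \<mu>)"
    using d by (auto simp: d' row_data_def)
  have c_bd: "(if j = Suc n then int h else lookup \<kappa> (Suc j)) \<le> c j" "c j \<le> lookup \<kappa> j" if "j \<in> {1..Suc n}" for j
    using PiE_mem[OF c[unfolded odd_rows_def] that] by auto
  have \<mu>_bd: "c (Suc j) \<le> \<mu> j" "\<mu> j \<le> c j" if "j \<in> {1..n}" for j
    using PiE_mem[OF \<mu>[unfolded even_rows_def] that] by auto
  have c_bd': "lookup \<kappa> (Suc j) \<le> c j" if "j \<in> {1..n}" for j
    using c_bd(1)[of j] that by (auto split: if_splits)
  have \<kappa>0: "0 \<le> lookup \<kappa> j" if "j \<in> {1..Suc n}" for j
    using \<kappa> that by (auto simp: partitions_def)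
  have c0: "0 \<le> c j" if "j \<in> {1..Suc n}" for j
    using c_bd(1)[OF that] \<kappa>0[of "Suc j"] that by (auto split: if_splits)
  have low: "lower_rows n z = z'"
    using z' by (auto simp: z_def d' glue_rows_def lower_rows_def fun_eq_iff split_orthogonal_patterns_def array_index_iff)
  have even: "z (2 * n) j = (if j \<in> {1..n} then of_int (\<mu> j) else 0)" for j
    using z' by (auto simp: z_def d' glue_rows_def split_orthogonal_patterns_def array_index_iff lookup_exponent_of)
  have mid: "z (2 * n + 1) j = of_int (c j)" if "j \<in> {1..n}" for j
    using that by (simp add: z_def d' glue_rows_def array_index_iff)
  have last: "z (2 * n + 1) (Suc n) = of_int (c (Suc n)) - of_nat h / 2"
    by (simp add: z_def d' glue_rows_def array_index_iff)
  have top: "z (2 * n + 2) j = of_int (lookup \<kappa> j)" if "j \<in> {1..Suc n}" for j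
    using that by (simp add: z_def d' glue_rows_def array_index_iff)
  have Nat: "of_int k \<in> (\<nat> :: rat set)" if "0 \<le> k" for k
    using that by (metis of_nat_in_Nats of_int_of_nat_eq nonneg_int_cases)
  have "exponent_of n (\<lambda>j. \<lfloor>z (2 * n) j\<rfloor>) = exponent_of n \<mu>"
    by (rule exponent_of_cong) (simp add: even)
  moreover have "2 * z (2 * n + 1) (Suc n) \<in> \<nat>"
  proof -
    have "2 * z (2 * n + 1) (Suc n) = of_int (2 * c (Suc n) - int h)"
      unfolding last by simp
    also have "\<dots> \<in> \<nat>"
      using c_bd(1)[of "Suc n"] h by (intro Nat) auto
    finally show ?thesis .
  qed
  moreover have "z (2 * n + 1) (Suc j) \<le> z (2 * n) j" if j: "j \<in> {1..n}" for j
  proof -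
    have "z (2 * n + 1) (Suc j) \<le> of_int (c (Suc j))"
      using mid[of "Suc j"] last j by (cases "j = n") auto
    also have "\<dots> \<le> z (2 * n) j" using \<mu>_bd[OF j] j by (simp add: even)
    finally show ?thesis .
  qed
  moreover have "z (2 * n + 1) j \<le> z (2 * n + 2) j" if j: "j \<in> {1..Suc n}" for j
  proof -
    have "z (2 * n + 1) j \<le> of_int (c j)"
      using mid[of j] last j by (cases "j = Suc n") auto
    also have "\<dots> \<le> z (2 * n + 2) j" using c_bd(2)[OF j] top[OF j] by simp
    finally show ?thesis .
  qed
  moreover have "z i j = 0" if "2 * n < i" "(i, j) \<notin> array_index (Suc n)" for i j
    using that by (simp add: z_def d' glue_rows_def)
  ultimately show "glue_rows n \<kappa> d \<in> split_orthogonal_patterns (Suc n) \<kappa>"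
    unfolding z_def[symmetric] split_orthogonal_patterns_Suc low
    using z' \<mu>_bd c_bd' mid top by (auto simp: even intro!: Nat c0 \<kappa>0 split: if_splits)
  \<comment> \<open>As h is 0 or 1, the ceiling of c - h/2 is c, so both \<open>h\<close> and
    \<open>c\<close> can be read off from the odd end.\<close>
  have "of_int (c (Suc n)) - of_nat h / 2 \<in> (\<int> :: rat set) \<longleftrightarrow> h = 0" "\<lceil>of_int (c (Suc n)) - of_nat h / 2 :: rat\<rceil> = c (Suc n)"
    using h not_half_integer[of "of_int (c (Suc n))"] by (auto intro!: ceiling_unique)
  moreover have "(\<lambda>j\<in>{1..Suc n}. \<lceil>z (2 * n + 1) j\<rceil>) = c"
  proof (rule ext)
    fix j
    consider "j \<in> {1..n}" | "j = Suc n" | "j \<notin> {1..Suc n}" by force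
    then show "(\<lambda>j\<in>{1..Suc n}. \<lceil>z (2 * n + 1) j\<rceil>) j = c j"
      using mid[of j] last calculation(2) PiE_arb[OF c[unfolded odd_rows_def], of j] by cases auto
  qed
  moreover have "(\<lambda>j\<in>{1..n}. \<lfloor>z (2 * n) j\<rfloor>) = \<mu>"
    using PiE_arb[OF \<mu>[unfolded even_rows_def]] by (auto simp: even)
  ultimately show "split_rows n (glue_rows n \<kappa> d) = d"
    using h unfolding z_def[symmetric] split_rows_def low last by (auto simp: d')
qed

lemma sum_Sigma:
  assumes "finite A" "\<And>x. finite (B x)"
  shows "sum f (Sigma A B) = (\<Sum>x\<in>A. \<Sum>y\<in>B x. f (x, y))"
  using assms by (simp add: sum.Sigma)

text \<open>The exponent of the new variable is the alternating row sum with the odd row counted -2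
  times; the odd end c - h/2 therefore contributes the additional \<open>h\<close>.\<close>

lemma schur_CB_Suc:
  assumes \<kappa>: "\<kappa> \<in> partitions (Suc n)"
  shows "schur_CB (Suc n) \<kappa> \<beta> = (\<Sum>h\<in>{0, 1 :: nat}. \<Sum>c\<in>odd_rows n \<kappa> h. \<Sum>\<mu>\<in>even_rows n c.
     single (single (Suc n) ((\<Sum>j\<in>{1..Suc n}. lookup \<kappa> j) - 2 * (\<Sum>j\<in>{1..Suc n}. c j) + int h + (\<Sum>j\<in>{1..n}. \<mu> j))) (\<beta> ^ h) *
     schur_CB n (exponent_of n \<mu>) \<beta>)"
proof -
  let ?e = "\<lambda>h c \<mu>. (\<Sum>j\<in>{1..Suc n}. lookup \<kappa> j) - 2 * (\<Sum>j\<in>{1..Suc n}. c j) + int h + (\<Sum>j\<in>{1..n}. \<mu> j)"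
  let ?t = "\<lambda>(h, c, \<mu>, z). single (single (Suc n) (?e h c \<mu>)) (\<beta> ^ h) *
     single (pattern_exponent n z) (\<beta> ^ card (half_entries n z))"
  have fin: "finite (odd_rows n \<kappa> h)" "finite (even_rows n c)" for h c
    by (auto simp: odd_rows_def even_rows_def intro!: finite_PiE)
  have "schur_CB (Suc n) \<kappa> \<beta> = (\<Sum>d\<in>row_data n \<kappa>. ?t d)"
    unfolding schur_CB_def
  proof (rule sum.reindex_bij_witness[where i = "glue_rows n \<kappa>" and j = "split_rows n"])
    fix z assume z: "z \<in> split_orthogonal_patterns (Suc n) \<kappa>"
    note z' = z[unfolded split_orthogonal_patterns_Suc]
    define h :: nat where "h = (if z (2 * n + 1) (Suc n) \<in> \<int> then 0 else 1)"
    have mid: "z (2 * n + 1) j = of_int \<lceil>z (2 * n + 1) j\<rceil>" if "j \<in> {1..n}" for j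
      using z' that by (intro Nats_eq_ceiling) blast
    have last: "z (2 * n + 1) (Suc n) = of_int \<lceil>z (2 * n + 1) (Suc n)\<rceil> - of_nat h / 2"
      using z' unfolding h_def by (intro half_integer_ceiling) blast
    have even: "z (2 * n) j = of_int \<lfloor>z (2 * n) j\<rfloor>" for j
      by (rule Nats_eq_floor[OF pattern_row_even_Nats[OF z]])
    have "(\<Sum>j\<in>{1..Suc n}. z (2 * n + 2) j) - 2 * (\<Sum>j\<in>{1..Suc n}. z (2 * n + 1) j) + (\<Sum>j\<in>{1..n}. z (2 * n) j)
      = (\<Sum>j\<in>{1..Suc n}. of_int (lookup \<kappa> j)) - 2 * ((\<Sum>j\<in>{1..n}. of_int \<lceil>z (2 * n + 1) j\<rceil>) + (of_int \<lceil>z (2 * n + 1) (Suc n)\<rceil> - of_nat h / 2))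
        + (\<Sum>j\<in>{1..n}. of_int \<lfloor>z (2 * n) j\<rfloor>)"
    proof -
      have "(\<Sum>j\<in>{1..Suc n}. z (2 * n + 2) j) = (\<Sum>j\<in>{1..Suc n}. of_int (lookup \<kappa> j))"
        using z' by (intro sum.cong) auto
      moreover have "(\<Sum>j\<in>{1..n}. z (2 * n + 1) j) = (\<Sum>j\<in>{1..n}. of_int \<lceil>z (2 * n + 1) j\<rceil>)"
        using mid by (intro sum.cong) auto
      then have "(\<Sum>j\<in>{1..Suc n}. z (2 * n + 1) j) = (\<Sum>j\<in>{1..n}. of_int \<lceil>z (2 * n + 1) j\<rceil>) + (of_int \<lceil>z (2 * n + 1) (Suc n)\<rceil> - of_nat h / 2)"
        using last by simp
      moreover have "(\<Sum>j\<in>{1..n}. z (2 * n) j) = (\<Sum>j\<in>{1..n}. of_int \<lfloor>z (2 * n) j\<rfloor>)"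
        using even by (intro sum.cong) auto
      ultimately show ?thesis by (simp only:)
    qed
    also have "\<dots> = of_int (?e h (\<lambda>j\<in>{1..Suc n}. \<lceil>z (2 * n + 1) j\<rceil>) (\<lambda>j\<in>{1..n}. \<lfloor>z (2 * n) j\<rfloor>))"
      by simp
    finally have exponent: "pattern_exponent (Suc n) z = single (Suc n) (?e h (\<lambda>j\<in>{1..Suc n}. \<lceil>z (2 * n + 1) j\<rceil>) (\<lambda>j\<in>{1..n}. \<lfloor>z (2 * n) j\<rfloor>))
        + pattern_exponent n (lower_rows n z)"
      by (simp only: pattern_exponent_Suc floor_of_int)
    show "?t (split_rows n z) = single (pattern_exponent (Suc n) z) (\<beta> ^ card (half_entries (Suc n) z))"
      unfolding split_rows_def h_def[symmetric] exponent card_half_entries_Suc[OF z]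
      by (simp only: prod.case mult_single power_add)
  qed (use \<kappa> in \<open>auto simp: glue_split_rows split_rows_in_row_data glue_rows_in_patterns split_glue_rows\<close>)
  also have "\<dots> = (\<Sum>h\<in>{0, 1 :: nat}. \<Sum>c\<in>odd_rows n \<kappa> h. \<Sum>\<mu>\<in>even_rows n c. \<Sum>z\<in>split_orthogonal_patterns n (exponent_of n \<mu>). ?t (h, c, \<mu>, z))"
    unfolding row_data_def
    by (simp only: sum_Sigma fin finite_SigmaI finite_split_orthogonal_patterns finite.intros)
  finally show ?thesis
    by (simp add: schur_CB_def sum_distrib_left)
qed

section \<open>The determinantal formula\<close>

lemma
  assumes \<kappa>: "\<kappa> \<in> partitions (Suc n)" and c: "c \<in> odd_rows n \<kappa> h" and \<mu>: "\<mu> \<in> even_rows n c"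
  shows odd_row_last: "int h \<le> c (Suc n)"
    and even_row_le: "j \<in> {1..n} \<Longrightarrow> \<mu> j \<le> c j" "j \<in> {1..n} \<Longrightarrow> c (Suc j) \<le> \<mu> j"
    and odd_row_le: "j \<in> {1..Suc n} \<Longrightarrow> c j \<le> lookup \<kappa> j"
    and exponent_of_even_row: "exponent_of n \<mu> \<in> partitions n"
proof -
  have c_bd: "(if j = Suc n then int h else lookup \<kappa> (Suc j)) \<le> c j" "c j \<le> lookup \<kappa> j" if "j \<in> {1..Suc n}" for j
    using PiE_mem[OF c[unfolded odd_rows_def] that] by auto
  have \<mu>_bd: "c (Suc j) \<le> \<mu> j" "\<mu> j \<le> c j" if "j \<in> {1..n}" for j
    using PiE_mem[OF \<mu>[unfolded even_rows_def] that] by auto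
  show "int h \<le> c (Suc n)" using c_bd(1)[of "Suc n"] by simp
  show "j \<in> {1..n} \<Longrightarrow> \<mu> j \<le> c j" "j \<in> {1..n} \<Longrightarrow> c (Suc j) \<le> \<mu> j" "j \<in> {1..Suc n} \<Longrightarrow> c j \<le> lookup \<kappa> j"
    using c_bd(2) \<mu>_bd by auto
  have c0: "0 \<le> c j" if "j \<in> {1..Suc n}" for j
  proof -
    have "0 \<le> (if j = Suc n then int h else lookup \<kappa> (Suc j))"
      using that \<kappa> by (auto simp: partitions_def)
    then show ?thesis using c_bd(1)[OF that] by (rule order_trans)
  qed
  show "exponent_of n \<mu> \<in> partitions n"
  proof (rule exponent_of_in_partitions)
    show "0 \<le> \<mu> j" if "j \<in> {1..n}" for j
      using c0[of "Suc j"] \<mu>_bd(1)[OF that] that by auto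
    show "\<mu> (Suc j) \<le> \<mu> j" if "j \<in> {1..<n}" for j
      using \<mu>_bd(2)[of "Suc j"] \<mu>_bd(1)[of j] that by auto
  qed
qed

lemma finite_rows: "finite (odd_rows n \<kappa> h)" "finite (even_rows n c)"
  by (auto simp: odd_rows_def even_rows_def intro!: finite_PiE)

lemma schur_CB_0: "schur_CB 0 \<kappa> \<beta> = 1"
proof -
  have "split_orthogonal_patterns 0 \<kappa> = {\<lambda>_ _. 0}"
    by (auto simp: split_orthogonal_patterns_def array_index_def interlacing_def odd_ends_def fun_eq_iff)
  then show ?thesis by (simp add: schur_CB_def pattern_exponent_def half_entries_def array_index_def)
qed

lemma lookup_single_times:
  fixes f :: laurent
  shows "lookup (single a b * f) m = b * lookup f (m - a)"
proof -
  have "(m = a + q) = (q = m - a)" for q by (auto simp: algebra_simps)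
  then show ?thesis
    by (simp add: lookup_mult lookup_single when_mult)
qed

text \<open>Partial sums up to n decrease because \<mu>_j \<le> c_j \<le> \<kappa>_j. The full sum
  exceeds that of \<kappa> by at most twice the sum of the \<mu>_j - c_j over j \<le> n, plus h - 2
  c_{n+1}; this is nonpositive as 0 \<le> h \<le> c_{n+1}. All exponents are covered, since the
  smaller exponents in the induction need not be partitions.\<close>

lemma schur_CB_keys:
  assumes "\<kappa> \<in> partitions n" "m \<in> keys (schur_CB n \<kappa> \<beta>)"
  shows "m \<in> int_vectors n \<and> (\<forall>k\<le>n. (\<Sum>i\<in>{1..k}. lookup m i) \<le> (\<Sum>i\<in>{1..k}. lookup \<kappa> i))"
  using assms
proof (induction n arbitrary: \<kappa> m)
  case 0
  then show ?case by (simp add: schur_CB_0 int_vectors_def)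
next
  case (Suc n)
  let ?e = "\<lambda>h c \<mu>. (\<Sum>j\<in>{1..Suc n}. lookup \<kappa> j) - 2 * (\<Sum>j\<in>{1..Suc n}. c j) + int h + (\<Sum>j\<in>{1..n}. \<mu> j)"
  from Suc.prems(2) obtain h c \<mu> where h: "h \<in> {0, 1}" and c: "c \<in> odd_rows n \<kappa> h" and \<mu>: "\<mu> \<in> even_rows n c"
    and m: "m \<in> keys (single (single (Suc n) (?e h c \<mu>)) (\<beta> ^ h) * schur_CB n (exponent_of n \<mu>) \<beta>)"
    unfolding schur_CB_Suc[OF Suc.prems(1)] in_keys_iff lookup_sum
    by (elim sum.not_neutral_contains_not_neutral) blast
  define m' where "m' = m - single (Suc n) (?e h c \<mu>)"
  have "m' \<in> keys (schur_CB n (exponent_of n \<mu>) \<beta>)"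
    using m by (auto simp: in_keys_iff lookup_single_times m'_def)
  note IH = Suc.IH[OF exponent_of_even_row[OF Suc.prems(1) c \<mu>] this]
  note le = odd_row_last[OF Suc.prems(1) c \<mu>] even_row_le(1)[OF Suc.prems(1) c \<mu>] odd_row_le[OF Suc.prems(1) c \<mu>]
  have mm: "lookup m i = lookup m' i + (if i = Suc n then ?e h c \<mu> else 0)" for i
    by (simp add: m'_def lookup_minus lookup_single when_def del: sum.cl_ivl_Suc)
  have m'0: "lookup m' i = 0" if "i \<notin> {1..n}" for i
    using IH that by (auto simp: int_vectors_def in_keys_iff subset_iff)
  have "lookup m i = 0" if "i \<notin> {1..Suc n}" for i
    using that m'0[of i] mm[of i] by (auto simp del: sum.cl_ivl_Suc)
  then have "keys m \<subseteq> {1..Suc n}"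
    by (auto simp: in_keys_iff simp del: atLeastAtMost_iff)
  moreover have small: "(\<Sum>i\<in>{1..k}. lookup m i) \<le> (\<Sum>i\<in>{1..k}. \<mu> i)" if "k \<le> n" for k
  proof -
    have "(\<Sum>i\<in>{1..k}. lookup m i) = (\<Sum>i\<in>{1..k}. lookup m' i)"
      using that by (intro sum.cong) (auto simp: mm)
    also have "\<dots> \<le> (\<Sum>i\<in>{1..k}. lookup (exponent_of n \<mu>) i)" using IH that by blast
    also have "\<dots> = (\<Sum>i\<in>{1..k}. \<mu> i)"
      using that by (intro sum.cong) (auto simp: lookup_exponent_of)
    finally show ?thesis .
  qed
  moreover have "(\<Sum>i\<in>{1..k}. lookup m i) \<le> (\<Sum>i\<in>{1..k}. lookup \<kappa> i)" if "k \<le> Suc n" for k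
  proof (cases "k = Suc n")
    case False
    have "(\<Sum>i\<in>{1..k}. \<mu> i) \<le> (\<Sum>i\<in>{1..k}. lookup \<kappa> i)"
      using le False that by (intro sum_mono order_trans[OF le(2) le(3)]) auto
    then show ?thesis using small[of k] False that by linarith
  next
    case True
    have "(\<Sum>i\<in>{1..n}. \<mu> i) \<le> (\<Sum>i\<in>{1..n}. c i)"
      using le(2) by (rule sum_mono)
    moreover have "lookup m (Suc n) = ?e h c \<mu>" using mm m'0 by simp
    ultimately show ?thesis using True small[of n] le(1) by simp
  qed
  ultimately show ?case by (simp add: int_vectors_def)
qed

text \<open>The exponent \<kappa> forces equality in every estimate behind
  \<open>schur_CB_keys\<close>, so exactly one choice of the two upper rows contributes, with
  coefficient 1.\<close>

lemma schur_CB_leading: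
  assumes "\<kappa> \<in> partitions n"
  shows "lookup (schur_CB n \<kappa> \<beta>) \<kappa> = 1"
  using assms
proof (induction n arbitrary: \<kappa>)
  case 0
  then show ?case by (simp add: schur_CB_0 partitions_def int_vectors_def)
next
  case (Suc n)
  note \<kappa> = Suc.prems
  let ?e = "\<lambda>h c \<mu>. (\<Sum>j\<in>{1..Suc n}. lookup \<kappa> j) - 2 * (\<Sum>j\<in>{1..Suc n}. c j) + int h + (\<Sum>j\<in>{1..n}. \<mu> j)"
  define c0 where "c0 = (\<lambda>j\<in>{1..Suc n}. if j = Suc n then 0 else lookup \<kappa> j)"
  define \<mu>0 where "\<mu>0 = (\<lambda>j\<in>{1..n}. lookup \<kappa> j)"
  define D where "D = (SIGMA h:{0, 1 :: nat}. SIGMA c:odd_rows n \<kappa> h. even_rows n c)"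
  define t where "t = (\<lambda>(h, c, \<mu>). \<beta> ^ h * lookup (schur_CB n (exponent_of n \<mu>) \<beta>) (\<kappa> - single (Suc n) (?e h c \<mu>)))"
  have mono: "lookup \<kappa> (Suc j) \<le> lookup \<kappa> j" if "j \<in> {1..n}" for j
    using \<kappa> that by (auto simp: partitions_def)
  have pos: "0 \<le> lookup \<kappa> j" if "j \<in> {1..Suc n}" for j
    using \<kappa> that by (auto simp: partitions_def)
  have "lookup (schur_CB (Suc n) \<kappa> \<beta>) \<kappa> = (\<Sum>h\<in>{0, 1 :: nat}. \<Sum>c\<in>odd_rows n \<kappa> h. \<Sum>\<mu>\<in>even_rows n c. t (h, c, \<mu>))"
    by (simp add: schur_CB_Suc[OF \<kappa>] lookup_add lookup_sum lookup_single_times t_def)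
  also have "\<dots> = sum t D"
    unfolding D_def by (simp only: sum_Sigma finite_rows finite_SigmaI finite.intros)
  also have "\<dots> = sum t {(0, c0, \<mu>0)}"
  proof (rule sum.mono_neutral_right)
    show "finite D" by (auto simp: D_def finite_rows)
    show "{(0, c0, \<mu>0)} \<subseteq> D"
      using mono pos by (auto simp: D_def c0_def \<mu>0_def odd_rows_def even_rows_def)
    show "\<forall>d\<in>D - {(0, c0, \<mu>0)}. t d = 0"
    proof (rule ballI, rule ccontr)
      fix d assume "d \<in> D - {(0, c0, \<mu>0)}" and nz: "t d \<noteq> 0"
      then obtain h c \<mu> where d: "d = (h, c, \<mu>)" "(h, c, \<mu>) \<noteq> (0, c0, \<mu>0)" and c: "c \<in> odd_rows n \<kappa> h" and \<mu>: "\<mu> \<in> even_rows n c"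
        by (auto simp: D_def)
      define m' where "m' = \<kappa> - single (Suc n) (?e h c \<mu>)"
      note le = odd_row_last[OF \<kappa> c \<mu>] even_row_le(1)[OF \<kappa> c \<mu>] odd_row_le[OF \<kappa> c \<mu>]
      have "m' \<in> keys (schur_CB n (exponent_of n \<mu>) \<beta>)"
        using nz by (auto simp: in_keys_iff t_def d m'_def)
      from schur_CB_keys[OF exponent_of_even_row[OF \<kappa> c \<mu>] this]
      have m': "m' \<in> int_vectors n" "(\<Sum>i\<in>{1..n}. lookup m' i) \<le> (\<Sum>i\<in>{1..n}. lookup (exponent_of n \<mu>) i)" by auto
      have "(\<Sum>i\<in>{1..n}. lookup m' i) = (\<Sum>i\<in>{1..n}. lookup \<kappa> i)"
        by (intro sum.cong) (auto simp: m'_def lookup_minus lookup_single when_def)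
      moreover have "(\<Sum>i\<in>{1..n}. lookup (exponent_of n \<mu>) i) = (\<Sum>i\<in>{1..n}. \<mu> i)"
        by (intro sum.cong) (auto simp: lookup_exponent_of)
      moreover have "(\<Sum>i\<in>{1..n}. \<mu> i) \<le> (\<Sum>i\<in>{1..n}. lookup \<kappa> i)"
        by (intro sum_mono order_trans[OF le(2) le(3)]) auto
      ultimately have "(\<Sum>i\<in>{1..n}. \<mu> i) = (\<Sum>i\<in>{1..n}. lookup \<kappa> i)" using m'(2) by linarith
      then have eq: "\<mu> j = lookup \<kappa> j" if "j \<in> {1..n}" for j
        by (rule sum_mono_inv) (use that in \<open>auto intro!: order_trans[OF le(2) le(3)]\<close>)
      then have eqc: "c j = lookup \<kappa> j" if "j \<in> {1..n}" for j
        using le(2)[OF that] le(3)[of j] that by force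
      have "lookup m' (Suc n) = 0" using m'(1) by (auto simp: int_vectors_def in_keys_iff subset_iff)
      then have "lookup \<kappa> (Suc n) = ?e h c \<mu>" by (simp add: m'_def lookup_minus)
      moreover have "(\<Sum>i\<in>{1..n}. \<mu> i) = (\<Sum>i\<in>{1..n}. lookup \<kappa> i)" "(\<Sum>i\<in>{1..n}. c i) = (\<Sum>i\<in>{1..n}. lookup \<kappa> i)"
        using eq eqc by (auto intro!: sum.cong)
      \<comment> \<open>Once the sums over j \<le> n agree, the exponent of the last variable gives
        h = 2 c_{n+1}, while 0 \<le> h \<le> c_{n+1}.\<close>
      ultimately have "h = 0" "c (Suc n) = 0" using le(1) by auto
      moreover have "c = c0"
      proof
        fix j
        consider "j \<in> {1..n}" | "j = Suc n" | "j \<notin> {1..Suc n}" by force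
        then show "c j = c0 j"
          using eqc[of j] \<open>c (Suc n) = 0\<close> PiE_arb[OF c[unfolded odd_rows_def], of j]
          by cases (auto simp: c0_def)
      qed
      moreover have "\<mu> = \<mu>0"
        using eq PiE_arb[OF \<mu>[unfolded even_rows_def]] by (auto simp: \<mu>0_def fun_eq_iff)
      ultimately show False using d by simp
    qed
  qed
  also have "\<dots> = lookup (schur_CB n (exponent_of n (lookup \<kappa>)) \<beta>) (\<kappa> - single (Suc n) (lookup \<kappa> (Suc n)))"
  proof -
    have "exponent_of n \<mu>0 = exponent_of n (lookup \<kappa>)" by (rule exponent_of_cong) (simp add: \<mu>0_def)
    moreover have "(\<Sum>j\<in>{1..n}. c0 j) = (\<Sum>j\<in>{1..n}. lookup \<kappa> j)" "(\<Sum>j\<in>{1..n}. \<mu>0 j) = (\<Sum>j\<in>{1..n}. lookup \<kappa> j)"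
      by (auto simp: c0_def \<mu>0_def intro!: sum.cong)
    then have "?e 0 c0 \<mu>0 = lookup \<kappa> (Suc n)"
      by (simp add: c0_def)
    ultimately show ?thesis by (simp add: t_def del: sum.cl_ivl_Suc)
  qed
  also have "\<kappa> - single (Suc n) (lookup \<kappa> (Suc n)) = exponent_of n (lookup \<kappa>)"
  proof (rule poly_mapping_eqI)
    fix i
    have "i \<notin> {1..Suc n} \<Longrightarrow> lookup \<kappa> i = 0" 
      using \<kappa> by (auto simp: partitions_def int_vectors_def in_keys_iff subset_iff)
    then show "lookup (\<kappa> - single (Suc n) (lookup \<kappa> (Suc n))) i = lookup (exponent_of n (lookup \<kappa>)) i"
      by (cases "i = Suc n") (auto simp: lookup_minus lookup_single when_def lookup_exponent_of)
  qed
  also have "lookup (schur_CB n (exponent_of n (lookup \<kappa>)) \<beta>) (exponent_of n (lookup \<kappa>)) = 1"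
    using mono pos by (intro Suc.IH exponent_of_in_partitions) auto
  finally show ?case .
qed

section \<open>The determinantal formula for Laurent polynomials\<close>

definition X :: "nat \<Rightarrow> int \<Rightarrow> laurent" where
  "X i k = single (single i k) 1"

definition scalar :: "complex \<Rightarrow> laurent" where
  "scalar b = single 0 b"

definition U :: "nat \<Rightarrow> laurent" where
  "U i = X i 1 + X i (-1)"

text \<open>
  \<open>odd_orth \<beta> i k\<close> is \<open>x - x\<^sup>-\<^sup>1\<close> times the orthogonal polynomial of degree \<open>k - 1\<close> in \<open>x + x\<^sup>-\<^sup>1\<close> for the
  one-variable weight \<open>(1 - x\<^sup>2) (1 - x\<^sup>-\<^sup>2) / ((1 + \<beta> x) (1 + \<beta> x\<^sup>-\<^sup>1))\<close>, where \<open>x = x\<^sub>i\<close>.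
\<close>

definition odd_orth :: "complex \<Rightarrow> nat \<Rightarrow> int \<Rightarrow> laurent" where
  "odd_orth \<beta> i k = X i k + scalar \<beta> * X i (k - 1) - (X i (- k) + scalar \<beta> * X i (1 - k))"

text \<open>The type C denominator in product form. The recursion splits off the factor that
  \<open>branching_determinant\<close> produces for a new variable, up to the unit
  (-x_{n+1})^{n+1}.\<close>

primrec weyl_denominator :: "nat \<Rightarrow> laurent" where
  "weyl_denominator 0 = 1"
| "weyl_denominator (Suc n) =
     weyl_denominator n * ((X (Suc n) 1 - X (Suc n) (-1)) * (\<Prod>i\<in>{1..n}. U i - U (Suc n)))"

definition numerator :: "nat \<Rightarrow> complex \<Rightarrow> exponent \<Rightarrow> laurent" where
  "numerator n \<beta> \<kappa> = alternant n (\<lambda>i j. odd_orth \<beta> i (lookup \<kappa> j + int n + 1 - int j))"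

lemma X_add: "X i (k + l) = X i k * X i l"
  by (simp add: X_def mult_single single_add)

lemma X_zero: "X i 0 = 1"
  by (simp add: X_def)

lemma three_term_X: "three_term (X m) (odd_orth \<beta>) U (scalar \<beta>)"
proof unfold_locales
  show "odd_orth \<beta> i (k + 1) + odd_orth \<beta> i (k - 1) = U i * odd_orth \<beta> i k" for i k
    unfolding odd_orth_def U_def
    by (simp add: algebra_simps X_add[symmetric]) (simp add: algebra_simps X_add[symmetric] flip: mult.assoc)?
  show "odd_orth \<beta> i 0 = - scalar \<beta> * odd_orth \<beta> i 1" for i
    by (simp add: odd_orth_def X_zero algebra_simps)
qed (simp_all add: X_add X_zero)

lemma one_plus_scalar_X_nonzero: "1 + scalar b * X i 1 \<noteq> 0"
proof
  assume "1 + scalar b * X i 1 = 0"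
  then have "lookup (1 + scalar b * X i 1) 0 = 0" by simp
  moreover have "single i (1 :: int) \<noteq> 0"
    by (metis lookup_single_eq lookup_zero zero_neq_one)
  ultimately show False
    by (simp add: lookup_add scalar_def X_def mult_single lookup_single when_def)
qed

text \<open>After multiplication by the smaller denominator each summand of the branching rule
  contains a numerator, by the induction hypothesis, and \<open>branching_determinant\<close>
  evaluates the sum. The identity then holds up to the common unit \<open>?C\<close>.\<close>

theorem schur_CB_times_denominator:
  assumes "\<kappa> \<in> partitions n"
  shows "schur_CB n \<kappa> \<beta> * weyl_denominator n = numerator n \<beta> \<kappa>"
  using assms
proof (induction n arbitrary: \<kappa>)
  case 0
  then show ?case by (simp add: schur_CB_0 numerator_def alternant_def)
next
  case (Suc n)
  note \<kappa> = Suc.prems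
  define y where "y = X (Suc n)"
  interpret three_term y "odd_orth \<beta>" U "scalar \<beta>"
    unfolding y_def by (rule three_term_X)
  let ?e = "\<lambda>h c \<mu>. (\<Sum>j\<in>{1..Suc n}. lookup \<kappa> j) - 2 * (\<Sum>j\<in>{1..Suc n}. c j) + int h + (\<Sum>j\<in>{1..n}. \<mu> j)"
  let ?C = "(-1) ^ Suc n * y (int n + 1)"
  have summand: "single (single (Suc n) (?e h c \<mu>)) (\<beta> ^ h) * schur_CB n (exponent_of n \<mu>) \<beta> * weyl_denominator n
      = scalar \<beta> ^ h * y (?e h c \<mu>) * alternant n (\<lambda>i j. odd_orth \<beta> i (\<mu> j + int n + 1 - int j))"
    if "c \<in> odd_rows n \<kappa> h" "\<mu> \<in> even_rows n c" for h c \<mu>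
  proof -
    have "scalar \<beta> ^ h = scalar (\<beta> ^ h)" by (induction h) (auto simp: scalar_def mult_single)
    then have "single (single (Suc n) (?e h c \<mu>)) (\<beta> ^ h) = scalar \<beta> ^ h * y (?e h c \<mu>)"
      by (simp add: scalar_def y_def X_def mult_single)
    moreover have "numerator n \<beta> (exponent_of n \<mu>) = alternant n (\<lambda>i j. odd_orth \<beta> i (\<mu> j + int n + 1 - int j))"
      unfolding numerator_def by (rule alternant_cong) (simp add: lookup_exponent_of)
    ultimately show ?thesis
      using Suc.IH[OF exponent_of_even_row[OF \<kappa> that]] by (simp only: mult.assoc)
  qed
  have "schur_CB (Suc n) \<kappa> \<beta> * weyl_denominator n = (\<Sum>h\<in>{0, 1 :: nat}. \<Sum>c\<in>odd_rows n \<kappa> h. \<Sum>\<mu>\<in>even_rows n c.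
      scalar \<beta> ^ h * y (?e h c \<mu>) * alternant n (\<lambda>i j. odd_orth \<beta> i (\<mu> j + int n + 1 - int j)))"
    unfolding schur_CB_Suc[OF \<kappa>] sum_distrib_right by (intro sum.cong refl summand)
  then have 1: "(1 - y 2) * (\<Prod>i\<in>{1..n}. r i) * (schur_CB (Suc n) \<kappa> \<beta> * weyl_denominator n)
     = ?C * alternant (Suc n) (\<lambda>i j. if i \<le> n then odd_orth \<beta> i (lookup \<kappa> j + int n + 2 - int j) else B (lookup \<kappa> j + int n + 2 - int j))"
    unfolding odd_rows_def even_rows_def
    by (simp only:) (rule branching_determinant, use \<kappa> one_plus_scalar_X_nonzero[of \<beta> "Suc n"] in \<open>auto simp: partitions_def y_def\<close>)
  have "B k = odd_orth \<beta> (Suc n) k" for k by (simp only: B_def) (simp add: odd_orth_def y_def)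
  then have 2: "alternant (Suc n) (\<lambda>i j. if i \<le> n then odd_orth \<beta> i (lookup \<kappa> j + int n + 2 - int j) else B (lookup \<kappa> j + int n + 2 - int j))
     = numerator (Suc n) \<beta> \<kappa>"
    unfolding numerator_def
    by (intro alternant_cong) (auto simp: le_Suc_eq intro!: arg_cong[where f = "odd_orth \<beta> _"])
  have y: "y 1 * y (-1) = 1" "y 1 * y 1 = y 2" by (simp_all add: add[symmetric] zero)
  have 3: "- y 1 * (X (Suc n) 1 - X (Suc n) (-1)) = 1 - y 2"
    using y by (simp add: y_def[symmetric] algebra_simps)
  have "r i = - y 1 * (U i - U (Suc n))" for i
    unfolding r_def U_def[of "Suc n"] y_def[symmetric]
    using y by (simp add: algebra_simps)
  then have 4: "(\<Prod>i\<in>{1..n}. r i) = (- y 1) ^ n * (\<Prod>i\<in>{1..n}. U i - U (Suc n))"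
    by (simp only: prod.distrib prod_constant) simp
  have "(\<Sum>i\<in>{0..n}. 1) = int n + 1" by simp
  then have "?C = (- y 1) ^ Suc n"
    using sum[of "{0..n}" "\<lambda>_. 1"] by (simp add: power_minus[of "y 1"] add.commute)
  then have 5: "?C * (schur_CB (Suc n) \<kappa> \<beta> * weyl_denominator (Suc n)) = ?C * numerator (Suc n) \<beta> \<kappa>"
    using 1 unfolding 2 4 3[symmetric] by (simp add: mult_ac)
  \<comment> \<open>\<open>?C\<close> is a monomial up to sign; an explicit inverse shows that it is
    nonzero and can be cancelled.\<close>
  have "?C * ((-1) ^ Suc n * y (- (int n + 1))) = ((-1) * (-1)) ^ Suc n * (y (- (int n + 1)) * y (int n + 1))"
    by (simp only: power_mult_distrib mult_ac)
  also have "\<dots> = 1" by (simp only: minus) simp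
  finally have "?C \<noteq> 0" by force
  then show ?case using 5 by (simp only: mult_cancel_left simp_thms)
qed

section \<open>Homomorphisms on Laurent polynomials\<close>

text \<open>One interface for two kinds of homomorphism: substitutions of monomials, with values in
  Laurent polynomials, and evaluations at a point, with values in the complex numbers.\<close>

locale monomial_hom =
  fixes \<iota> :: "complex \<Rightarrow> 'a::comm_ring_1" and \<Phi> :: "exponent \<Rightarrow> 'a"
  assumes iota: "\<iota> 0 = 0" "\<iota> 1 = 1" "\<iota> (a + b) = \<iota> a + \<iota> b" "\<iota> (a * b) = \<iota> a * \<iota> b"
    and Phi: "\<Phi> 0 = 1" "\<Phi> (m + m') = \<Phi> m * \<Phi> m'"
begin

definition hom :: "laurent \<Rightarrow> 'a" where
  "hom f = (\<Sum>m\<in>keys f. \<iota> (lookup f m) * \<Phi> m)"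

lemma hom_single: "hom (single m a) = \<iota> a * \<Phi> m"
  by (simp add: hom_def iota)

lemma hom_plus: "hom (f + g) = hom f + hom g"
  unfolding hom_def
  by (rule setsum_keys_plus_distrib) (simp_all add: iota distrib_right)

lemma hom_sum_plain: "hom (sum f A) = (\<Sum>a\<in>A. hom (f a))"
proof (induction A rule: infinite_finite_induct)
  case (insert a A)
  then show ?case by (simp add: hom_plus)
qed (simp_all add: hom_def)

lemma expand: "f = (\<Sum>m\<in>keys f. single m (lookup f m))" for f :: laurent
proof (rule poly_mapping_eqI)
  fix k
  have "lookup (\<Sum>m\<in>keys f. single m (lookup f m)) k = (\<Sum>m\<in>keys f. if m = k then lookup f m else 0)"
    unfolding lookup_sum by (intro sum.cong) (auto simp: lookup_single when_def)
  then show "lookup f k = lookup (\<Sum>m\<in>keys f. single m (lookup f m)) k"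
    by (simp add: in_keys_iff)
qed

lemma hom_times: "hom (f * g) = hom f * hom g"
proof -
  have "hom (f * g) = hom ((\<Sum>m\<in>keys f. single m (lookup f m)) * (\<Sum>m\<in>keys g. single m (lookup g m)))"
    by (simp only: expand[symmetric])
  also have "\<dots> = (\<Sum>m\<in>keys f. \<Sum>m'\<in>keys g. \<iota> (lookup f m) * \<Phi> m * (\<iota> (lookup g m') * \<Phi> m'))"
    by (simp add: sum_product hom_sum_plain mult_single hom_single iota Phi mult_ac)
  finally show ?thesis by (simp add: hom_def sum_product)
qed

sublocale comm_ring_hom hom
proof
  have "hom (single 0 1) = 1" by (simp only: hom_single iota Phi mult_1_left)
  then show "hom 1 = 1" by simp
qed (simp_all add: hom_plus hom_times, simp add: hom_def)

lemma hom_alternant: "hom (alternant n f) = alternant n (\<lambda>i j. hom (f i j))"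
  unfolding alternant_def hom_det[symmetric]
  by (rule arg_cong[of _ _ Determinant.det]) (auto intro!: eq_matI)

lemma hom_scalar: "hom (scalar b) = \<iota> b"
  by (simp add: scalar_def hom_single Phi)

lemma hom_X: "hom (X i k) = \<Phi> (single i k)"
  by (simp add: X_def hom_single iota)

end

section \<open>Invariance under the hyperoctahedral group\<close>

lemma X_distinct: "X i 1 \<noteq> X i (-1)"
proof
  assume "X i 1 = X i (-1)"
  then have "lookup (X i 1) (single i 1) = lookup (X i (-1)) (single i 1)" by simp
  moreover have "single i (-1 :: int) \<noteq> single i 1"
    by (metis lookup_single_eq one_neq_neg_one)
  ultimately show False by (simp add: X_def lookup_single when_def)
qed

lemma U_distinct:
  assumes "i \<noteq> j"
  shows "U i \<noteq> U j"
proof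
  assume "U i = U j"
  then have "lookup (U i) (single i 1) = lookup (U j) (single i 1)" by simp
  moreover have "single i (-1 :: int) \<noteq> single i 1"
    by (metis lookup_single_eq one_neq_neg_one)
  moreover have "single j k \<noteq> single i (1 :: int)" for k
    using assms by (metis lookup_single_eq lookup_single_not_eq zero_neq_one)
  ultimately show False by (simp add: U_def X_def lookup_add lookup_single when_def)
qed

lemma weyl_denominator_nonzero: "weyl_denominator n \<noteq> 0"
  by (induction n) (auto simp: X_distinct dest: U_distinct[THEN notE, rotated])

lemma zero_in_partitions: "0 \<in> partitions n"
  by (simp add: partitions_def int_vectors_def)

text \<open>Shape 0 leaves a single choice for each of the two upper rows, and a half-integral odd
  end is impossible, so only the zero array occurs.\<close>

lemma schur_CB_zero: "schur_CB n 0 \<beta> = 1"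
proof (induction n)
  case 0
  show ?case by (rule schur_CB_0)
next
  case (Suc n)
  define c0 where "c0 = (\<lambda>j\<in>{1..Suc n}. 0 :: int)"
  define \<mu>0 where "\<mu>0 = (\<lambda>j\<in>{1..n}. 0 :: int)"
  have "odd_rows n 0 0 = PiE {1..Suc n} (\<lambda>j. {c0 j})"
    unfolding odd_rows_def by (rule PiE_cong) (auto simp: c0_def)
  also have "\<dots> = {c0}" by (rule PiE_singleton) (unfold c0_def, rule restrict_extensional)
  finally have c0: "odd_rows n 0 0 = {c0}" .
  have "even_rows n c0 = PiE {1..n} (\<lambda>j. {\<mu>0 j})"
    unfolding even_rows_def by (rule PiE_cong) (auto simp: c0_def \<mu>0_def)
  also have "\<dots> = {\<mu>0}" by (rule PiE_singleton) (unfold \<mu>0_def, rule restrict_extensional)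
  finally have \<mu>0: "even_rows n c0 = {\<mu>0}" .
  have c1: "odd_rows n 0 (Suc 0) = {}"
    by (auto simp: odd_rows_def PiE_eq_empty_iff intro!: bexI[of _ "Suc n"])
  have "exponent_of n \<mu>0 = exponent_of n (lookup 0)"
    by (rule exponent_of_cong) (simp add: \<mu>0_def)
  also have "\<dots> = 0" by (rule exponent_of_lookup) (simp add: int_vectors_def)
  finally have "exponent_of n \<mu>0 = 0" .
  moreover have "(\<Sum>j\<in>{1..n}. c0 j) = 0" "(\<Sum>j\<in>{1..n}. \<mu>0 j) = 0" "c0 (Suc n) = 0"
    by (auto simp: c0_def \<mu>0_def)
  ultimately show ?case
    using Suc.IH by (simp add: schur_CB_Suc[OF zero_in_partitions] c0 c1 \<mu>0)
qed

text \<open>The Weyl denominator formula, as the case of the zero partition; the determinant is the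
  same for every \<beta>.\<close>

lemma numerator_zero: "numerator n \<beta> 0 = weyl_denominator n"
  using schur_CB_times_denominator[OF zero_in_partitions, of n \<beta>] by (simp add: schur_CB_zero)

lemma monomial_hom_subst:
  assumes "\<phi> 0 = 0" "\<And>m m'. \<phi> (m + m') = \<phi> m + \<phi> m'"
  shows "monomial_hom scalar (\<lambda>m. single (\<phi> m) 1)"
  by unfold_locales (simp_all add: assms scalar_def single_add mult_single)

lemma monomial_subst_eq_hom:
  assumes "\<phi> 0 = 0" "\<And>m m'. \<phi> (m + m') = \<phi> m + \<phi> m'"
  shows "monomial_subst \<phi> f = monomial_hom.hom scalar (\<lambda>m. single (\<phi> m) 1) f"
  unfolding monomial_subst_def monomial_hom.hom_def[OF monomial_hom_subst[of \<phi>, OF assms]]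
  by (simp add: scalar_def mult_single)

text \<open>By \<open>numerator_zero\<close> the hypothesis for the zero partition says that the
  denominator acquires the same factor \<open>s\<close>, which then cancels.\<close>

lemma schur_CB_invariant:
  assumes \<phi>: "\<phi> 0 = 0" "\<And>m m'. \<phi> (m + m') = \<phi> m + \<phi> m'"
    and s: "s \<noteq> 0" "\<And>\<kappa>. monomial_subst \<phi> (numerator n \<beta> \<kappa>) = s * numerator n \<beta> \<kappa>"
    and \<kappa>: "\<kappa> \<in> partitions n"
  shows "monomial_subst \<phi> (schur_CB n \<kappa> \<beta>) = schur_CB n \<kappa> \<beta>"
proof -
  interpret monomial_hom scalar "\<lambda>m. single (\<phi> m) 1"
    by (rule monomial_hom_subst[OF \<phi>])
  note subst = monomial_subst_eq_hom[of \<phi>, OF \<phi>]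
  have "hom (schur_CB n \<kappa> \<beta>) * (s * weyl_denominator n) = hom (schur_CB n \<kappa> \<beta> * weyl_denominator n)"
    using s(2)[of 0] by (simp add: numerator_zero subst hom_mult)
  also have "\<dots> = schur_CB n \<kappa> \<beta> * (s * weyl_denominator n)"
    using s(2)[of \<kappa>] by (simp add: schur_CB_times_denominator[OF \<kappa>, symmetric] subst mult_ac)
  finally show ?thesis
    using s(1) weyl_denominator_nonzero by (simp add: subst)
qed

text \<open>The sign depends on \<tau> alone, hence the order of the quantifiers: numerators of
  different partitions must receive the same sign. The permutation \<open>p\<close> is \<tau> moved
  to indices starting at 0.\<close>

lemma alternant_permute_rows:
  assumes \<tau>: "\<tau> permutes {1..n}"
  shows "\<exists>s\<in>{1, -1}. \<forall>f :: nat \<Rightarrow> nat \<Rightarrow> 'a::comm_ring_1. alternant n (\<lambda>i j. f (\<tau> i) j) = s * alternant n f"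
proof -
  define p where "p i = (if i < n then \<tau> (Suc i) - 1 else i)" for i
  have \<tau>_in: "\<tau> (Suc i) \<in> {1..n}" if "i < n" for i
    using permutes_in_image[OF \<tau>, of "Suc i"] that by auto
  then have Suc_p: "Suc (p i) = \<tau> (Suc i)" if "i < n" for i
    using that by (force simp: p_def)
  have "inj_on p {0..<n}"
  proof (rule inj_onI)
    fix i j assume "i \<in> {0..<n}" "j \<in> {0..<n}" "p i = p j"
    then have "\<tau> (Suc i) = \<tau> (Suc j)" using Suc_p by (metis atLeastLessThan_iff)
    then show "i = j" using permutes_inj[OF \<tau>] by (auto dest: injD)
  qed
  moreover have "p ` {0..<n} \<subseteq> {0..<n}"
    using \<tau>_in Suc_p by (force simp: p_def)
  ultimately have "bij_betw p {0..<n} {0..<n}"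
    unfolding bij_betw_def by (intro conjI endo_inj_surj) auto
  then have p: "p permutes {0..<n}"
    by (rule bij_imp_permutes) (simp add: p_def)
  have "alternant n (\<lambda>i j. f (\<tau> i) j) = signof p * alternant n f" for f :: "nat \<Rightarrow> nat \<Rightarrow> 'a"
  proof -
    have "Matrix.mat n n (\<lambda>(i, j). f (\<tau> (Suc i)) (Suc j)) =
        Matrix.mat n n (\<lambda>(i, j). Matrix.mat n n (\<lambda>(i, j). f (Suc i) (Suc j)) $$ (p i, j))"
      (is "?A = ?B")
    proof (rule eq_matI)
      fix i j assume "i < dim_row ?B" "j < dim_col ?B"
      then have ij: "i < n" "j < n" by simp_all
      moreover have "p i < n" using permutes_in_image[OF p, of i] ij(1) by simp
      ultimately show "?A $$ (i, j) = ?B $$ (i, j)" by (simp only: index_mat prod.case Suc_p)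
    qed simp_all
    then show ?thesis
      unfolding alternant_def by (elim ssubst) (rule det_permute_rows[OF _ p], simp)
  qed
  moreover have "(signof p :: 'a) \<in> {1, -1}" by (auto simp: sign_def)
  ultimately show ?thesis by (intro bexI[of _ "signof p"] allI)
qed

text \<open>Permuting the variables permutes the rows of the numerator. Inverting x_i negates row i,
  because \<open>odd_orth\<close> is odd under x -> 1/x.\<close>

lemma schur_CB_bc_invariant:
  assumes \<kappa>: "\<kappa> \<in> partitions n"
  shows "bc_invariant n (schur_CB n \<kappa> \<beta>)"
  unfolding bc_invariant_def
proof (intro conjI allI impI ballI)
  fix \<sigma> assume \<sigma>: "\<sigma> permutes {1..n}"
  note inj = permutes_inj[OF \<sigma>]
  let ?\<phi> = "Poly_Mapping.map_key \<sigma> :: exponent \<Rightarrow> exponent"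
  have \<phi>: "?\<phi> 0 = 0" "?\<phi> (m + m') = ?\<phi> m + ?\<phi> m'" for m m'
    using inj by (simp_all add: map_key_plus)
  interpret monomial_hom scalar "\<lambda>m. single (?\<phi> m) 1"
    by (rule monomial_hom_subst[OF \<phi>])
  obtain s :: laurent where s: "s \<in> {1, -1}" "\<And>f. alternant n (\<lambda>i j. f (inv_into UNIV \<sigma> i) j) = s * alternant n f"
    using alternant_permute_rows[OF permutes_inv[OF \<sigma>]] by metis
  \<comment> \<open>\<open>map_key \<sigma>\<close> composes exponent vectors with \<sigma>, so on
    variables it acts by the inverse permutation.\<close>
  have single: "?\<phi> (single i k) = single (inv_into UNIV \<sigma> i) k" for i k
    using map_key_single[OF inj, of "inv_into UNIV \<sigma> i"] permutes_inverses(1)[OF \<sigma>] by simp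
  have "hom (odd_orth \<beta> i k) = odd_orth \<beta> (inv_into UNIV \<sigma> i) k" for i k
    by (simp add: odd_orth_def hom_minus hom_add hom_mult hom_X hom_scalar single) (simp add: X_def)
  then have "monomial_subst ?\<phi> (numerator n \<beta> \<kappa>) = s * numerator n \<beta> \<kappa>" for \<kappa>
    using s(2) by (simp add: monomial_subst_eq_hom[of ?\<phi>, OF \<phi>] numerator_def hom_alternant)
  then show "monomial_subst ?\<phi> (schur_CB n \<kappa> \<beta>) = schur_CB n \<kappa> \<beta>"
    using s(1) by (intro schur_CB_invariant[OF \<phi> _ _ \<kappa>, of s]) auto
next
  fix i assume i: "i \<in> {1..n}"
  let ?\<phi> = "\<lambda>m :: exponent. Poly_Mapping.update i (- lookup m i) m"
  have \<phi>: "?\<phi> 0 = 0" "?\<phi> (m + m') = ?\<phi> m + ?\<phi> m'" for m m'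
    by (auto intro!: poly_mapping_eqI simp: lookup_update lookup_add)
  interpret monomial_hom scalar "\<lambda>m. single (?\<phi> m) 1"
    by (rule monomial_hom_subst[OF \<phi>])
  have single: "?\<phi> (single j k) = single j (if j = i then - k else k)" for j k
    by (auto intro!: poly_mapping_eqI simp: lookup_update lookup_single when_def)
  define r :: "nat \<Rightarrow> laurent" where "r j = (if j = i then - 1 else 1)" for j
  have "hom (odd_orth \<beta> j k) = r j * odd_orth \<beta> j k" for j k
    by (simp add: odd_orth_def hom_minus hom_add hom_mult hom_X hom_scalar single)
      (simp add: X_def r_def)
  then have "monomial_subst ?\<phi> (numerator n \<beta> \<kappa>) = (\<Prod>j\<in>{1..n}. r j) * numerator n \<beta> \<kappa>" for \<kappa>
    by (simp add: monomial_subst_eq_hom[of ?\<phi>, OF \<phi>] numerator_def hom_alternant alternant_scale_rows)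
  moreover have "(\<Prod>j\<in>{1..n}. r j) \<noteq> 0" by (auto simp: r_def)
  ultimately show "monomial_subst ?\<phi> (schur_CB n \<kappa> \<beta>) = schur_CB n \<kappa> \<beta>"
    by (intro schur_CB_invariant[OF \<phi> _ _ \<kappa>])
qed

section \<open>The one-variable weight\<close>

definition odd_value :: "complex \<Rightarrow> complex \<Rightarrow> int \<Rightarrow> complex" where
  "odd_value \<beta> x k = x powi k + \<beta> * x powi (k - 1) - (x powi (- k) + \<beta> * x powi (1 - k))"

locale nonvanishing =
  fixes n :: nat and x :: "nat \<Rightarrow> complex"
  assumes nz: "i \<in> {1..n} \<Longrightarrow> x i \<noteq> 0"
begin

sublocale monomial_hom "\<lambda>a. a" "\<lambda>m. \<Prod>i\<in>{1..n}. x i powi lookup m i"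
proof
  show "(\<Prod>i\<in>{1..n}. x i powi lookup (m + m') i)
      = (\<Prod>i\<in>{1..n}. x i powi lookup m i) * (\<Prod>i\<in>{1..n}. x i powi lookup m' i)" for m m'
    unfolding prod.distrib[symmetric] using nz by (intro prod.cong) (auto simp: lookup_add power_int_add)
qed simp_all

lemma laurent_eval_eq_hom: "laurent_eval n f x = hom f"
  by (simp only: laurent_eval_def hom_def)

lemma laurent_eval_mult: "laurent_eval n (f * g) x = laurent_eval n f x * laurent_eval n g x"
  by (simp only: laurent_eval_eq_hom hom_mult)

lemma laurent_eval_add: "laurent_eval n (f + g) x = laurent_eval n f x + laurent_eval n g x"
  by (simp only: laurent_eval_eq_hom hom_add)

lemma laurent_eval_minus: "laurent_eval n (f - g) x = laurent_eval n f x - laurent_eval n g x"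
  by (simp only: laurent_eval_eq_hom hom_minus)

lemma laurent_eval_one: "laurent_eval n 1 x = 1"
  by (simp only: laurent_eval_eq_hom hom_one)

lemma laurent_eval_prod: "laurent_eval n (prod f A) x = (\<Prod>a\<in>A. laurent_eval n (f a) x)"
  by (simp only: laurent_eval_eq_hom hom_prod)

lemma laurent_eval_scalar: "laurent_eval n (scalar b) x = b"
  by (simp only: laurent_eval_eq_hom hom_scalar)

lemma laurent_eval_X:
  assumes "i \<in> {1..n}"
  shows "laurent_eval n (X i k) x = x i powi k"
proof -
  have "laurent_eval n (X i k) x = (\<Prod>j\<in>{1..n}. if j = i then x i powi k else 1)"
    unfolding laurent_eval_eq_hom hom_X by (intro prod.cong) (auto simp: lookup_single when_def)
  then show ?thesis using assms by simp
qed

lemma laurent_eval_odd_orth: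
  "i \<in> {1..n} \<Longrightarrow> laurent_eval n (odd_orth \<beta> i k) x = odd_value \<beta> (x i) k"
  by (simp add: odd_orth_def odd_value_def laurent_eval_minus laurent_eval_add laurent_eval_mult
      laurent_eval_scalar laurent_eval_X)

lemma laurent_eval_numerator:
  "laurent_eval n (numerator n \<beta> \<kappa>) x = alternant n (\<lambda>i j. odd_value \<beta> (x i) (lookup \<kappa> j + int n + 1 - int j))"
  unfolding numerator_def laurent_eval_eq_hom hom_alternant
  by (rule alternant_cong) (simp only: laurent_eval_odd_orth[unfolded laurent_eval_eq_hom])

end

text \<open>The factors 1 - x^2 and 1 - x^{-2} of the one-variable density are left out: they belong
  to the Weyl denominators, and it is the numerators that are integrated against this
  weight.\<close>

definition weight :: "complex \<Rightarrow> complex \<Rightarrow> complex" where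
  "weight \<beta> x = 1 / ((1 + \<beta> * x) * (1 + \<beta> * inverse x))"

section \<open>The Koornwinder density at q = t = 0\<close>

lemma qpoch_inf_q_0: "qpoch_inf z 0 = 1 - z"
proof -
  have "qpoch_inf z 0 = (\<Prod>k\<in>{0}. 1 - 0 ^ k * z)"
    unfolding qpoch_inf_def by (rule prodinf_finite) auto
  then show ?thesis by simp
qed

lemma density_Suc:
  "koornwinder_density (Suc m) 0 0 (- \<beta>) 0 0 0 x = koornwinder_density m 0 0 (- \<beta>) 0 0 0 x *
     ((1 - x (Suc m) powi 2) * (1 - x (Suc m) powi (-2)) * weight \<beta> (x (Suc m)) *
      (\<Prod>i\<in>{1..m}. (1 - x i * x (Suc m)) * (1 - x i * inverse (x (Suc m))) *
        (1 - inverse (x i) * x (Suc m)) * (1 - inverse (x i) * inverse (x (Suc m)))))"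
proof -
  let ?P = "\<lambda>m. {(i, j). 1 \<le> i \<and> i < j \<and> j \<le> (m :: nat)}"
  have P: "?P (Suc m) = ?P m \<union> (\<lambda>i. (i, Suc m)) ` {1..m}" "?P m \<inter> (\<lambda>i. (i, Suc m)) ` {1..m} = {}"
    by auto
  have fin: "finite (?P m)"
    by (rule finite_subset[of _ "{1..m} \<times> {1..m}"]) auto
  have inj: "inj_on (\<lambda>i. (i, Suc m)) {1..m}" by (auto simp: inj_on_def)
  have img: "(\<Prod>(i, j)\<in>(\<lambda>i. (i, Suc m)) ` {1..m}. F i j) = (\<Prod>i\<in>{1..m}. F i (Suc m))" for F :: "nat \<Rightarrow> nat \<Rightarrow> complex"
    by (simp only: prod.reindex[OF inj] o_def prod.case)
  show ?thesis
    unfolding koornwinder_density_def P(1)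
    by (subst prod.union_disjoint[OF fin _ P(2)])
      (simp_all add: img[unfolded One_nat_def] qpoch_inf_q_0 weight_def power_int_minus mult_ac)
qed

text \<open>With u_x = x + 1/x one has (1 - xy)(1 - y/x) = -y (u_x - u_y) and (1 - x/y)(1 - 1/(xy))
  = -(u_x - u_y)/y. The four factors of a pair thus form a square, one root for each denominator, as
  u_x is unchanged by inversion. The evaluation dimension \<open>n\<close> stays fixed while
  \<open>m\<close> grows.\<close>

lemma density_eq:
  assumes "nonvanishing n x" and "m \<le> n"
  shows "koornwinder_density m 0 0 (- \<beta>) 0 0 0 x =
    laurent_eval n (weyl_denominator m) x * laurent_eval n (weyl_denominator m) (\<lambda>i. inverse (x i)) *
      (\<Prod>i\<in>{1..m}. weight \<beta> (x i))"
  using \<open>m \<le> n\<close>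
proof (induction m)
  interpret E: nonvanishing n x by fact
  interpret E': nonvanishing n "\<lambda>i. inverse (x i)"
    by unfold_locales (simp add: E.nz)
  case 0
  show ?case
    by (simp add: koornwinder_density_def E.laurent_eval_one E'.laurent_eval_one) (intro prod.neutral, auto)
next
  case (Suc m)
  interpret E: nonvanishing n x by fact
  interpret E': nonvanishing n "\<lambda>i. inverse (x i)"
    by unfold_locales (simp add: E.nz)
  let ?y = "x (Suc m)"
  have y: "?y \<noteq> 0" using E.nz Suc.prems by auto
  have U: "laurent_eval n (U i) x = x i + inverse (x i)" if "i \<in> {1..n}" for i
    using that by (simp add: U_def E.laurent_eval_add E.laurent_eval_X)
  have U': "laurent_eval n (U i) (\<lambda>i. inverse (x i)) = x i + inverse (x i)" if "i \<in> {1..n}" for i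
    using that by (simp add: U_def E'.laurent_eval_add E'.laurent_eval_X)
  have 1: "laurent_eval n (weyl_denominator (Suc m)) x = laurent_eval n (weyl_denominator m) x *
     ((?y - inverse ?y) * (\<Prod>i\<in>{1..m}. x i + inverse (x i) - (?y + inverse ?y)))"
    using Suc.prems by (simp add: E.laurent_eval_mult E.laurent_eval_minus E.laurent_eval_prod
        E.laurent_eval_X U)
  have 2: "laurent_eval n (weyl_denominator (Suc m)) (\<lambda>i. inverse (x i)) = laurent_eval n (weyl_denominator m) (\<lambda>i. inverse (x i)) *
     ((inverse ?y - ?y) * (\<Prod>i\<in>{1..m}. x i + inverse (x i) - (?y + inverse ?y)))"
    using Suc.prems by (simp add: E'.laurent_eval_mult E'.laurent_eval_minus E'.laurent_eval_prod
        E'.laurent_eval_X U')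
  have 3: "(1 - ?y powi 2) * (1 - ?y powi (-2)) = (?y - inverse ?y) * (inverse ?y - ?y)"
    using y by (simp add: power_int_minus field_simps power2_eq_square)
  have 4: "(\<Prod>i\<in>{1..m}. (1 - x i * ?y) * (1 - x i * inverse ?y) * (1 - inverse (x i) * ?y) * (1 - inverse (x i) * inverse ?y))
    = (\<Prod>i\<in>{1..m}. x i + inverse (x i) - (?y + inverse ?y)) * (\<Prod>i\<in>{1..m}. x i + inverse (x i) - (?y + inverse ?y))"
    unfolding prod.distrib[symmetric]
  proof (rule prod.cong[OF refl])
    fix i assume "i \<in> {1..m}"
    then have "x i \<noteq> 0" using E.nz Suc.prems by auto
    then show "(1 - x i * ?y) * (1 - x i * inverse ?y) * (1 - inverse (x i) * ?y) * (1 - inverse (x i) * inverse ?y)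
      = (x i + inverse (x i) - (?y + inverse ?y)) * (x i + inverse (x i) - (?y + inverse ?y))"
      using y by (simp add: divide_simps) (simp add: algebra_simps)
  qed
  show ?case
    unfolding density_Suc 1 2 3 4 using Suc by (simp add: mult_ac)
qed

section \<open>Integrals over the circle\<close>

definition circle :: "real measure" where
  "circle = restrict_space lborel {0..2 * pi}"

lemma product_sigma_finite_circle: "product_sigma_finite (\<lambda>_ :: nat. circle)"
  unfolding product_sigma_finite_def circle_def
  by (auto intro!: sigma_finite_measure_restrict_space sigma_finite_lborel)

lemma integrable_circle:
  fixes f :: "real \<Rightarrow> complex"
  assumes "continuous_on {0..2 * pi} f"
  shows "integrable circle f"
  unfolding circle_def using borel_integrable_atLeastAtMost'[OF assms]
  by (subst integrable_restrict_space) (auto simp: set_integrable_def)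

lemma integral_cis:
  "(LINT t|circle. cis (of_int k * t)) = (if k = 0 then 2 * of_real pi else 0)"
proof -
  define F where "F = (\<lambda>t. if k = 0 then of_real t else cis (of_int k * t) / (\<i> * of_int k))"
  have "(LINT t|circle. cis (of_int k * t)) = (LINT t|lborel. indicator {0..2 * pi} t *\<^sub>R cis (of_int k * t))"
    unfolding circle_def by (subst integral_restrict_space) auto
  also have "\<dots> = F (2 * pi) - F 0"
  proof (rule integral_FTC_atLeastAtMost)
    fix t
    show "(F has_vector_derivative cis (of_int k * t)) (at t within {0..2 * pi})"
    proof (cases "k = 0")
      case True
      then show ?thesis
        unfolding F_def has_vector_derivative_def by (auto intro!: derivative_eq_intros simp: scaleR_conv_of_real)
    next
      case False
      then show ?thesis
        unfolding F_def has_vector_derivative_def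
        by (auto intro!: derivative_eq_intros simp: scaleR_conv_of_real field_simps)
    qed
  qed (auto intro!: continuous_intros)
  also have "\<dots> = (if k = 0 then 2 * of_real pi else 0)"
  proof -
    have "cis (of_int k * (2 * pi)) = 1"
      using cis_multiple_2pi[of "of_int k"] by (simp add: mult_ac)
    then show ?thesis by (simp add: F_def)
  qed
  finally show ?thesis .
qed

lemma one_plus_nonzero:
  assumes "norm (\<beta> :: complex) < 1"
  shows "1 + \<beta> * cis t \<noteq> 0"
proof
  assume "1 + \<beta> * cis t = 0"
  then have "\<beta> * cis t = - 1" by (metis add.commute add_eq_0_iff)
  then have "norm (\<beta> * cis t) = 1" by simp
  then show False using assms by (simp add: norm_mult)
qed

text \<open>
  \<open>J k = \<integral> x\<^sup>k / (1 + \<beta> x)\<close> satisfies \<open>J k + \<beta> J (k + 1) = \<integral> x\<^sup>k = 0\<close>, hence \<open>J k = (- \<beta>)\<^sup>d J (k + d)\<close>, and the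
  \<open>J k\<close> are bounded.
\<close>

lemma integral_cis_over_linear:
  assumes \<beta>: "norm \<beta> < 1" and k: "k \<ge> 1" and s: "s \<in> {1, -1}"
  shows "(LINT t|circle. cis (of_int (s * k) * t) / (1 + \<beta> * cis (of_int s * t))) = 0"
proof -
  define g where "g k t = cis (of_int (s * k) * t) / (1 + \<beta> * cis (of_int s * t))" for k t
  define J where "J k = (LINT t|circle. g k t)" for k
  note nz = one_plus_nonzero[OF \<beta>]
  have int: "integrable circle (g k)" for k
    unfolding g_def by (intro integrable_circle continuous_intros) (auto simp: nz)
  have step: "J k = - \<beta> * J (k + 1)" if "k \<ge> 1" for k
  proof -
    have "J k + \<beta> * J (k + 1) = (LINT t|circle. g k t + \<beta> * g (k + 1) t)"
      unfolding J_def using int by simp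
    also have "\<dots> = (LINT t|circle. cis (of_int (s * k) * t))"
    proof (rule Bochner_Integration.integral_cong[OF refl])
      fix t
      have "cis (of_int (s * (k + 1)) * t) = cis (of_int (s * k) * t) * cis (of_int s * t)"
        by (simp add: cis_mult algebra_simps)
      then have "g k t + \<beta> * g (k + 1) t = cis (of_int (s * k) * t) * (1 + \<beta> * cis (of_int s * t)) / (1 + \<beta> * cis (of_int s * t))"
        unfolding g_def by (simp only: add_divide_distrib[symmetric] times_divide_eq_right distrib_left mult_1_right mult_1_left mult_ac)
      then show "g k t + \<beta> * g (k + 1) t = cis (of_int (s * k) * t)"
        using nz[of "of_int s * t"] by simp
    qed
    also have "\<dots> = 0" using that s by (subst integral_cis) auto
    finally show ?thesis by (simp add: add_eq_0_iff2)
  qed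
  define C where "C = (LINT t|circle. norm (1 / (1 + \<beta> * cis (of_int s * t))))"
  have bound: "norm (J k) \<le> C" for k
  proof -
    have "norm (J k) \<le> (LINT t|circle. norm (cis (of_int (s * k) * t) / (1 + \<beta> * cis (of_int s * t))))"
      unfolding J_def g_def by (rule integral_norm_bound)
    then show ?thesis by (simp add: C_def norm_divide)
  qed
  have power: "J k = (- \<beta>) ^ d * J (k + int d)" for d
  proof (induction d)
    case (Suc d)
    then show ?case using step[of "k + int d"] k by (simp add: algebra_simps)
  qed simp
  have "norm (J k) \<le> norm \<beta> ^ d * C" for d
  proof -
    have "norm (J k) = norm \<beta> ^ d * norm (J (k + int d))"
      by (subst power[of d]) (simp add: norm_mult norm_power)
    also have "\<dots> \<le> norm \<beta> ^ d * C"
      by (intro mult_left_mono bound) simp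
    finally show ?thesis .
  qed
  moreover have "(\<lambda>d. norm \<beta> ^ d * C) \<longlonglongrightarrow> 0 * C"
    using \<beta> by (intro tendsto_mult tendsto_const LIMSEQ_power_zero) simp
  ultimately have "norm (J k) \<le> 0"
    by (intro LIMSEQ_le_const[of "\<lambda>d. norm \<beta> ^ d * C"]) auto
  then show ?thesis by (simp add: J_def g_def)
qed

text \<open>With P = 1 + \<beta> x and Q = 1 + \<beta>/x the two factors are x^l Q - x^{-l} P and
  x^{-m} P - x^m Q, and the weight is 1/(PQ). The mixed products give x^{l-m} + x^{m-l}. The others,
  x^{l+m} Q/P and x^{-l-m} P/Q, integrate to 0 by \<open>integral_cis_over_linear\<close>, since l +
  m - 1 \<ge> 1.\<close>

lemma odd_value_orthogonal:
  assumes \<beta>: "norm \<beta> < 1" and lm: "l \<ge> 1" "m \<ge> 1"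
  shows "(LINT t|circle. odd_value \<beta> (cis t) l * odd_value \<beta> (cis (- t)) m * weight \<beta> (cis t))
    = (if l = m then 4 * of_real pi else 0)"
proof -
  define e where "e k t = cis (of_int k * t)" for k t
  define T where "T s k t = cis (of_int (s * k) * t) / (1 + \<beta> * cis (of_int s * t))" for s k t
  note nz = one_plus_nonzero[OF \<beta>]
  have int: "integrable circle (T s k)" "integrable circle (e k)" for s k
    unfolding T_def e_def by (intro integrable_circle continuous_intros; auto simp: nz)+
  have "odd_value \<beta> (cis t) l * odd_value \<beta> (cis (- t)) m * weight \<beta> (cis t)
    = e (l - m) t + e (m - l) t - T 1 (l + m) t - \<beta> * T 1 (l + m - 1) t - T (-1) (l + m) t - \<beta> * T (-1) (l + m - 1) t" for t
  proof -
    define P Q where "P = 1 + \<beta> * e 1 t" and "Q = 1 + \<beta> * e (-1) t"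
    have PQ: "P \<noteq> 0" "Q \<noteq> 0" using nz by (auto simp: P_def Q_def e_def)
    have e: "e a t * e b t = e (a + b) t" for a b
      by (simp add: e_def cis_mult algebra_simps)
    have A: "odd_value \<beta> (cis t) l = e l t * Q - e (- l) t * P"
      by (simp add: odd_value_def P_def Q_def cis_power_int e_def cis_mult algebra_simps)
    have B: "odd_value \<beta> (cis (- t)) m = e (- m) t * P - e m t * Q"
      by (simp add: odd_value_def P_def Q_def cis_power_int e_def cis_mult algebra_simps)
    have w: "weight \<beta> (cis t) = 1 / (P * Q)"
      by (simp add: weight_def P_def Q_def e_def)
    have T1: "T 1 (l + m) t + \<beta> * T 1 (l + m - 1) t = e l t * e m t * Q / P"
      by (simp add: T_def P_def Q_def e_def cis_mult algebra_simps add_divide_distrib)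
    have T2: "T (-1) (l + m) t + \<beta> * T (-1) (l + m - 1) t = e (- l) t * e (- m) t * P / Q"
      by (simp add: T_def P_def Q_def e_def cis_mult algebra_simps add_divide_distrib)
    have "(e l t * Q - e (- l) t * P) * (e (- m) t * P - e m t * Q) * (1 / (P * Q))
      = e l t * e (- m) t + e m t * e (- l) t - e l t * e m t * Q / P - e (- l) t * e (- m) t * P / Q"
      using PQ by (simp add: field_simps)
    moreover have "e l t * e (- m) t = e (l - m) t" "e m t * e (- l) t = e (m - l) t"
      by (simp_all add: e)
    ultimately show ?thesis
      unfolding A B w by (simp only: T1[symmetric] T2[symmetric] diff_diff_eq add.assoc)
  qed
  then have "(LINT t|circle. odd_value \<beta> (cis t) l * odd_value \<beta> (cis (- t)) m * weight \<beta> (cis t))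
    = (LINT t|circle. e (l - m) t) + (LINT t|circle. e (m - l) t) - (LINT t|circle. T 1 (l + m) t) - \<beta> * (LINT t|circle. T 1 (l + m - 1) t)
      - (LINT t|circle. T (-1) (l + m) t) - \<beta> * (LINT t|circle. T (-1) (l + m - 1) t)"
    using int by simp
  moreover have "(LINT t|circle. T s k t) = 0" if "k \<ge> 1" "s \<in> {1, -1}" for k s
    unfolding T_def by (rule integral_cis_over_linear[OF \<beta> that])
  moreover have "(LINT t|circle. e k t) = (if k = 0 then 2 * of_real pi else 0)" for k
    unfolding e_def by (rule integral_cis)
  ultimately show ?thesis
    using lm by simp
qed

section \<open>Orthogonality\<close>

abbreviation torus :: "nat \<Rightarrow> (nat \<Rightarrow> real) measure" where
  "torus n \<equiv> Pi\<^sub>M {1..n} (\<lambda>_. circle)"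

definition weighted_integrand :: "nat \<Rightarrow> complex \<Rightarrow> laurent \<Rightarrow> laurent \<Rightarrow> (nat \<Rightarrow> real) \<Rightarrow> complex" where
  "weighted_integrand n \<beta> f g \<theta> = laurent_eval n f (\<lambda>i. cis (\<theta> i)) * laurent_eval n g (\<lambda>i. cis (- \<theta> i)) *
     (\<Prod>i\<in>{1..n}. weight \<beta> (cis (\<theta> i)))"

lemma nonvanishing_cis: "nonvanishing n (\<lambda>i. cis (\<phi> i))"
  by unfold_locales simp

lemma continuous_weight:
  assumes "norm \<beta> < 1"
  shows "continuous_on A (\<lambda>t. weight \<beta> (cis t))"
  unfolding weight_def cis_inverse
  by (intro continuous_intros) (auto simp: one_plus_nonzero[OF assms])

lemma integrable_weighted_integrand:
  assumes \<beta>: "norm \<beta> < 1"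
  shows "integrable (torus n) (weighted_integrand n \<beta> f g)"
proof -
  interpret product_sigma_finite "\<lambda>_ :: nat. circle" by (rule product_sigma_finite_circle)
  define F where "F m m' i t = cis t powi lookup m i * cis (- t) powi lookup m' i * weight \<beta> (cis t)" for m m' :: exponent and i t
  have "integrable circle (F m m' i)" for m m' i
    unfolding F_def cis_power_int by (intro integrable_circle continuous_intros continuous_weight \<beta>)
  then have F: "integrable (torus n) (\<lambda>\<theta>. \<Prod>i\<in>{1..n}. F m m' i (\<theta> i))" for m m'
    by (intro product_integrable_prod) auto
  have "weighted_integrand n \<beta> f g = (\<lambda>\<theta>. \<Sum>m\<in>keys f. \<Sum>m'\<in>keys g. lookup f m * lookup g m' * (\<Prod>i\<in>{1..n}. F m m' i (\<theta> i)))"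
    by (intro ext) (simp add: weighted_integrand_def laurent_eval_def sum_product sum_distrib_left
        sum_distrib_right F_def prod.distrib mult_ac, rule sum.swap)
  then show ?thesis
    by (simp only:) (intro Bochner_Integration.integrable_sum integrable_mult_right F)
qed

lemma weighted_integrand_add:
  "weighted_integrand n \<beta> (f + f') g \<theta> = weighted_integrand n \<beta> f g \<theta> + weighted_integrand n \<beta> f' g \<theta>"
proof -
  interpret nonvanishing n "\<lambda>i. cis (\<theta> i)" by (rule nonvanishing_cis)
  show ?thesis by (simp add: weighted_integrand_def laurent_eval_add algebra_simps)
qed

lemma weighted_integrand_scalar:
  "weighted_integrand n \<beta> (scalar c * f) g \<theta> = c * weighted_integrand n \<beta> f g \<theta>"
proof -
  interpret nonvanishing n "\<lambda>i. cis (\<theta> i)" by (rule nonvanishing_cis)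
  show ?thesis by (simp add: weighted_integrand_def laurent_eval_mult laurent_eval_scalar)
qed

text \<open>The factor \<i>^n is what remains of dx_k = \<i> x_k d\<theta>_k after cancellation with
  the 1/x_k of the pairing.\<close>

definition inner_constant :: "nat \<Rightarrow> complex" where
  "inner_constant n = 1 / (2 ^ n * fact n * (2 * of_real pi * \<i>) ^ n) * \<i> ^ n"

lemma inner_constant_nonzero: "inner_constant n \<noteq> 0"
  by (simp add: inner_constant_def)

lemma koornwinder_inner_eq:
  "koornwinder_inner n 0 0 (- \<beta>) 0 0 0 f g = inner_constant n *
     (LINT \<theta>|torus n. weighted_integrand n \<beta> (f * weyl_denominator n) (g * weyl_denominator n) \<theta>)"
proof -
  have "laurent_eval n f (\<lambda>k. cis (\<theta> k)) * laurent_eval n g (\<lambda>i. inverse (cis (\<theta> i))) *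
      koornwinder_density n 0 0 (- \<beta>) 0 0 0 (\<lambda>k. cis (\<theta> k)) * (\<Prod>i\<in>{1..n}. 1 / cis (\<theta> i)) *
      (\<Prod>k\<in>{1..n}. \<i> * cis (\<theta> k))
    = \<i> ^ n * weighted_integrand n \<beta> (f * weyl_denominator n) (g * weyl_denominator n) \<theta>" for \<theta>
  proof -
    interpret E: nonvanishing n "\<lambda>i. cis (\<theta> i)" by (rule nonvanishing_cis)
    interpret E': nonvanishing n "\<lambda>i. cis (- \<theta> i)" by (rule nonvanishing_cis)
    have "(\<Prod>i\<in>{1..n}. 1 / cis (\<theta> i)) * (\<Prod>k\<in>{1..n}. \<i> * cis (\<theta> k)) = \<i> ^ n"
      unfolding prod.distrib[symmetric] by simp
    moreover have "a * b * (c * d * w) * p * q = p * q * (a * c * (b * d) * w)" for a b c d w p q :: complex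
      by simp
    ultimately show ?thesis
      unfolding density_eq[OF E.nonvanishing_axioms order_refl] weighted_integrand_def
      by (simp only: cis_inverse E.laurent_eval_mult E'.laurent_eval_mult)
  qed
  then show ?thesis
    unfolding koornwinder_inner_def torus_integral_def circle_def[symmetric] inner_constant_def by simp
qed

lemma koornwinder_inner_add:
  assumes "norm \<beta> < 1"
  shows "koornwinder_inner n 0 0 (- \<beta>) 0 0 0 (f + f') g
    = koornwinder_inner n 0 0 (- \<beta>) 0 0 0 f g + koornwinder_inner n 0 0 (- \<beta>) 0 0 0 f' g"
  by (simp only: koornwinder_inner_eq distrib_right[of f] weighted_integrand_add distrib_left
      Bochner_Integration.integral_add[OF integrable_weighted_integrand integrable_weighted_integrand, OF assms assms])

lemma koornwinder_inner_scalar: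
  "koornwinder_inner n 0 0 (- \<beta>) 0 0 0 (scalar c * f) g = c * koornwinder_inner n 0 0 (- \<beta>) 0 0 0 f g"
  by (simp add: koornwinder_inner_eq mult.assoc weighted_integrand_scalar)

lemma koornwinder_inner_sum:
  assumes "norm \<beta> < 1"
  shows "koornwinder_inner n 0 0 (- \<beta>) 0 0 0 (\<Sum>a\<in>A. scalar (c a) * f a) g
    = (\<Sum>a\<in>A. c a * koornwinder_inner n 0 0 (- \<beta>) 0 0 0 (f a) g)"
proof (induction A rule: infinite_finite_induct)
  case (insert a A)
  then show ?case by (simp add: koornwinder_inner_add[OF assms] koornwinder_inner_scalar)
qed (use koornwinder_inner_scalar[of n \<beta> 0 0 g] in auto)

lemma koornwinder_inner_minus:
  assumes "norm \<beta> < 1"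
  shows "koornwinder_inner n 0 0 (- \<beta>) 0 0 0 (f - f') g
    = koornwinder_inner n 0 0 (- \<beta>) 0 0 0 f g - koornwinder_inner n 0 0 (- \<beta>) 0 0 0 f' g"
  using koornwinder_inner_add[OF assms, of n "f - f'" f' g] by (simp add: algebra_simps)

text \<open>Read backwards, both sequences are strictly increasing lists, and such a list is
  determined by its set of entries.\<close>

lemma decreasing_values_eq:
  fixes l l' :: "nat \<Rightarrow> int"
  assumes "\<And>i j. i \<in> {1..n} \<Longrightarrow> j \<in> {1..n} \<Longrightarrow> i < j \<Longrightarrow> l j < l i"
    and "\<And>i j. i \<in> {1..n} \<Longrightarrow> j \<in> {1..n} \<Longrightarrow> i < j \<Longrightarrow> l' j < l' i"
    and "l ` {1..n} = l' ` {1..n}" and "j \<in> {1..n}"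
  shows "l j = l' j"
proof -
  have set: "set (map (\<lambda>j. k (n - j)) [0..<n]) = k ` {1..n}" for k :: "nat \<Rightarrow> int"
  proof -
    have "x \<in> (\<lambda>j. n - j) ` {0..<n}" if "x \<in> {1..n}" for x
      by (rule image_eqI[of _ _ "n - x"]) (use that in auto)
    then have "(\<lambda>j. n - j) ` {0..<n} = {1..n}" by auto
    then show ?thesis by (metis image_image set_map set_upt)
  qed
  have "map (\<lambda>j. l (n - j)) [0..<n] = map (\<lambda>j. l' (n - j)) [0..<n]"
  proof (rule strict_sorted_equal)
    show "sorted_wrt (<) (map (\<lambda>j. l (n - j)) [0..<n])" "sorted_wrt (<) (map (\<lambda>j. l' (n - j)) [0..<n])"
      by (auto simp: sorted_wrt_iff_nth_less intro!: assms(1,2))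
  qed (simp only: set assms(3))
  then have "\<forall>j<n. l (n - j) = l' (n - j)" by simp
  from this[rule_format, of "n - j"] show ?thesis using assms(4) by simp
qed

context
  fixes n :: nat
begin

definition shifted :: "exponent \<Rightarrow> nat \<Rightarrow> int" where
  "shifted \<kappa> j = lookup \<kappa> j + int n + 1 - int j"

lemma shifted_ge_1:
  assumes "\<kappa> \<in> partitions n" "j \<in> {1..n}"
  shows "1 \<le> shifted \<kappa> j"
  using assms by (force simp: partitions_def shifted_def)

lemma shifted_decreasing:
  assumes \<kappa>: "\<kappa> \<in> partitions n" and "i \<in> {1..n}" "j \<in> {1..n}" "i < j"
  shows "shifted \<kappa> j < shifted \<kappa> i"
proof -
  have "lookup \<kappa> (i + d) \<le> lookup \<kappa> i" if "i + d \<le> n" for d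
    using that
  proof (induction d)
    case (Suc d)
    have "lookup \<kappa> (i + d + 1) \<le> lookup \<kappa> (i + d)"
      using \<kappa> Suc.prems assms(2) by (auto simp: partitions_def)
    then show ?case using Suc by simp
  qed simp
  from this[of "j - i"] show ?thesis using assms by (simp add: shifted_def)
qed

text \<open>Equal values in permuted order give equal sets of values, and a strictly decreasing
  sequence is determined by its set; this yields \<kappa> = \<mu>. Distinctness of the values then
  yields p = q.\<close>

lemma shifted_permuted_eq:
  assumes \<kappa>: "\<kappa> \<in> partitions n" and \<mu>: "\<mu> \<in> partitions n"
    and p: "p permutes {0..<n}" and q: "q permutes {0..<n}"
    and eq: "\<And>i. i \<in> {0..<n} \<Longrightarrow> shifted \<kappa> (Suc (p i)) = shifted \<mu> (Suc (q i))"
  shows "\<kappa> = \<mu> \<and> p = q"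
proof -
  have im: "(\<lambda>i. k (Suc (r i))) ` {0..<n} = k ` {1..n}" if "r permutes {0..<n}" for k :: "nat \<Rightarrow> int" and r
  proof -
    have "(\<lambda>i. k (Suc (r i))) ` {0..<n} = (\<lambda>i. k (Suc i)) ` r ` {0..<n}" by (simp add: image_image)
    also have "\<dots> = k ` Suc ` {0..<n}" by (simp only: permutes_image[OF that] image_image)
    also have "Suc ` {0..<n} = {1..n}"
      by (simp add: image_Suc_atLeastLessThan atLeastLessThanSuc_atLeastAtMost)
    finally show ?thesis .
  qed
  have "shifted \<kappa> ` {1..n} = (\<lambda>i. shifted \<kappa> (Suc (p i))) ` {0..<n}" by (rule im[OF p, symmetric])
  also have "\<dots> = (\<lambda>i. shifted \<mu> (Suc (q i))) ` {0..<n}" by (rule image_cong[OF refl eq])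
  also have "\<dots> = shifted \<mu> ` {1..n}" by (rule im[OF q])
  finally have "shifted \<kappa> j = shifted \<mu> j" if "j \<in> {1..n}" for j
    by (rule decreasing_values_eq[rotated 2]) (use that shifted_decreasing[OF \<kappa>] shifted_decreasing[OF \<mu>] in auto)
  then have "exponent_of n (lookup \<kappa>) = exponent_of n (lookup \<mu>)"
    by (intro exponent_of_cong) (auto simp: shifted_def)
  then have "\<kappa> = \<mu>" using \<kappa> \<mu> by (simp add: partitions_def exponent_of_lookup)
  moreover have "p i = q i" for i
  proof (cases "i \<in> {0..<n}")
    case True
    then have "Suc (p i) \<in> {1..n}" "Suc (q i) \<in> {1..n}"
      using permutes_in_image[OF p, of i] permutes_in_image[OF q, of i] by auto
    then show ?thesis
      using eq[OF True] shifted_decreasing[OF \<kappa>, of "Suc (p i)" "Suc (q i)"] shifted_decreasing[OF \<kappa>, of "Suc (q i)" "Suc (p i)"] \<open>\<kappa> = \<mu>\<close>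
      by (cases "p i" "q i" rule: linorder_cases) auto
  qed (use p q in \<open>auto simp: permutes_def\<close>)
  ultimately show ?thesis by auto
qed

text \<open>Both determinants are expanded over permutations and each term factors into one-variable
  integrals. By \<open>shifted_permuted_eq\<close> a term survives only for \<kappa> = \<mu> and p =
  q, where the signs square to 1; there are n! such terms, each equal to (4 pi)^n.\<close>

lemma integral_numerators:
  assumes \<beta>: "norm \<beta> < 1" and \<kappa>: "\<kappa> \<in> partitions n" and \<mu>: "\<mu> \<in> partitions n"
  shows "(LINT \<theta>|torus n. weighted_integrand n \<beta> (numerator n \<beta> \<kappa>) (numerator n \<beta> \<mu>) \<theta>)
    = (if \<kappa> = \<mu> then fact n * (4 * of_real pi) ^ n else 0)"
proof -
  interpret product_sigma_finite "\<lambda>_ :: nat. circle" by (rule product_sigma_finite_circle)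
  let ?S = "{p. p permutes {0..<n}}"
  define J where "J l m t = odd_value \<beta> (cis t) l * odd_value \<beta> (cis (- t)) m * weight \<beta> (cis t)" for l m t
  have int: "integrable circle (J l m)" for l m
    unfolding J_def odd_value_def cis_power_int
    by (intro integrable_circle continuous_intros continuous_weight \<beta>)
  define L where "L p q i = J (shifted \<kappa> (Suc (p (i - 1)))) (shifted \<mu> (Suc (q (i - 1))))" for p q :: "nat \<Rightarrow> nat" and i :: nat
  have prod: "(\<Prod>i\<in>{0..<n}. a (Suc i) i) * (\<Prod>i\<in>{0..<n}. b (Suc i) i) * (\<Prod>i\<in>{1..n}. c i)
      = (\<Prod>i\<in>{1..n}. a i (i - 1) * b i (i - 1) * c i)" for a b :: "nat \<Rightarrow> nat \<Rightarrow> complex" and c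
    by (simp only: prod_Suc_shift[symmetric] prod.distrib diff_Suc_1)
  have "weighted_integrand n \<beta> (numerator n \<beta> \<kappa>) (numerator n \<beta> \<mu>) \<theta>
      = (\<Sum>p\<in>?S. \<Sum>q\<in>?S. signof p * signof q * (\<Prod>i\<in>{1..n}. L p q i (\<theta> i)))" for \<theta>
  proof -
    interpret E: nonvanishing n "\<lambda>i. cis (\<theta> i)" by (rule nonvanishing_cis)
    interpret E': nonvanishing n "\<lambda>i. cis (- \<theta> i)" by (rule nonvanishing_cis)
    show ?thesis
      unfolding weighted_integrand_def E.laurent_eval_numerator E'.laurent_eval_numerator shifted_def[symmetric]
        alternant_by_rows sum_product
      unfolding sum_distrib_right
    proof (intro sum.cong refl)
      fix p q
      show "signof p * (\<Prod>i\<in>{0..<n}. odd_value \<beta> (cis (\<theta> (Suc i))) (shifted \<kappa> (Suc (p i)))) *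
          (signof q * (\<Prod>i\<in>{0..<n}. odd_value \<beta> (cis (- \<theta> (Suc i))) (shifted \<mu> (Suc (q i))))) *
          (\<Prod>i\<in>{1..n}. weight \<beta> (cis (\<theta> i)))
        = signof p * signof q * (\<Prod>i\<in>{1..n}. L p q i (\<theta> i))"
        using prod[of "\<lambda>i k. odd_value \<beta> (cis (\<theta> i)) (shifted \<kappa> (Suc (p k)))"
            "\<lambda>i k. odd_value \<beta> (cis (- \<theta> i)) (shifted \<mu> (Suc (q k)))" "\<lambda>i. weight \<beta> (cis (\<theta> i))"]
        by (simp only: L_def J_def mult_ac)
    qed
  qed
  moreover have "integrable (torus n) (\<lambda>\<theta>. \<Prod>i\<in>{1..n}. L p q i (\<theta> i))" for p q
    by (intro product_integrable_prod) (auto simp: L_def int)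
  ultimately have "(LINT \<theta>|torus n. weighted_integrand n \<beta> (numerator n \<beta> \<kappa>) (numerator n \<beta> \<mu>) \<theta>)
     = (\<Sum>p\<in>?S. \<Sum>q\<in>?S. signof p * signof q * (LINT \<theta>|torus n. (\<Prod>i\<in>{1..n}. L p q i (\<theta> i))))"
    by simp
  also have "\<dots> = (\<Sum>p\<in>?S. \<Sum>q\<in>?S. if \<kappa> = \<mu> \<and> p = q then (4 * of_real pi) ^ n else 0)"
  proof (intro sum.cong refl)
    fix p q assume pq: "p \<in> ?S" "q \<in> ?S"
    then have p: "p permutes {0..<n}" and q: "q permutes {0..<n}" by auto
    have "(LINT \<theta>|torus n. (\<Prod>i\<in>{1..n}. L p q i (\<theta> i))) = (\<Prod>i\<in>{1..n}. integral\<^sup>L circle (L p q i))"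
      by (intro product_integral_prod) (auto simp: L_def int)
    also have "\<dots> = (\<Prod>i\<in>{0..<n}. integral\<^sup>L circle (J (shifted \<kappa> (Suc (p i))) (shifted \<mu> (Suc (q i)))))"
      by (simp only: prod_Suc_shift[symmetric] L_def diff_Suc_1)
    also have "\<dots> = (\<Prod>i\<in>{0..<n}. if shifted \<kappa> (Suc (p i)) = shifted \<mu> (Suc (q i)) then 4 * of_real pi else 0)"
    proof (rule prod.cong[OF refl])
      fix i assume "i \<in> {0..<n}"
      then have "Suc (p i) \<in> {1..n}" "Suc (q i) \<in> {1..n}"
        using permutes_in_image[OF p, of i] permutes_in_image[OF q, of i] by auto
      then show "integral\<^sup>L circle (J (shifted \<kappa> (Suc (p i))) (shifted \<mu> (Suc (q i))))
          = (if shifted \<kappa> (Suc (p i)) = shifted \<mu> (Suc (q i)) then 4 * of_real pi else 0)"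
        unfolding J_def by (intro odd_value_orthogonal \<beta> shifted_ge_1 \<kappa> \<mu>)
    qed
    also have "\<dots> = (if \<kappa> = \<mu> \<and> p = q then (4 * of_real pi) ^ n else 0)"
    proof (cases "\<kappa> = \<mu> \<and> p = q")
      case False
      then obtain i where "i \<in> {0..<n}" "shifted \<kappa> (Suc (p i)) \<noteq> shifted \<mu> (Suc (q i))"
        using shifted_permuted_eq[OF \<kappa> \<mu> p q] by blast
      then show ?thesis using False by (intro trans[OF prod_zero]) auto
    qed simp
    finally show "signof p * signof q * (LINT \<theta>|torus n. (\<Prod>i\<in>{1..n}. L p q i (\<theta> i)))
        = (if \<kappa> = \<mu> \<and> p = q then (4 * of_real pi) ^ n else 0)"
      by (simp add: sign_def)
  qed
  also have "\<dots> = (if \<kappa> = \<mu> then fact n * (4 * of_real pi) ^ n else 0)"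
  proof -
    have "card ?S = fact n" by (rule card_permutations) auto
    then show ?thesis by (simp add: finite_permutations)
  qed
  finally show ?thesis .
qed

end

text \<open>The denominators in the density turn both Schur polynomials into numerators. The
  equivalence also records that the norms are nonzero, which the uniqueness proof uses.\<close>

lemma koornwinder_inner_schur_CB:
  assumes "norm \<beta> < 1" and "\<kappa> \<in> partitions n" and "\<mu> \<in> partitions n"
  shows "koornwinder_inner n 0 0 (- \<beta>) 0 0 0 (schur_CB n \<kappa> \<beta>) (schur_CB n \<mu> \<beta>) = 0 \<longleftrightarrow> \<kappa> \<noteq> \<mu>"
  using assms by (simp add: koornwinder_inner_eq schur_CB_times_denominator integral_numerators inner_constant_nonzero
      del: One_nat_def)

section \<open>Uniqueness\<close>

definition dominated :: "nat \<Rightarrow> exponent \<Rightarrow> exponent \<Rightarrow> bool" where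
  "dominated n \<mu> \<kappa> \<longleftrightarrow> (\<forall>k\<in>{1..n}. (\<Sum>i\<in>{1..k}. lookup \<mu> i) \<le> (\<Sum>i\<in>{1..k}. lookup \<kappa> i))"

lemma dominated_refl: "dominated n \<kappa> \<kappa>"
  by (simp add: dominated_def)

lemma dominated_trans: "dominated n \<nu> \<mu> \<Longrightarrow> dominated n \<mu> \<kappa> \<Longrightarrow> dominated n \<nu> \<kappa>"
  by (force simp: dominated_def)

lemma less_exponent_iff:
  "(m :: exponent) < m' \<longleftrightarrow> (\<exists>k. lookup m k < lookup m' k \<and> (\<forall>k'<k. lookup m k' = lookup m' k'))"
  by (simp add: less_poly_mapping.rep_eq less_fun_def)

text \<open>The linear order on exponents is the lexicographic one, which refines dominance.\<close>

lemma dominated_imp_le: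
  assumes "dominated n \<mu> \<kappa>" "\<mu> \<in> int_vectors n" "\<kappa> \<in> int_vectors n"
  shows "\<mu> \<le> \<kappa>"
proof (rule ccontr)
  assume "\<not> \<mu> \<le> \<kappa>"
  then have "\<kappa> < \<mu>" by simp
  \<comment> \<open>At the first index where the vectors differ, the partial sums up to that index
    contradict dominance.\<close>
  then obtain k where k: "lookup \<kappa> k < lookup \<mu> k" "\<And>i. i < k \<Longrightarrow> lookup \<kappa> i = lookup \<mu> i"
    by (auto simp: less_exponent_iff)
  have "k \<in> {1..n}"
  proof (rule ccontr)
    assume "k \<notin> {1..n}"
    then have "lookup \<kappa> k = 0" "lookup \<mu> k = 0"
      using assms by (auto simp: int_vectors_def in_keys_iff subset_iff)
    then show False using k by simp
  qed
  moreover from this obtain j where "k = Suc j" by (cases k) auto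
  moreover from this have "(\<Sum>i\<in>{1..j}. lookup \<kappa> i) = (\<Sum>i\<in>{1..j}. lookup \<mu> i)"
    using k(2) by (intro sum.cong) auto
  ultimately show False
    using assms(1) k(1) by (force simp: dominated_def)
qed

lemma dominated_antisym:
  assumes "dominated n \<mu> \<kappa>" "dominated n \<kappa> \<mu>" "\<mu> \<in> partitions n" "\<kappa> \<in> partitions n"
  shows "\<mu> = \<kappa>"
  using assms dominated_imp_le[of n \<mu> \<kappa>] dominated_imp_le[of n \<kappa> \<mu>] by (auto simp: partitions_def)

text \<open>Parts are nonnegative, so each part of \<nu> is at most a partial sum of \<nu>, which is
  bounded by the corresponding partial sum of \<kappa>.\<close>

lemma finite_dominated: "finite {\<nu> \<in> partitions n. dominated n \<nu> \<kappa>}" (is "finite ?A")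
proof -
  define B where "B k = (\<Sum>i\<in>{1..k}. lookup \<kappa> i)" for k
  have "restrict (lookup \<nu>) {1..n} \<in> PiE {1..n} (\<lambda>k. {0..B k})" if \<nu>: "\<nu> \<in> ?A" for \<nu>
  proof (rule PiE_I)
    fix k assume k: "k \<in> {1..n}"
    have nonneg: "0 \<le> lookup \<nu> i" if "i \<in> {1..k}" for i
      using \<nu> k that by (auto simp: partitions_def)
    then have "lookup \<nu> k \<le> (\<Sum>i\<in>{1..k}. lookup \<nu> i)"
      using k by (intro member_le_sum) auto
    also have "\<dots> \<le> B k" using \<nu> k by (auto simp: dominated_def B_def)
    finally show "restrict (lookup \<nu>) {1..n} k \<in> {0..B k}" using k nonneg[of k] by simp
  qed (auto simp: restrict_def)
  then have "(\<lambda>\<nu>. restrict (lookup \<nu>) {1..n}) ` ?A \<subseteq> PiE {1..n} (\<lambda>k. {0..B k})" by blast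
  moreover have "finite (PiE {1..n} (\<lambda>k. {0..B k}))" by (intro finite_PiE) auto
  ultimately have "finite ((\<lambda>\<nu>. restrict (lookup \<nu>) {1..n}) ` ?A)" by (rule finite_subset)
  moreover have "inj_on (\<lambda>\<nu>. restrict (lookup \<nu>) {1..n}) ?A"
  proof (rule inj_onI)
    fix \<mu> \<nu> assume *: "\<mu> \<in> ?A" "\<nu> \<in> ?A" "restrict (lookup \<mu>) {1..n} = restrict (lookup \<nu>) {1..n}"
    have "lookup \<mu> i = lookup \<nu> i" if "i \<in> {1..n}" for i
      using fun_cong[OF *(3), of i] that by simp
    then have "exponent_of n (lookup \<mu>) = exponent_of n (lookup \<nu>)"
      by (rule exponent_of_cong)
    then show "\<mu> = \<nu>" using * by (simp add: partitions_def exponent_of_lookup)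
  qed
  ultimately show ?thesis by (rule finite_imageD)
qed

section \<open>Invariant Laurent polynomials as combinations of CB-interpolating Schur
  polynomials\<close>

lemma flip_additive:
  fixes m m' :: exponent
  shows "Poly_Mapping.update i (- lookup (m + m') i) (m + m')
    = Poly_Mapping.update i (- lookup m i) m + Poly_Mapping.update i (- lookup m' i) m'"
  by (auto intro!: poly_mapping_eqI simp: lookup_update lookup_add)

lemma lookup_invariant:
  assumes "monomial_subst \<phi> f = f" "inj \<phi>"
  shows "lookup f (\<phi> m) = lookup f m"
proof -
  have "lookup f (\<phi> m) = lookup (monomial_subst \<phi> f) (\<phi> m)" by (simp only: assms(1))
  also have "\<dots> = (\<Sum>k\<in>keys f. if k = m then lookup f k else 0)"
    unfolding monomial_subst_def lookup_sum using assms(2)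
    by (intro sum.cong) (auto simp: lookup_single when_def dest: injD)
  finally show ?thesis by (simp add: in_keys_iff)
qed

text \<open>The lexicographically largest exponent of an invariant polynomial is a partition.\<close>

lemma invariant_eq_0:
  assumes f: "f \<in> laurent_polys n" "bc_invariant n f" and zero: "\<And>\<mu>. \<mu> \<in> partitions n \<Longrightarrow> lookup f \<mu> = 0"
  shows "f = 0"
proof (rule ccontr)
  assume "f \<noteq> 0"
  then have "keys f \<noteq> {}" by simp
  define m where "m = Max (keys f)"
  have m: "m \<in> keys f" unfolding m_def using \<open>keys f \<noteq> {}\<close> by (intro Max_in) auto
  have max: "\<not> m < m'" if "lookup f m' = lookup f m" for m'
  proof -
    have "m' \<in> keys f" using m that by (simp add: in_keys_iff)
    then have "m' \<le> m" unfolding m_def by (intro Max_ge) auto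
    then show ?thesis by simp
  qed
  have "m \<in> partitions n"
    unfolding partitions_def
  proof (intro CollectI conjI ballI)
    show "m \<in> int_vectors n" using f(1) m by (auto simp: laurent_polys_def)
  next
    fix i assume i: "i \<in> {1..n}"
    show "0 \<le> lookup m i"
    proof (rule ccontr)
      assume neg: "\<not> 0 \<le> lookup m i"
      let ?\<phi> = "\<lambda>m :: exponent. Poly_Mapping.update i (- lookup m i) m"
      have "?\<phi> (?\<phi> m) = m" for m
        by (rule poly_mapping_eqI) (simp add: lookup_update)
      then have "inj ?\<phi>" by (rule inj_on_inverseI)
      then have "lookup f (?\<phi> m) = lookup f m"
        using f(2) i by (intro lookup_invariant) (auto simp: bc_invariant_def)
      moreover have "m < ?\<phi> m"
        using neg by (auto simp: less_exponent_iff lookup_update intro!: exI[of _ i])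
      ultimately show False using max by blast
    qed
  next
    fix i assume i: "i \<in> {1..<n}"
    show "lookup m (i + 1) \<le> lookup m i"
    proof (rule ccontr)
      assume less: "\<not> lookup m (i + 1) \<le> lookup m i"
      let ?\<sigma> = "Transposition.transpose i (i + 1)"
      let ?\<phi> = "Poly_Mapping.map_key ?\<sigma> :: exponent \<Rightarrow> exponent"
      have \<sigma>: "?\<sigma> permutes {1..n}" using i by (intro permutes_swap_id) auto
      have lookup: "lookup (?\<phi> m) k = lookup m (?\<sigma> k)" for m k
        using permutes_inj[OF \<sigma>] by (simp add: map_key.rep_eq)
      have "?\<phi> (?\<phi> m) = m" for m
        by (rule poly_mapping_eqI) (simp only: lookup transpose_involutory)
      then have "inj ?\<phi>" by (rule inj_on_inverseI)
      then have "lookup f (?\<phi> m) = lookup f m"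
        using f(2) \<sigma> by (intro lookup_invariant) (auto simp: bc_invariant_def)
      moreover have "m < ?\<phi> m"
        using less unfolding less_exponent_iff lookup by (intro exI[of _ i]) (auto simp: Transposition.transpose_def)
      ultimately show False using max by blast
    qed
  qed
  then show False using zero m by (simp add: in_keys_iff)
qed

lemma bc_invariant_diff:
  assumes "bc_invariant n f" "bc_invariant n g"
  shows "bc_invariant n (f - scalar c * g)"
proof -
  have *: "monomial_subst \<phi> (f - scalar c * g) = f - scalar c * g"
    if "monomial_subst \<phi> f = f" "monomial_subst \<phi> g = g"
      and \<phi>: "\<phi> 0 = 0" "\<And>m m'. \<phi> (m + m') = \<phi> m + \<phi> m'" for \<phi>
  proof -
    interpret monomial_hom scalar "\<lambda>m. single (\<phi> m) 1"
      by (rule monomial_hom_subst[OF \<phi>])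
    show ?thesis
      using that(1,2) by (simp add: monomial_subst_eq_hom[of \<phi>, OF \<phi>] hom_minus hom_mult hom_scalar)
  qed
  have zero: "Poly_Mapping.update i 0 (0 :: exponent) = 0" for i
    by (rule poly_mapping_eqI) (simp add: lookup_update)
  show ?thesis
    using assms unfolding bc_invariant_def
    by (auto intro!: * simp: map_key_plus permutes_inj flip_additive zero)
qed

lemma schur_CB_in_laurent_polys:
  assumes "\<kappa> \<in> partitions n"
  shows "schur_CB n \<kappa> \<beta> \<in> laurent_polys n"
  using schur_CB_keys[OF assms] by (auto simp: laurent_polys_def)

lemma schur_CB_triangular:
  assumes "\<kappa> \<in> partitions n" "lookup (schur_CB n \<kappa> \<beta>) \<mu> \<noteq> 0"
  shows "dominated n \<mu> \<kappa>"
  using schur_CB_keys[OF assms(1), of \<mu> \<beta>] assms(2) by (auto simp: dominated_def in_keys_iff)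

lemma laurent_polys_diff:
  assumes "f \<in> laurent_polys n" "g \<in> laurent_polys n"
  shows "f - scalar c * g \<in> laurent_polys n"
proof -
  have "keys (f - scalar c * g) \<subseteq> keys f \<union> keys g"
    by (auto simp: in_keys_iff lookup_minus scalar_def lookup_single_times)
  then show ?thesis using assms by (auto simp: laurent_polys_def)
qed

text \<open>Triangular elimination. The lexicographic maximum of \<open>A\<close> is dominated by no
  other element, so removing it keeps \<open>A\<close> closed under dominance. Subtracting a
  multiple of its Schur polynomial clears that coefficient, and \<open>invariant_eq_0\<close>
  settles the empty set.\<close>

lemma schur_CB_span:
  assumes "finite A" "A \<subseteq> partitions n"
    and "\<And>\<nu> \<mu>. \<nu> \<in> partitions n \<Longrightarrow> \<mu> \<in> A \<Longrightarrow> dominated n \<nu> \<mu> \<Longrightarrow> \<nu> \<in> A"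
    and "f \<in> laurent_polys n" "bc_invariant n f" "\<And>\<nu>. \<nu> \<in> partitions n \<Longrightarrow> lookup f \<nu> \<noteq> 0 \<Longrightarrow> \<nu> \<in> A"
  shows "\<exists>c. f = (\<Sum>\<mu>\<in>A. scalar (c \<mu>) * schur_CB n \<mu> \<beta>)"
  using assms
proof (induction "card A" arbitrary: A f)
  case 0
  then have "A = {}" by simp
  then have "f = 0" using 0 by (intro invariant_eq_0[of f n]) auto
  then show ?case using \<open>A = {}\<close> by simp
next
  case (Suc d)
  define \<mu> where "\<mu> = Max A"
  define g where "g = f - scalar (lookup f \<mu>) * schur_CB n \<mu> \<beta>"
  have "A \<noteq> {}" using Suc.hyps(2) by auto
  then have \<mu>: "\<mu> \<in> A" unfolding \<mu>_def using Suc.prems(1) by (intro Max_in)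
  then have \<mu>': "\<mu> \<in> partitions n" using Suc.prems(2) by auto
  have lookup_g: "lookup g \<nu> = lookup f \<nu> - lookup f \<mu> * lookup (schur_CB n \<mu> \<beta>) \<nu>" for \<nu>
    by (simp add: g_def lookup_minus scalar_def lookup_single_times)
  have "\<exists>c. g = (\<Sum>\<nu>\<in>A - {\<mu>}. scalar (c \<nu>) * schur_CB n \<nu> \<beta>)"
  proof (rule Suc.hyps(1))
    show "d = card (A - {\<mu>})" using Suc.hyps(2) \<mu> Suc.prems(1) by simp
    show "finite (A - {\<mu>})" "A - {\<mu>} \<subseteq> partitions n" using Suc.prems by auto
    show "\<nu> \<in> A - {\<mu>}" if "\<nu> \<in> partitions n" "\<nu>' \<in> A - {\<mu>}" "dominated n \<nu> \<nu>'" for \<nu> \<nu>'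
    proof -
      have "\<nu> \<in> A" using Suc.prems(3) that by blast
      moreover have "\<nu> \<noteq> \<mu>"
      proof
        assume "\<nu> = \<mu>"
        then have "\<mu> \<le> \<nu>'"
          using that Suc.prems(2) by (intro dominated_imp_le[of n]) (auto simp: partitions_def)
        moreover have "\<nu>' \<le> \<mu>" unfolding \<mu>_def using that Suc.prems(1) by (intro Max_ge) auto
        ultimately show False using that(2) by simp
      qed
      ultimately show ?thesis by blast
    qed
    show "g \<in> laurent_polys n" "bc_invariant n g"
      unfolding g_def using Suc.prems(4,5) \<mu>'
      by (auto intro!: laurent_polys_diff bc_invariant_diff schur_CB_in_laurent_polys schur_CB_bc_invariant)
    show "\<nu> \<in> A - {\<mu>}" if "\<nu> \<in> partitions n" "lookup g \<nu> \<noteq> 0" for \<nu>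
    proof -
      have "\<nu> \<noteq> \<mu>" using that(2) schur_CB_leading[OF \<mu>'] by (auto simp: lookup_g)
      moreover have "lookup f \<nu> \<noteq> 0 \<or> lookup (schur_CB n \<mu> \<beta>) \<nu> \<noteq> 0" using that(2) by (auto simp: lookup_g)
      then have "\<nu> \<in> A"
        using Suc.prems(3)[OF that(1) \<mu>] Suc.prems(6)[OF that(1)] schur_CB_triangular[OF \<mu>'] by blast
      ultimately show ?thesis by blast
    qed
  qed
  then obtain c where c: "g = (\<Sum>\<nu>\<in>A - {\<mu>}. scalar (c \<nu>) * schur_CB n \<nu> \<beta>)" by blast
  have "f = scalar (lookup f \<mu>) * schur_CB n \<mu> \<beta> + g" by (simp add: g_def)
  also have "\<dots> = (\<Sum>\<nu>\<in>A. scalar ((c(\<mu> := lookup f \<mu>)) \<nu>) * schur_CB n \<nu> \<beta>)"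
    unfolding c sum.remove[OF Suc.prems(1) \<mu>] by (auto intro!: sum.cong)
  finally show ?case by blast
qed

lemma is_koornwinder_family_schur_CB:
  assumes "norm \<beta> < 1"
  shows "is_koornwinder_family n 0 0 (- \<beta>) 0 0 0 (\<lambda>\<kappa>\<in>partitions n. schur_CB n \<kappa> \<beta>)"
proof -
  have "lookup (schur_CB n \<kappa> \<beta>) \<mu> = 0" if "\<kappa> \<in> partitions n" "\<not> dominated n \<mu> \<kappa>" for \<kappa> \<mu>
    using schur_CB_triangular that by blast
  then show ?thesis
    unfolding is_koornwinder_family_def dominated_def[symmetric]
    using koornwinder_inner_schur_CB[OF assms]
    by (auto simp: schur_CB_in_laurent_polys schur_CB_bc_invariant schur_CB_leading)
qed

text \<open>By triangularity K \<kappa> minus the Schur polynomial is a combination of Schur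
  polynomials of strictly dominated \<mu>, where both families agree by induction. Pairing with
  these gives 0, and the nonzero norms make every coefficient vanish. Dominance is only partial, so
  the induction counts dominated partitions.\<close>

lemma koornwinder_family_unique:
  assumes \<beta>: "norm \<beta> < 1" and K: "is_koornwinder_family n 0 0 (- \<beta>) 0 0 0 K"
    and \<kappa>: "\<kappa> \<in> partitions n"
  shows "K \<kappa> = schur_CB n \<kappa> \<beta>"
  using \<kappa>
proof (induction \<kappa> rule: measure_induct_rule[where f = "\<lambda>\<kappa>. card {\<nu> \<in> partitions n. dominated n \<nu> \<kappa>}"])
  case (less \<kappa>)
  note \<kappa> = less.prems
  let ?S = "\<lambda>\<kappa>. schur_CB n \<kappa> \<beta>" and ?inner = "koornwinder_inner n 0 0 (- \<beta>) 0 0 0"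
  note K' = K[unfolded is_koornwinder_family_def dominated_def[symmetric]]
  define A where "A = {\<nu> \<in> partitions n. dominated n \<nu> \<kappa>} - {\<kappa>}"
  have fin: "finite A" by (simp add: A_def finite_dominated)
  have IH: "K \<mu> = ?S \<mu>" if "\<mu> \<in> A" for \<mu>
  proof (rule less.IH)
    have \<mu>: "\<mu> \<in> partitions n" "dominated n \<mu> \<kappa>" "\<mu> \<noteq> \<kappa>" using that by (auto simp: A_def)
    show "card {\<nu> \<in> partitions n. dominated n \<nu> \<mu>} < card {\<nu> \<in> partitions n. dominated n \<nu> \<kappa>}"
    proof (rule psubset_card_mono[OF finite_dominated])
      have "\<not> dominated n \<kappa> \<mu>" using \<mu> \<kappa> dominated_antisym by blast
      then show "{\<nu> \<in> partitions n. dominated n \<nu> \<mu>} \<subset> {\<nu> \<in> partitions n. dominated n \<nu> \<kappa>}"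
        using \<mu> \<kappa> dominated_trans dominated_refl by blast
    qed
    show "\<mu> \<in> partitions n" by fact
  qed
  \<comment> \<open>The factor \<open>scalar 1\<close> brings the difference into the form of
    \<open>laurent_polys_diff\<close> and \<open>bc_invariant_diff\<close>.\<close>
  define f where "f = K \<kappa> - scalar 1 * ?S \<kappa>"
  have f: "f = K \<kappa> - ?S \<kappa>" by (simp add: f_def scalar_def)
  have "\<exists>c. f = (\<Sum>\<mu>\<in>A. scalar (c \<mu>) * ?S \<mu>)"
  proof (rule schur_CB_span[OF fin])
    show "A \<subseteq> partitions n" by (auto simp: A_def)
    show "\<nu> \<in> A" if "\<nu> \<in> partitions n" "\<mu> \<in> A" "dominated n \<nu> \<mu>" for \<nu> \<mu>
      using that \<kappa> dominated_trans dominated_antisym unfolding A_def by blast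
    show "f \<in> laurent_polys n" "bc_invariant n f"
      unfolding f_def using K' \<kappa>
      by (auto intro!: laurent_polys_diff bc_invariant_diff schur_CB_in_laurent_polys schur_CB_bc_invariant)
    show "\<nu> \<in> A" if "\<nu> \<in> partitions n" "lookup f \<nu> \<noteq> 0" for \<nu>
    proof -
      have "\<nu> \<noteq> \<kappa>" using that(2) K' \<kappa> schur_CB_leading[OF \<kappa>] by (auto simp: f lookup_minus)
      moreover have "lookup (K \<kappa>) \<nu> \<noteq> 0 \<or> lookup (?S \<kappa>) \<nu> \<noteq> 0" using that(2) by (auto simp: f lookup_minus)
      ultimately show ?thesis
        using that(1) K' \<kappa> schur_CB_triangular[OF \<kappa>] unfolding A_def by blast
    qed
  qed
  then obtain c where c: "f = (\<Sum>\<mu>\<in>A. scalar (c \<mu>) * ?S \<mu>)" by blast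
  have "c \<mu> = 0" if \<mu>: "\<mu> \<in> A" for \<mu>
  proof -
    have \<mu>': "\<mu> \<in> partitions n" "\<mu> \<noteq> \<kappa>" using \<mu> by (auto simp: A_def)
    have "?inner (K \<kappa>) (K \<mu>) = 0"
      using K'[THEN conjunct2, THEN conjunct1, rule_format, OF \<kappa> \<mu>'(1)] \<mu>'(2) by simp
    moreover have "?inner (?S \<kappa>) (?S \<mu>) = 0" using koornwinder_inner_schur_CB[OF \<beta> \<kappa> \<mu>'(1)] \<mu>'(2) by blast
    ultimately have "?inner f (?S \<mu>) = 0"
      unfolding f using IH[OF \<mu>] by (simp add: koornwinder_inner_minus[OF \<beta>])
    then have "0 = (\<Sum>\<nu>\<in>A. c \<nu> * ?inner (?S \<nu>) (?S \<mu>))"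
      unfolding c by (simp add: koornwinder_inner_sum[OF \<beta>])
    also have "\<dots> = (\<Sum>\<nu>\<in>A. if \<nu> = \<mu> then c \<mu> * ?inner (?S \<mu>) (?S \<mu>) else 0)"
    proof (rule sum.cong[OF refl])
      fix \<nu> assume "\<nu> \<in> A"
      then have "\<nu> \<in> partitions n" by (simp add: A_def)
      then show "c \<nu> * ?inner (?S \<nu>) (?S \<mu>) = (if \<nu> = \<mu> then c \<mu> * ?inner (?S \<mu>) (?S \<mu>) else 0)"
        using koornwinder_inner_schur_CB[OF \<beta> _ \<mu>'(1), of \<nu>] by auto
    qed
    also have "\<dots> = c \<mu> * ?inner (?S \<mu>) (?S \<mu>)"
      using fin \<mu> by simp
    finally show ?thesis
      using koornwinder_inner_schur_CB[OF \<beta> \<mu>'(1) \<mu>'(1)] by auto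
  qed
  then have "f = 0" unfolding c by (intro sum.neutral) (simp add: scalar_def)
  then show ?case by (simp add: f)
qed

theorem mainTheorem4:
  fixes n :: nat and \<beta> :: complex and \<kappa> :: exponent
  assumes "n \<ge> 1" and "norm \<beta> < 1" and "\<kappa> \<in> partitions n"
  shows "schur_CB n \<kappa> \<beta> = koornwinder n 0 0 (- \<beta>) 0 0 0 \<kappa>"
proof -
  have "koornwinder n 0 0 (- \<beta>) 0 0 0 = (\<lambda>\<kappa>\<in>partitions n. schur_CB n \<kappa> \<beta>)"
    unfolding koornwinder_def
  proof (rule the_equality)
    show "(\<lambda>\<kappa>\<in>partitions n. schur_CB n \<kappa> \<beta>) \<in> extensional (partitions n) \<and>
        is_koornwinder_family n 0 0 (- \<beta>) 0 0 0 (\<lambda>\<kappa>\<in>partitions n. schur_CB n \<kappa> \<beta>)"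
      using is_koornwinder_family_schur_CB[OF assms(2)] by simp
  next
    fix K assume K: "K \<in> extensional (partitions n) \<and> is_koornwinder_family n 0 0 (- \<beta>) 0 0 0 K"
    show "K = (\<lambda>\<kappa>\<in>partitions n. schur_CB n \<kappa> \<beta>)"
      using K koornwinder_family_unique[OF assms(2), of n K]
      by (intro extensionalityI[of _ "partitions n"]) auto
  qed
  then show ?thesis using assms(3) by simp
qed

end
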